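(* Let $q\in(0,1)$, $m\in\mathbb{Z}_{\ge1}$, $\vec x=(x_1>\dots>x_m\ge 0)\in\mathbb{W}_m$, and let $\vec y(t)=(y_1(t)>\dots>y_m(t))$, $t\in\mathbb{Z}_{\ge0}$, be the trajectory of the Markov chain $\Upsilon_m$ started from $\vec y(0)=\vec x$. View the trajectory as a random point configuration $\{(y_j(t),t): 1\le j\le m,\ t\ge0\}\subset\mathbb{Z}_{\ge0}^2$. Then this configuration forms a determinantal point process: for any $\ell\ge1$ and any pairwise distinct points $(u_1,t_1),\dots,(u_\ell,t_\ell)$ with $u_i\in\mathbb{Z}_{\ge0}$, $t_i\in\mathbb{Z}_{\ge1}$, $$\mathrm{Prob}\big(\text{the random configuration contains all } (u_i,t_i),\ i=1,\dots,\ell\big)=\det\big[K_{\mathrm{walks}}(u_i,t_i;u_j,t_j)\big]_{i,j=1}^{\ell},$$ where, for $y_1,y_2\in\mathbb{Z}$, $t_1\in\mathbb{Z}_{\ge0}$, $t_2\in\mathbb{Z}_{>0}$, $$\begin{aligned}K_{\mathrm{walks}}(y_1,t_1;y_2,t_2)=\ &\mathbf{1}_{t_1=t_2}\mathbf{1}_{y_1=y_2}-\mathbf{1}_{t_2>t_1}\mathbf{1}_{y_2+t_2>y_1+t_1}\frac{q^{(t_1-t_2)(y_1+t_1)}(q^{y_1-y_2+t_1-t_2+1};q)_{t_2-t_1-1}}{(q;q)_{t_2-t_1-1}}\\ &-\frac{q^{-t_1-y_1}}{(2\pi\mathbf{i})^2}\oint\oint dz\,dw\,\frac{z^{-t_2}w^{t_1}}{w-z}\,\frac{(q;q)_{t_1}}{(wq^{-y_1-t_1};q)_{t_1+1}}\,\frac{(zq^{1-y_2-t_2};q)_{t_2-1}}{(q;q)_{t_2-1}}\,\frac{(w^{-1};q)_\infty}{(z^{-1};q)_\infty}\prod_{r=1}^m\frac{1-q^{x_r}/z}{1-q^{x_r}/w}.\end{aligned}$$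 Here both contours are positively oriented, the $w$ contour is an arbitrarily small circle around $0$, and the $z$ contour goes around $q^{y_2+t_2},q^{y_2+t_2+1},q^{y_2+t_2+2},\dots$, around $0$ and the $w$ contour, and encircles no other $z$-poles of the integrand.
   Context: $\mathbb{W}_m=\{\vec x=(x_1>x_2>\dots>x_m\ge0)\}\subset\mathbb{Z}_{\ge0}^m$, and $|\vec x|=x_1+\dots+x_m$. The chain $\Upsilon_m$ (noncolliding $q$-exchangeable random walks) is the discrete-time Markov chain on $\mathbb{W}_m$ with one-step transition probabilities $$\Upsilon_m(\vec x,\vec y)=q^{-\binom m2+(m-1)(|\vec x|-|\vec y|)}\prod_{1\le i<j\le m}\frac{q^{y_j}-q^{y_i}}{q^{x_j}-q^{x_i}}\ \prod_{i=1}^m\big(q^{x_i}\mathbf{1}_{y_i=x_i}+(1-q^{x_i})\mathbf{1}_{y_i=x_i-1}\big),\qquad \vec x,\vec y\in\mathbb{W}_m.$$ (It is known that these are nonnegative and sum to $1$ over $\vec y\in\mathbb{W}_m$.) Notation: $(a;q)_k=(1-a)(1-aq)\cdots(1-aq^{k-1})$ for $k\in\mathbb{Z}_{\ge0}$, $(a;q)_\infty=\prod_{i\ge0}(1-aq^i)$, $\mathbf{1}_A$ is the indicator of $A$, and $\mathbf{i}=\sqrt{-1}$. *)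

theory Defs
  imports
    "HOL-Probability.Probability"
    "HOL-Complex_Analysis.Complex_Analysis"
    "Jordan_Normal_Form.Determinant"
begin

definition qpoch :: "'a :: comm_ring_1 \<Rightarrow> 'a \<Rightarrow> nat \<Rightarrow> 'a" where
  "qpoch a q k = (\<Prod>i<k. 1 - a * q ^ i)"

definition qpoch_inf :: "complex \<Rightarrow> complex \<Rightarrow> complex" where
  "qpoch_inf a q = prodinf (\<lambda>i. 1 - a * q ^ i)"

(* A vector (x_1 > ... > x_m) is a list of length m, so x_r is x ! (r - 1). *)
definition W :: "nat \<Rightarrow> nat list set" where
  "W m = {x. length x = m \<and> sorted_wrt (>) x}"

definition Upsilon :: "real \<Rightarrow> nat \<Rightarrow> nat list \<Rightarrow> nat list \<Rightarrow> real" where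
  "Upsilon q m x y =
     q powi (- int (m choose 2) + (int m - 1) * (int (sum_list x) - int (sum_list y)))
     * (\<Prod>(i, j) \<in> {(i, j). i < j \<and> j < m}.
          (q ^ (y ! j) - q ^ (y ! i)) / (q ^ (x ! j) - q ^ (x ! i)))
     * (\<Prod>i<m. q ^ (x ! i) * of_bool (int (y ! i) = int (x ! i))
               + (1 - q ^ (x ! i)) * of_bool (int (y ! i) = int (x ! i) - 1))"

(* Y is a time-homogeneous Markov chain on the countable set S with one-step transition
   probabilities P, started from x; cond_prob is only constrained when the
   conditioning event has positive probability. *)
definition markov_chain ::
  "'w measure \<Rightarrow> 's set \<Rightarrow> ('s \<Rightarrow> 's \<Rightarrow> real) \<Rightarrow> 's \<Rightarrow> (nat \<Rightarrow> 'w \<Rightarrow> 's) \<Rightarrow> bool" where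
  "markov_chain M S P x Y \<longleftrightarrow>
     prob_space M \<and>
     (\<forall>t. Y t \<in> measurable M (count_space S)) \<and>
     (AE \<omega> in M. Y 0 \<omega> = x) \<and>
     (\<forall>t s. (\<forall>i\<le>Suc t. s i \<in> S) \<longrightarrow>
        measure M {\<omega> \<in> space M. \<forall>i\<le>t. Y i \<omega> = s i} > 0 \<longrightarrow>
        cond_prob M (\<lambda>\<omega>. Y (Suc t) \<omega> = s (Suc t)) (\<lambda>\<omega>. \<forall>i\<le>t. Y i \<omega> = s i)
          = P (s t) (s (Suc t)))"

definition configuration :: "nat \<Rightarrow> (nat \<Rightarrow> 'w \<Rightarrow> nat list) \<Rightarrow> 'w \<Rightarrow> (nat \<times> nat) set" where
  "configuration m Y \<omega> = {(Y t \<omega> ! j, t) | j t. j < m}"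

definition walks_integrand ::
  "complex \<Rightarrow> nat list \<Rightarrow> int \<Rightarrow> nat \<Rightarrow> int \<Rightarrow> nat \<Rightarrow> complex \<Rightarrow> complex \<Rightarrow> complex" where
  "walks_integrand q x y1 t1 y2 t2 w z =
     z powi (- int t2) * w ^ t1 / (w - z)
     * (qpoch q q t1 / qpoch (w * q powi (- y1 - int t1)) q (t1 + 1))
     * (qpoch (z * q powi (1 - y2 - int t2)) q (t2 - 1) / qpoch q q (t2 - 1))
     * (qpoch_inf (inverse w) q / qpoch_inf (inverse z) q)
     * (\<Prod>r<length x. (1 - q ^ (x ! r) / z) / (1 - q ^ (x ! r) / w))"

definition winds :: "(real \<Rightarrow> complex) \<Rightarrow> int \<Rightarrow> complex \<Rightarrow> bool" where
  "winds \<gamma> n p \<longleftrightarrow> p \<notin> path_image \<gamma> \<and> winding_number \<gamma> p = of_int n"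

(* The w contour is the circle of radius \<epsilon> around 0, so small that no factor in the
   denominator depending on w alone vanishes for 0 < |w| \<le> \<epsilon>. The z contour \<gamma> is any
   positively oriented simple closed curve, avoiding the zeros of (1/z; q)_infinity, that winds
   around 0, the w contour and all q^(y2+t2+k), but around no other z-pole of the integrand.
   Zeros of (1/z; q)_infinity which are cancelled by a numerator are not poles, and
   \<gamma> may or may not enclose them. *)
definition admissible_contours ::
  "complex \<Rightarrow> nat list \<Rightarrow> int \<Rightarrow> nat \<Rightarrow> int \<Rightarrow> nat \<Rightarrow> real \<Rightarrow> (real \<Rightarrow> complex) \<Rightarrow> bool" where
  "admissible_contours q x y1 t1 y2 t2 \<epsilon> \<gamma> \<longleftrightarrow>
     \<epsilon> > 0 \<and>
     (\<forall>w. 0 < norm w \<and> norm w \<le> \<epsilon> \<longrightarrow>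
        qpoch (w * q powi (- y1 - int t1)) q (t1 + 1) \<noteq> 0 \<and>
        (\<forall>r<length x. 1 - q ^ (x ! r) / w \<noteq> 0)) \<and>
     valid_path \<gamma> \<and> simple_path \<gamma> \<and> pathfinish \<gamma> = pathstart \<gamma> \<and>
     (\<forall>z\<in>path_image \<gamma>. qpoch_inf (inverse z) q \<noteq> 0) \<and>
     winds \<gamma> 1 0 \<and>
     (\<forall>w\<in>path_image (circlepath 0 \<epsilon>). winds \<gamma> 1 w) \<and>
     (\<forall>k. winds \<gamma> 1 (q powi (y2 + int t2 + int k))) \<and>
     (\<forall>w\<in>path_image (circlepath 0 \<epsilon>). \<forall>p.
        is_pole (walks_integrand q x y1 t1 y2 t2 w) p \<and>
        p \<noteq> 0 \<and> p \<notin> path_image (circlepath 0 \<epsilon>) \<and>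
        p \<notin> range (\<lambda>k. q powi (y2 + int t2 + int k)) \<longrightarrow> winds \<gamma> 0 p)"

(* \<epsilon> and \<gamma> choose the radius of the w contour and the z contour for each argument
   (y1, t1; y2, t2); the kernel is used for t2 > 0 only. *)
definition K_walks ::
  "complex \<Rightarrow> nat list \<Rightarrow> (int \<Rightarrow> nat \<Rightarrow> int \<Rightarrow> nat \<Rightarrow> real)
     \<Rightarrow> (int \<Rightarrow> nat \<Rightarrow> int \<Rightarrow> nat \<Rightarrow> real \<Rightarrow> complex) \<Rightarrow> int \<Rightarrow> nat \<Rightarrow> int \<Rightarrow> nat \<Rightarrow> complex" where
  "K_walks q x \<epsilon> \<gamma> y1 t1 y2 t2 =
     of_bool (t1 = t2) * of_bool (y1 = y2)
     - of_bool (t2 > t1) * of_bool (y2 + int t2 > y1 + int t1)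
       * (q powi ((int t1 - int t2) * (y1 + int t1))
          * qpoch (q powi (y1 - y2 + int t1 - int t2 + 1)) q (t2 - t1 - 1)
          / qpoch q q (t2 - t1 - 1))
     - q powi (- int t1 - y1) / (2 * of_real pi * \<i>)\<^sup>2
       * contour_integral (circlepath 0 (\<epsilon> y1 t1 y2 t2)) (\<lambda>w.
           contour_integral (\<gamma> y1 t1 y2 t2) (\<lambda>z. walks_integrand q x y1 t1 y2 t2 w z))"

lemma qpoch_inf_holomorphic:
  fixes q :: real
  assumes "0 < q" "q < 1"
  shows "(\<lambda>a. qpoch_inf a (of_real q)) holomorphic_on UNIV"
    and "\<And>a. convergent_prod (\<lambda>i. 1 - a * complex_of_real q ^ i)"
proof -
  show cv: "convergent_prod (\<lambda>i. 1 - a * complex_of_real q ^ i)" for a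
  proof -
    have "summable (\<lambda>i. norm (a * complex_of_real q ^ i))"
      using assms by (simp add: norm_mult norm_power summable_mult)
    hence "summable (\<lambda>i. norm ((1 - a * complex_of_real q ^ i) - 1))" by simp
    thus ?thesis
      by (intro abs_convergent_prod_imp_convergent_prod summable_imp_abs_convergent_prod)
  qed
  have ul: "uniform_limit (cball b 1) (\<lambda>N a. \<Prod>i<N. 1 - a * complex_of_real q ^ i)
          (\<lambda>a. qpoch_inf a (of_real q)) sequentially" for b
  proof -
    have "uniformly_convergent_on (cball b 1) (\<lambda>N a. \<Prod>i<N. 1 - a * complex_of_real q ^ i)"
    proof (rule uniformly_convergent_on_prod')
      show "uniformly_convergent_on (cball b 1)
              (\<lambda>N a. \<Sum>i<N. norm ((1 - a * complex_of_real q ^ i) - 1))"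
      proof (rule Weierstrass_m_test'[where M = "\<lambda>i. (norm b + 1) * q ^ i"])
        show "summable (\<lambda>i. (norm b + 1) * q ^ i)" using assms by (intro summable_mult) auto
        fix i a assume "a \<in> cball b 1"
        hence "norm a \<le> norm b + 1"
          using norm_triangle_sub[of a b] by (simp add: dist_norm norm_minus_commute)
        thus "norm (norm (1 - a * complex_of_real q ^ i - 1)) \<le> (norm b + 1) * q ^ i"
          using assms by (simp add: norm_mult norm_power mult_right_mono)
      qed
    qed (auto intro!: continuous_intros)
    then obtain l where l: "uniform_limit (cball b 1) (\<lambda>N a. \<Prod>i<N. 1 - a * complex_of_real q ^ i) l sequentially"
      by (auto simp: uniformly_convergent_on_def)
    have "l a = qpoch_inf a (of_real q)" if "a \<in> cball b 1" for a
    proof (rule LIMSEQ_unique[OF tendsto_uniform_limitI[OF l that]])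
      show "(\<lambda>N. \<Prod>i<N. 1 - a * complex_of_real q ^ i) \<longlonglongrightarrow> qpoch_inf a (of_real q)"
        using convergent_prod_LIMSEQ[OF cv[of a]]
        unfolding qpoch_inf_def by (simp add: LIMSEQ_lessThan_iff_atMost)
    qed
    thus ?thesis by (intro uniform_limit_cong'[THEN iffD1, OF _ _ l]) simp_all
  qed
  show "(\<lambda>a. qpoch_inf a (of_real q)) holomorphic_on UNIV"
  proof (rule holomorphic_uniform_sequence[where f = "\<lambda>N a. \<Prod>i<N. 1 - a * complex_of_real q ^ i"])
    show "(\<lambda>a. \<Prod>i<N. 1 - a * complex_of_real q ^ i) holomorphic_on UNIV" for N
      by (intro holomorphic_intros)
    show "\<exists>d>0. cball b d \<subseteq> UNIV \<and> uniform_limit (cball b d)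
            (\<lambda>N a. \<Prod>i<N. 1 - a * complex_of_real q ^ i) (\<lambda>a. qpoch_inf a (of_real q)) sequentially" for b
      using ul[of b] by (intro exI[of _ 1]) simp
  qed simp
qed

lemma walks_integrand_reassoc:
  fixes a :: "'a :: field"
  shows "a * b / c * (d / e) * (f / g) * (h / i) * (j / k) = a / c * f / i * j * (b * (d / e) / g * h / k)"
  by (simp add: divide_inverse mult_ac)

lemma winds_circle_in: "norm p < R \<Longrightarrow> winds (circlepath 0 R) 1 p"
  by (auto simp: winds_def winding_number_circlepath path_image_circlepath)

lemma winds_circle_out: 
  assumes "0 \<le> R" "norm p > R" shows "winds (circlepath 0 R) 0 p"
proof -
  have "winding_number (circlepath 0 R) p = 0"
    by (rule winding_number_zero_outside[where s = "cball 0 R"]) (use assms in \<open>auto simp: path_image_circlepath\<close>)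
  with assms show ?thesis by (auto simp: winds_def)
qed

(* The contour condition is satisfiable for all arguments of the kernel. *)
lemma admissible_contours_exist:
  fixes q :: real
  assumes q: "0 < q" "q < 1"
  shows "\<exists>\<epsilon> \<gamma>. admissible_contours (of_real q) x y1 t1 y2 t2 \<epsilon> \<gamma>"
proof -
  define n where "n = y2 + int t2"
  let ?q = "complex_of_real q"
  have mono: "q powi a < q powi b \<longleftrightarrow> b < a" for a b :: int
    by (metis assms(1,2) linorder_neqE_linordered_idom not_less_iff_gr_or_eq power_int_strict_decreasing)
  have pos: "q powi a > 0" for a :: int using q by simp
  define R where "R = (q powi n + q powi (n - 1)) / 2"
  have "q powi n < q powi (n - 1)" using mono by simp
  hence R: "q powi n < R" "R < q powi (n - 1)" by (auto simp: R_def)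
  have R0: "R > 0" using R(1) pos[of n] by linarith
  define b where "b = min R (min (q powi (y1 + int t1)) (q ^ sum_list x))"
  define \<epsilon> where "\<epsilon> = b / 2"
  have b: "b > 0" using R0 q by (auto simp: b_def)
  have e: "\<epsilon> > 0" "\<epsilon> < R" "\<epsilon> < q powi (y1 + int t1)" "\<epsilon> < q ^ sum_list x"
    using b unfolding \<epsilon>_def by (auto simp: b_def min_def split: if_splits)
  have nq: "norm (?q powi a) = q powi a" for a :: int
    using q by (simp add: norm_power_int)
  have nz: "qpoch_inf (inverse z) ?q \<noteq> 0" if "\<And>k. z \<noteq> ?q ^ k" "z \<noteq> 0" for z
    unfolding qpoch_inf_def
    by (rule prodinf_nonzero[OF qpoch_inf_holomorphic(2)[OF q]]) (use that in \<open>auto simp: field_simps\<close>)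
  have c1: "qpoch (w * ?q powi (- y1 - int t1)) ?q (t1 + 1) \<noteq> 0" if "w \<noteq> 0" "norm w \<le> \<epsilon>" for w
  proof
    assume "qpoch (w * ?q powi (- y1 - int t1)) ?q (t1 + 1) = 0"
    then obtain i where i: "i \<le> t1" "w * ?q powi (- y1 - int t1) * ?q ^ i = 1"
      by (auto simp: qpoch_def less_Suc_eq_le simp del: prod.lessThan_Suc)
    hence "norm (w * ?q powi (- y1 - int t1) * ?q ^ i) = 1" by simp
    hence "norm w * (q powi (- y1 - int t1) * q ^ i) = 1"
      using q by (simp add: norm_mult norm_power nq mult_ac)
    moreover have "norm w * (q powi (- y1 - int t1) * q ^ i) \<le> norm w * (q powi (- y1 - int t1) * 1)"
      by (rule mult_left_mono[OF mult_left_mono]) (use q pos in \<open>auto intro: power_le_one less_imp_le\<close>)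
    moreover have "norm w * (q powi (- y1 - int t1) * 1) < q powi (y1 + int t1) * (q powi (- y1 - int t1) * 1)"
      by (rule mult_strict_right_mono) (use that e pos in auto)
    moreover have "q powi (y1 + int t1) * (q powi (- y1 - int t1) * 1) = 1"
      using q by (simp flip: power_int_add)
    ultimately show False by simp
  qed
  have c2: "1 - ?q ^ (x ! r) / w \<noteq> 0" if "w \<noteq> 0" "norm w \<le> \<epsilon>" "r < length x" for w r
  proof
    assume "1 - ?q ^ (x ! r) / w = 0"
    hence "w = ?q ^ (x ! r)" using that by (simp add: field_simps)
    hence "norm w = q ^ (x ! r)" using q by (simp add: norm_power)
    moreover have "q ^ (x ! r) \<ge> q ^ sum_list x"
      using q that by (intro power_decreasing) (auto intro: elem_le_sum_list)
    ultimately show False using that e by simp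
  qed
  have c3: "winds (circlepath 0 R) 0 p"
    if w: "norm w = \<epsilon>" and p: "is_pole (walks_integrand ?q x y1 t1 y2 t2 w) p" "p \<noteq> 0" "norm p \<noteq> \<epsilon>"
      "p \<notin> range (\<lambda>k. ?q powi (n + int k))" for w p
  proof -
    have "\<exists>k. p = ?q ^ k"
    proof (rule ccontr)
      assume "\<nexists>k. p = ?q ^ k"
      hence pk: "p \<noteq> ?q ^ k" for k by blast
      define D where "D = {z. z \<noteq> 0 \<and> z \<noteq> w \<and> qpoch_inf (inverse z) ?q \<noteq> 0}"
      have h: "(\<lambda>z. qpoch_inf (inverse z) ?q) holomorphic_on -{0}"
      proof -
        have "(\<lambda>z. inverse z) holomorphic_on -{0 :: complex}" by (intro holomorphic_intros) auto
        from holomorphic_on_compose_gen[OF this qpoch_inf_holomorphic(1)[OF q]]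
        show ?thesis by (simp add: o_def)
      qed
      have "open D"
      proof -
        have "open (-{0 :: complex})" by auto
        hence "open {z \<in> -{0}. qpoch_inf (inverse z) ?q \<in> -{0}}"
          using continuous_open_preimage[OF holomorphic_on_imp_continuous_on[OF h], of "-{0}"]
          by (auto simp: vimage_def Int_def)
        moreover have "D = {z \<in> -{0}. qpoch_inf (inverse z) ?q \<in> -{0}} \<inter> -{w}" by (auto simp: D_def)
        ultimately show ?thesis by auto
      qed
      moreover have "p \<in> D" using pk p w nz by (auto simp: D_def)
      moreover have "walks_integrand ?q x y1 t1 y2 t2 w holomorphic_on D"
      proof -
        have "(\<lambda>z. qpoch_inf (inverse z) ?q) holomorphic_on D"
          by (rule holomorphic_on_subset[OF h]) (auto simp: D_def)
        hence hol: "(\<lambda>z. z powi (- int t2) / (w - z) * (\<Prod>i<t2 - 1. 1 - (z * ?q powi (1 - y2 - int t2)) * ?q ^ i)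
                / qpoch_inf (inverse z) ?q * (\<Prod>r<length x. 1 - ?q ^ (x ! r) / z) * C) holomorphic_on D" for C
          by (intro holomorphic_on_mult holomorphic_on_divide holomorphic_on_prod holomorphic_on_diff
                holomorphic_on_power_int holomorphic_on_const holomorphic_on_ident) (auto simp: D_def)
        define C where "C = w ^ t1 * (qpoch ?q ?q t1 / qpoch (w * ?q powi (- y1 - int t1)) ?q (t1 + 1))
                   / qpoch ?q ?q (t2 - 1) * qpoch_inf (inverse w) ?q
                   / (\<Prod>r<length x. 1 - ?q ^ (x ! r) / w)"
        have "walks_integrand ?q x y1 t1 y2 t2 w =
            (\<lambda>z. z powi (- int t2) / (w - z) * (\<Prod>i<t2 - 1. 1 - (z * ?q powi (1 - y2 - int t2)) * ?q ^ i)
                / qpoch_inf (inverse z) ?q * (\<Prod>r<length x. 1 - ?q ^ (x ! r) / z) * C)"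
          unfolding walks_integrand_def C_def prod_dividef qpoch_def[of "_ * _ powi (1 - _ - _)"]
          by (rule ext, rule walks_integrand_reassoc)
        with hol show ?thesis by simp
      qed
      ultimately show False using not_is_pole_holomorphic p(1) by blast
    qed
    then obtain k where k: "p = ?q ^ k" by blast
    have "int k < n"
    proof (rule ccontr)
      assume "\<not> int k < n"
      hence "p = ?q powi (n + int (nat (int k - n)))" using k by simp
      thus False using p by blast
    qed
    hence "q powi (n - 1) \<le> q powi (int k)" using mono[of "int k" "n - 1"] by linarith
    hence "norm p > R" using k q R by (simp add: norm_power)
    thus ?thesis using winds_circle_out R0 by simp
  qed
  have "admissible_contours ?q x y1 t1 y2 t2 \<epsilon> (circlepath 0 R)"
    unfolding admissible_contours_def n_def[symmetric]
  proof (intro conjI ballI allI impI)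
    show "simple_path (circlepath 0 R)" using R0 by (simp add: simple_path_circlepath)
    fix z assume "z \<in> path_image (circlepath 0 R)"
    hence z: "norm z = R" using R0 by simp
    show "qpoch_inf (inverse z) ?q \<noteq> 0"
    proof (rule nz)
      show "z \<noteq> 0" using z R0 by auto
      fix k show "z \<noteq> ?q ^ k"
      proof
        assume "z = ?q ^ k"
        hence "R = q powi int k" using z q by (simp add: norm_power)
        with R have "int k < n" "n - 1 < int k" using mono[of n "int k"] mono[of "int k" "n - 1"] by auto
        thus False by simp
      qed
    qed
  next
    fix k
    have "q powi (n + int k) \<le> q powi n" using mono[of n "n + int k"] by linarith
    thus "winds (circlepath 0 R) 1 (?q powi (n + int k))"
      by (intro winds_circle_in) (use R nq in simp)
  next
    fix w :: complex and p assume "w \<in> path_image (circlepath 0 \<epsilon>)"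
      and *: "is_pole (walks_integrand ?q x y1 t1 y2 t2 w) p \<and> p \<noteq> 0 \<and>
         p \<notin> path_image (circlepath 0 \<epsilon>) \<and> p \<notin> range (\<lambda>k. ?q powi (n + int k))"
    hence "norm w = \<epsilon>" using e by simp
    moreover have "norm p \<noteq> \<epsilon>" using * e by simp
    ultimately show "winds (circlepath 0 R) 0 p" using * by (intro c3) blast+
  next
    fix w assume "w \<in> path_image (circlepath 0 \<epsilon>)"
    hence "norm w = \<epsilon>" using e by simp
    with e show "winds (circlepath 0 R) 1 w" by (intro winds_circle_in) simp
  next
    show "winds (circlepath 0 R) 1 0" using R0 by (intro winds_circle_in) simp
  next
    fix w :: complex assume "0 < norm w \<and> norm w \<le> \<epsilon>"
    thus "qpoch (w * ?q powi (- y1 - int t1)) ?q (t1 + 1) \<noteq> 0" by (intro c1) auto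
  next
    fix w :: complex and r assume "0 < norm w \<and> norm w \<le> \<epsilon>" "r < length x"
    thus "1 - ?q ^ (x ! r) / w \<noteq> 0" by (intro c2) auto
  qed (use e in auto)
  thus ?thesis by blast
qed


end

(*
  A single walker has transfer matrix P, and Upsilon is the Doob transform of m independent walkers by a
  Vandermonde determinant in q^(-y).  Since a walker jumps by at most one, expanding
  det [(P f_j)(x_i)] by rows keeps exactly the noncolliding moves: all others meet at one site and contribute
  determinants with two equal rows.  Hence E prod_(j,t) (1 + f(y_j(t), t)) is one m x m determinant, and
  expanding each walker along its visits to the marked points, together with det(1 + AB) = det(1 + BA),
  turns it into det(1 + K f) with
    K(u,s; v,t) = sum_r (P^(-s) L_r)(u) P^t(x_r, v) - [s < t] P^(t-s)(u, v),
  where L_r is the Lagrange basis in q^(-y) at the nodes x_r.  Taking f = 0, 1 on subsets and alternating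
  isolates the correlation functions.

  The matrix P is triangular with an explicit inverse (a weighted partial summation), P^t is a divided
  difference in q^(-y), and sum_k P^(-s)(u, k) P^t(k, v) = P^(t-s)(u, v).  So K is also
    [t <= s] P^(t-s)(u, v) - sum_(k <= u) P^(-s)(u, k) (P^t(k, v) - sum_r L_r(k) P^t(x_r, v)).
  In the coordinates 1/z and 1/w the double contour integral is a sum of residues at z = q^k, k not in x,
  and w = q^(x_r) or q^k, which is exactly this sum after transposition and a diagonal conjugation.
*)
theory Submission
  imports Defs
begin

section \<open>Transfer operators of a single walker\<close>

text \<open>The polynomials in q^(-y) of degree below m form a space invariant under P. Hence the
  Lagrange basis at the m starting sites propagates polynomial data exactly to any site, and T free
  steps multiply the initial determinant by q^(T binom(m,2)), the constant that
  \<open>Upsilon\<close> divides out. The zeros q^k of (1/z; q)_infinity accumulate at 0, inside the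
  z contour, so infinitely many residues would have to be summed there. After z -> 1/z the winding
  number about each point drops by one, and all but finitely many poles are no longer encircled. The
  obstacle is the freedom left by \<open>admissible_contours\<close>. If y2 lies above every x_r,
  the w circle may pass through a pole q^k with k <= y2, and the clause on poles says nothing about
  points of that circle. The contour kernel is therefore identified only at entries where each such
  winding number is either forced to be 0 or multiplied by 0. When a marked site lies above all
  starting sites, the remaining entries are avoided: the row of the earliest such mark vanishes, in
  agreement with probability 0.\<close>

definition kdelta :: "nat \<Rightarrow> nat \<Rightarrow> 'a :: field" where
  "kdelta b a = (if a = b then 1 else 0)"

definition stepop :: "'a :: field \<Rightarrow> (nat \<Rightarrow> 'a) \<Rightarrow> nat \<Rightarrow> 'a" where
  "stepop q f a = q ^ a * f a - (if a = 0 then 0 else q ^ (a - 1) * f (a - 1))"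

text \<open>The inverse of \<open>stepop\<close>: the partial sums of \<open>stepop q f\<close>
  telescope to \<open>q ^ a * f a\<close>. Only sites up to \<open>a\<close> enter, so no
  summability is at stake.\<close>

definition cumop :: "'a :: field \<Rightarrow> (nat \<Rightarrow> 'a) \<Rightarrow> nat \<Rightarrow> 'a" where
  "cumop q f a = (\<Sum>k\<le>a. f k) / q ^ a"

lemma stepop_Suc [simp]: "stepop q f (Suc a) = q ^ Suc a * f (Suc a) - q ^ a * f a"
  by (simp add: stepop_def)

lemma stepop_0 [simp]: "stepop q f 0 = f 0"
  by (simp add: stepop_def)

lemma stepop_sum: "stepop q (\<lambda>a. \<Sum>i\<in>I. c i * F i a) = (\<lambda>a. \<Sum>i\<in>I. c i * stepop q (F i) a)"
  by (auto simp: stepop_def fun_eq_iff sum_distrib_left sum_subtractf right_diff_distrib mult_ac)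

lemma cumop_sum: "cumop q (\<lambda>a. \<Sum>i\<in>I. c i * F i a) = (\<lambda>a. \<Sum>i\<in>I. c i * cumop q (F i) a)"
proof
  fix a
  have "(\<Sum>k\<le>a. \<Sum>i\<in>I. c i * F i k) = (\<Sum>i\<in>I. c i * (\<Sum>k\<le>a. F i k))"
    by (subst sum.swap) (simp add: sum_distrib_left)
  thus "cumop q (\<lambda>a. \<Sum>i\<in>I. c i * F i a) a = (\<Sum>i\<in>I. c i * cumop q (F i) a)"
    unfolding cumop_def times_divide_eq_right sum_divide_distrib[symmetric] by (rule arg_cong)
qed

lemma stepop_pow_sum:
  "(stepop q ^^ n) (\<lambda>a. \<Sum>i\<in>I. c i * F i a) = (\<lambda>a. \<Sum>i\<in>I. c i * (stepop q ^^ n) (F i) a)"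
  by (induction n) (simp_all add: stepop_sum)

lemma cumop_pow_sum:
  "(cumop q ^^ n) (\<lambda>a. \<Sum>i\<in>I. c i * F i a) = (\<lambda>a. \<Sum>i\<in>I. c i * (cumop q ^^ n) (F i) a)"
  by (induction n) (simp_all add: cumop_sum)

lemma stepop_pow_lincomb:
  "(stepop q ^^ n) (\<lambda>a. c * f a + d * g a) = (\<lambda>a. c * (stepop q ^^ n) f a + d * (stepop q ^^ n) g a)"
  using stepop_pow_sum[where c = "\<lambda>i::bool. if i then c else d" and F = "\<lambda>i. if i then f else g" and I = UNIV]
  by (simp add: UNIV_bool add.commute)

lemma cumop_pow_local:
  "(\<And>k. k \<le> a \<Longrightarrow> f k = g k) \<Longrightarrow> (cumop q ^^ n) f a = (cumop q ^^ n) g a"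
proof (induction n arbitrary: a)
  case (Suc n)
  have "(cumop q ^^ n) f k = (cumop q ^^ n) g k" if "k \<le> a" for k
    using that Suc.prems by (intro Suc.IH) simp
  thus ?case unfolding funpow.simps o_apply by (subst (1 2) cumop_def) simp
qed simp

lemma sum_kdelta: "finite I \<Longrightarrow> (\<Sum>k\<in>I. f k * kdelta k a) = (if a \<in> I then f a else 0)"
proof -
  assume "finite I"
  have "(\<Sum>k\<in>I. f k * kdelta k a) = (\<Sum>k\<in>I. if a = k then f k else 0)"
    by (intro sum.cong) (auto simp: kdelta_def)
  also have "\<dots> = (if a \<in> I then f a else 0)" using \<open>finite I\<close> by simp
  finally show ?thesis .
qed

text \<open>Since only sites up to \<open>a\<close> matter, \<open>f\<close> may be replaced by a
  finite combination of point masses, to which linearity applies. The coefficients are the matrix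
  entries of the negative powers of P.\<close>

lemma cumop_pow_expand: "(cumop q ^^ n) f a = (\<Sum>k\<le>a. (cumop q ^^ n) (kdelta k) a * f k)"
proof -
  have "(cumop q ^^ n) f a = (cumop q ^^ n) (\<lambda>c. \<Sum>k\<le>a. f k * kdelta k c) a"
    by (rule cumop_pow_local) (simp add: sum_kdelta)
  thus ?thesis by (simp add: cumop_pow_sum mult.commute)
qed

lemma cumop_stepop [simp]: "q \<noteq> 0 \<Longrightarrow> cumop q (stepop q f) = f"
proof
  fix a assume q: "q \<noteq> 0"
  have "(\<Sum>k\<le>a. stepop q f k) = q ^ a * f a"
    by (induction a) (simp_all add: algebra_simps)
  thus "cumop q (stepop q f) a = f a" using q by (simp add: cumop_def)
qed

lemma cumop_pow_stepop_pow:
  "q \<noteq> 0 \<Longrightarrow> t \<le> s \<Longrightarrow> (cumop q ^^ t) ((stepop q ^^ s) f) = (stepop q ^^ (s - t)) f"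
proof (induction t arbitrary: s)
  case (Suc t)
  then obtain s' where s': "s = Suc s'" "t \<le> s'" by (cases s) auto
  have "(cumop q ^^ Suc t) ((stepop q ^^ s) f) = (cumop q ^^ t) (cumop q (stepop q ((stepop q ^^ s') f)))"
    by (simp add: s' funpow_swap1)
  also have "\<dots> = (stepop q ^^ (s - Suc t)) f" using Suc s' by simp
  finally show ?case .
qed simp

lemma cumop_pow_stepop_pow':
  "q \<noteq> 0 \<Longrightarrow> s \<le> t \<Longrightarrow> (cumop q ^^ t) ((stepop q ^^ s) f) = (cumop q ^^ (t - s)) f"
  using cumop_pow_stepop_pow[of q s s f] funpow_add[of "t - s" s "cumop q"] by simp

section \<open>Matrix entries of the powers of the step operator and of its inverse\<close>

definition divdiff_weight :: "'a :: field \<Rightarrow> nat \<Rightarrow> nat \<Rightarrow> nat \<Rightarrow> 'a" where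
  "divdiff_weight q t b a = (if a \<in> {b..b+t} then \<Prod>i\<in>{b..b+t}-{a}. 1 / (1 / q ^ a - 1 / q ^ i) else 0)"

lemma inverse_power_inj:
  fixes q :: "'a :: field"
  assumes "q \<noteq> 0" "\<And>n. n > 0 \<Longrightarrow> q ^ n \<noteq> 1"
  shows "1 / q ^ a = 1 / q ^ b \<longleftrightarrow> a = b"
proof -
  have "a = b" if "q ^ a = q ^ b" "a \<le> b" for a b
  proof (rule ccontr)
    assume "a \<noteq> b"
    have "q ^ b = q ^ a * q ^ (b - a)" using that(2) by (simp flip: power_add)
    hence "q ^ (b - a) = 1" using that assms(1) by simp
    thus False using assms(2)[of "b - a"] \<open>a \<noteq> b\<close> that by simp
  qed
  from this[of a b] this[of b a] show ?thesis using assms(1) nat_le_linear[of a b] by (auto simp: field_simps)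
qed

text \<open>\<open>divdiff_weight q t b a\<close> is the weight of F(q^(-a)) in the divided
  difference of F at the nodes q^(-b), ..., q^(-b-t). The recursion is that of divided differences
  over two overlapping windows of nodes; the factor \<open>q ^ b\<close> makes the difference of the
  two end nodes independent of b.\<close>

lemma divdiff_weight_rec:
  fixes q :: "'a :: field"
  assumes q: "q \<noteq> 0" "\<And>n. n > 0 \<Longrightarrow> q ^ n \<noteq> 1"
  shows "q ^ b * (divdiff_weight q t b a - divdiff_weight q t (Suc b) a) = (1 - 1 / q ^ Suc t) * divdiff_weight q (Suc t) b a"
proof -
  let ?Q = "\<lambda>i. 1 / q ^ i"
  define c where "c = b + Suc t"
  define I where "I = {Suc b..b + t}"
  define p where "p = (\<Prod>i\<in>I-{a}. 1 / (?Q a - ?Q i))"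
  have sets: "{b..b+t} = insert b I" "{Suc b..Suc b + t} = insert c I" "{b..b+Suc t} = insert b (insert c I)"
    and fin: "finite I" "b \<notin> I" "c \<notin> I" "b \<noteq> c"
    by (auto simp: I_def c_def)
  have eq: "divdiff_weight q t b a = (if a \<in> insert b I then \<Prod>i\<in>insert b I-{a}. 1 / (?Q a - ?Q i) else 0)"
    "divdiff_weight q t (Suc b) a = (if a \<in> insert c I then \<Prod>i\<in>insert c I-{a}. 1 / (?Q a - ?Q i) else 0)"
    "divdiff_weight q (Suc t) b a = (if a \<in> insert b (insert c I) then \<Prod>i\<in>insert b (insert c I)-{a}. 1 / (?Q a - ?Q i) else 0)"
    unfolding divdiff_weight_def sets(1) by (simp_all only: sets(2,3))
  have key: "1 - 1 / q ^ Suc t = q ^ b * (?Q b - ?Q c)"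
    using q by (simp add: c_def power_add field_simps)
  have inj: "?Q i = ?Q j \<longleftrightarrow> i = j" for i j using inverse_power_inj[OF q] .
  have ins: "insert d I - {a} = (if d = a then I - {a} else insert d (I - {a}))" if "d \<notin> I" for d
    using that by auto
  \<comment> \<open>An end node lies in one window only and yields a single fraction; a common node
    yields a difference of two fractions.\<close>
  consider "a = b" | "a = c" | "a \<in> I" | "a \<notin> insert b (insert c I)" by blast
  thus ?thesis
  proof cases
    case 1
    have s: "insert b (insert c I) - {a} = insert c (I - {a})" "insert b I - {a} = I - {a}" using 1 fin by auto
    have "divdiff_weight q t (Suc b) a = 0" using 1 by (simp add: divdiff_weight_def)
    moreover have "divdiff_weight q t b a = p" unfolding eq(1) s p_def using 1 by simp
    moreover have "divdiff_weight q (Suc t) b a = 1 / (?Q b - ?Q c) * p" unfolding eq(3) s p_def using 1 fin by simp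
    moreover have "?Q b - ?Q c \<noteq> 0" using fin inj[of b c] by auto
    ultimately show ?thesis unfolding key by simp
  next
    case 2
    have s: "insert b (insert c I) - {a} = insert b (I - {a})" "insert c I - {a} = I - {a}" using 2 fin by auto
    have "divdiff_weight q t b a = 0" using 2 by (simp add: divdiff_weight_def c_def)
    moreover have e: "?Q b - ?Q c = - (?Q c - ?Q b)" by simp
    moreover have "divdiff_weight q (Suc t) b a = 1 / (?Q c - ?Q b) * p" unfolding eq(3) s p_def using 2 fin by simp
    moreover have "divdiff_weight q t (Suc b) a = p" unfolding eq(2) s p_def using 2 by simp
    moreover have "?Q c - ?Q b \<noteq> 0" using fin inj[of c b] by auto
    moreover have "z * (0 - p) = z * - D * (1 / D * p)" if "D \<noteq> 0" for z D :: 'a using that by simp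
    ultimately show ?thesis unfolding key e by metis
  next
    case 3
    hence n: "a \<noteq> b" "a \<noteq> c" using fin by auto
    have s: "insert b (insert c I) - {a} = insert b (insert c (I - {a}))" "insert b I - {a} = insert b (I - {a})"
      "insert c I - {a} = insert c (I - {a})" using 3 fin by auto
    have nz: "?Q a - ?Q b \<noteq> 0" "?Q a - ?Q c \<noteq> 0" using n inj by auto
    have "(1 / (?Q a - ?Q b) - 1 / (?Q a - ?Q c)) = (?Q b - ?Q c) * (1 / (?Q a - ?Q b) * (1 / (?Q a - ?Q c)))"
      using diff_frac_eq[OF nz, of 1 1] by simp
    hence "1 / (?Q a - ?Q b) * p - 1 / (?Q a - ?Q c) * p
            = (?Q b - ?Q c) * (1 / (?Q a - ?Q b) * (1 / (?Q a - ?Q c) * p))"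
      by (simp only: left_diff_distrib[symmetric]) (simp only: mult.assoc)
    moreover have "divdiff_weight q t b a = 1 / (?Q a - ?Q b) * p" "divdiff_weight q t (Suc b) a = 1 / (?Q a - ?Q c) * p"
      "divdiff_weight q (Suc t) b a = 1 / (?Q a - ?Q b) * (1 / (?Q a - ?Q c) * p)"
      using 3 fin s by (simp_all add: eq p_def)
    ultimately show ?thesis by (simp only: key mult.assoc)
  next
    case 4
    thus ?thesis by (simp add: eq)
  qed
qed

text \<open>One step maps the point mass at b to q^b times the difference of the point masses at b
  and b + 1. Performing this step first reproduces the recursion of divided differences in b, which
  is why the induction runs over all b.\<close>

lemma stepop_pow_kdelta:
  fixes q :: "'a :: field"
  assumes q: "q \<noteq> 0" "\<And>n. n > 0 \<Longrightarrow> q ^ n \<noteq> 1"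
  shows "(stepop q ^^ t) (kdelta b) a = (\<Prod>i<t. 1 - 1 / q ^ Suc i) * divdiff_weight q t b a"
proof (induction t arbitrary: b)
  case 0
  show ?case by (auto simp: kdelta_def divdiff_weight_def)
next
  case (Suc t)
  have "stepop q (kdelta b) = (\<lambda>a. q ^ b * kdelta b a + (- (q ^ b)) * kdelta (Suc b) a)"
    by (auto simp: stepop_def kdelta_def fun_eq_iff)
  hence "(stepop q ^^ Suc t) (kdelta b) a
      = q ^ b * (stepop q ^^ t) (kdelta b) a + (- (q ^ b)) * (stepop q ^^ t) (kdelta (Suc b)) a"
    by (simp only: funpow_Suc_right o_apply stepop_pow_lincomb)
  also have "\<dots> = (\<Prod>i<t. 1 - 1 / q ^ Suc i) * (q ^ b * (divdiff_weight q t b a - divdiff_weight q t (Suc b) a))"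
    by (simp add: Suc.IH algebra_simps)
  finally show ?case by (simp only: divdiff_weight_rec[OF q] prod.lessThan_Suc mult.assoc)
qed

text \<open>The product is a Gaussian binomial coefficient. Instead of evaluating iterated sums, the
  closed form is checked to be lowered by \<open>stepop\<close> from t + 1 to t, and this relation
  is then inverted.\<close>

lemma cumop_pow_kdelta:
  fixes q :: "'a :: field"
  assumes q: "q \<noteq> 0" "\<And>n. n > 0 \<Longrightarrow> q ^ n \<noteq> 1"
  shows "(cumop q ^^ Suc t) (kdelta b) a =
    (if b \<le> a then (\<Prod>i<t. (1 - q ^ (a - b + Suc i)) / (1 - q ^ Suc i)) / q ^ (Suc t * a) else 0)"
proof -
  define \<psi> where "\<psi> t a = (if b \<le> a then (\<Prod>i<t. (1 - q ^ (a - b + Suc i)) / (1 - q ^ Suc i)) / q ^ (Suc t * a) else 0)" for t a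
  have nz: "1 - q ^ Suc i \<noteq> 0" for i using q(2)[of "Suc i"] by simp
  have step: "stepop q (\<psi> (Suc t)) a = \<psi> t a" for t a
  proof (cases "b \<le> a")
    case False
    thus ?thesis by (auto simp: stepop_def \<psi>_def)
  next
    case True
    show ?thesis
    proof (cases "a = b")
      case True
      have "stepop q (\<psi> (Suc t)) b = q ^ b * \<psi> (Suc t) b" by (auto simp: stepop_def \<psi>_def)
      also have "\<dots> = \<psi> t b" using nz q(1) by (simp add: \<psi>_def power_add del: power_Suc) 
      finally show ?thesis using True by simp
    next
      case False
      with True obtain c where c: "a = Suc c" "b \<le> c" by (cases a) auto
      define D where "D = c - b"
      define R where "R = (\<Prod>i<t. 1 - q ^ (D + Suc (Suc i)))"
      define N where "N = (\<Prod>i<t. 1 - q ^ Suc i)"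
      have N: "N \<noteq> 0" using nz by (simp add: N_def)
      have e1: "\<psi> (Suc t) a = R * (1 - q ^ (D + Suc (Suc t))) / (N * (1 - q ^ Suc t)) / q ^ (Suc (Suc t) * a)"
        using c by (simp add: \<psi>_def prod_dividef R_def N_def D_def Suc_diff_le)
      have e2: "\<psi> (Suc t) c = (1 - q ^ Suc D) * R / (N * (1 - q ^ Suc t)) / q ^ (Suc (Suc t) * c)"
        using c unfolding \<psi>_def prod_dividef R_def N_def D_def
        by (subst prod.lessThan_Suc_shift) simp
      have e3: "\<psi> t a = R / N / q ^ (Suc t * a)"
        using c by (simp add: \<psi>_def prod_dividef R_def N_def D_def Suc_diff_le)
      \<comment> \<open>The q-Pascal rule in the form needed for one application of
        \<open>stepop\<close>.\<close>
      have "(1 - q ^ (D + Suc (Suc t))) - q ^ Suc t * (1 - q ^ Suc D) = 1 - q ^ Suc t"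
        by (simp add: algebra_simps power_add)
      hence m: "R * (1 - q ^ (D + Suc (Suc t))) - q ^ Suc t * ((1 - q ^ Suc D) * R) = R * (1 - q ^ Suc t)"
        by (metis mult.commute mult.left_commute right_diff_distrib)
      have "stepop q (\<psi> (Suc t)) a = q ^ Suc c * \<psi> (Suc t) a - q ^ c * \<psi> (Suc t) c"
        by (simp add: c)
      also have "q ^ Suc c * \<psi> (Suc t) a = R * (1 - q ^ (D + Suc (Suc t))) / (N * (1 - q ^ Suc t)) / q ^ (Suc t * a)"
      proof -
        have "q ^ (Suc (Suc t) * a) = q ^ Suc c * q ^ (Suc t * a)" by (simp add: c power_add)
        thus ?thesis using q(1) by (simp add: e1 del: power_Suc mult_Suc mult_Suc_right)
      qed
      also have "q ^ c * \<psi> (Suc t) c = q ^ Suc t * ((1 - q ^ Suc D) * R) / (N * (1 - q ^ Suc t)) / q ^ (Suc t * a)"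
      proof -
        have 1: "q ^ (Suc (Suc t) * c) = q ^ c * q ^ (Suc t * c)" by (simp add: power_add)
        have 2: "q ^ (Suc t * a) = q ^ Suc t * q ^ (Suc t * c)" by (simp add: c flip: power_add)
        show ?thesis unfolding e2 1 2 using q(1) by (simp del: power_Suc mult_Suc mult_Suc_right)
      qed
      also have "R * (1 - q ^ (D + Suc (Suc t))) / (N * (1 - q ^ Suc t)) / q ^ (Suc t * a) - \<dots>
        = (R * (1 - q ^ (D + Suc (Suc t))) - q ^ Suc t * ((1 - q ^ Suc D) * R)) / (N * (1 - q ^ Suc t)) / q ^ (Suc t * a)"
        by (simp only: diff_divide_distrib)
      also have "\<dots> = \<psi> t a" unfolding m e3 using nz[of t] by (simp del: power_Suc mult_Suc)
      finally show ?thesis .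
    qed
  qed
  have "(cumop q ^^ Suc t) (kdelta b) = \<psi> t" for t
  proof (induction t)
    case 0
    show ?case
    proof
      fix a
      have "(\<Sum>k\<le>a. kdelta b k :: 'a) = (if b \<le> a then 1 else 0)"
        by (simp add: kdelta_def)
      thus "(cumop q ^^ Suc 0) (kdelta b) a = \<psi> 0 a" by (simp add: cumop_def \<psi>_def)
    qed
  next
    case (Suc t)
    have "stepop q (\<psi> (Suc t)) = \<psi> t" using step by blast
    hence "\<psi> (Suc t) = cumop q (\<psi> t)" using cumop_stepop[OF q(1)] by metis
    with Suc show ?case by simp
  qed
  thus ?thesis by (simp add: \<psi>_def)
qed

text \<open>Up to a constant factor, \<open>kap q a\<close> is the derivative of \<open>(\<zeta>; q)\<^sub>\<infinity>\<close> at its zero \<open>q\<^sup>-\<^sup>a\<close>.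
  A single walker stays at \<open>a\<close> with probability \<open>q\<^sup>a\<close> and otherwise moves to \<open>a - 1\<close>; conjugating this
  transition matrix by \<open>kap\<close> gives \<^const>\<open>stepop\<close>. All functions below carry this conjugation.\<close>

definition kap :: "'a :: field \<Rightarrow> nat \<Rightarrow> 'a" where
  "kap q a = q ^ a * (\<Prod>i<a. 1 - 1 / q ^ Suc i)"

lemma kap_nonzero:
  fixes q :: "'a :: field"
  assumes "q \<noteq> 0" "\<And>n. n > 0 \<Longrightarrow> q ^ n \<noteq> 1"
  shows "kap q a \<noteq> 0"
  using assms(1) assms(2)[of "Suc _"] by (simp add: kap_def del: power_Suc)

lemma kap_Suc:
  fixes q :: "'a :: field"
  assumes "q \<noteq> 0"
  shows "q ^ a * kap q (Suc a) = - (1 - q ^ Suc a) * kap q a"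
  using assms by (simp add: kap_def field_simps)

section \<open>Polynomials in q^(-y) and Lagrange interpolation\<close>

definition ebas :: "'a :: field \<Rightarrow> nat \<Rightarrow> nat \<Rightarrow> 'a" where
  "ebas q j y = 1 / (q ^ (j * y) * kap q y)"

text \<open>\<open>ebas q j\<close> is the monomial of degree j in q^(-y), conjugated by
  \<open>kap\<close>. A step preserves the filtration by degree, with eigenvalue q^j on degree j;
  for j < m these multiply to q^(m choose 2). For j = 0 the coefficient 1 - q^j vanishes, so the
  truncated index \<open>j - 1\<close> is harmless.\<close>

lemma stepop_ebas:
  fixes q :: "'a :: field"
  assumes q: "q \<noteq> 0" "\<And>n. n > 0 \<Longrightarrow> q ^ n \<noteq> 1"
  shows "stepop q (ebas q j) = (\<lambda>a. q ^ j * ebas q j a + (1 - q ^ j) * ebas q (j - 1) a)"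
proof
  fix a
  show "stepop q (ebas q j) a = q ^ j * ebas q j a + (1 - q ^ j) * ebas q (j - 1) a"
  proof (cases a)
    case (Suc b)
    have k: "kap q a \<noteq> 0" "kap q b \<noteq> 0" using kap_nonzero[OF q] by auto
    have "q ^ b * kap q a = - (1 - q ^ a) * kap q b" using kap_Suc[OF q(1)] Suc by simp
    hence e: "q ^ b / kap q b = - ((1 - q ^ a) / kap q a)" using k by (simp add: field_simps)
    have "stepop q (ebas q j) a = q ^ a * ebas q j a - q ^ b / kap q b / q ^ (j * b)"
      by (simp add: Suc ebas_def)
    also have "q ^ b / kap q b / q ^ (j * b) = - ((1 - q ^ a) * q ^ j / (q ^ (j * a) * kap q a))"
      using q(1) unfolding e by (simp add: Suc power_add)
    also have "q ^ a * ebas q j a - \<dots> = (q ^ a + (1 - q ^ a) * q ^ j) / (q ^ (j * a) * kap q a)"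
      by (simp add: ebas_def add_divide_distrib)
    also have "\<dots> = q ^ j * ebas q j a + (1 - q ^ j) * ebas q (j - 1) a"
    proof (cases j)
      case (Suc i)
      have "ebas q i a = q ^ a / (q ^ (j * a) * kap q a)"
        using q(1) by (simp add: ebas_def Suc power_add)
      thus ?thesis by (simp add: Suc ebas_def add_divide_distrib[symmetric] algebra_simps)
    qed (simp add: ebas_def)
    finally show ?thesis .
  next
    case 0
    thus ?thesis by (simp add: ebas_def kap_def)
  qed
qed

text \<open>The quotient of \<open>kap\<close> values conjugates the usual Lagrange basis polynomial
  and keeps its value 1 at its own node.\<close>

definition lagr :: "'a :: field \<Rightarrow> nat list \<Rightarrow> nat \<Rightarrow> nat \<Rightarrow> 'a" where
  "lagr q x r k = kap q (x ! r) / kap q k *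
     (\<Prod>s\<in>{..<length x}-{r}. (1 / q ^ k - 1 / q ^ (x ! s)) / (1 / q ^ (x ! r) - 1 / q ^ (x ! s)))"

text \<open>The difference of the two sides is a polynomial in z of degree below m with the m
  distinct roots \<open>X i\<close>.\<close>

lemma lagrange_interpolation_power:
  fixes X :: "nat \<Rightarrow> 'a :: field"
  assumes inj: "inj_on X {..<m}" and j: "j < m"
  shows "(\<Sum>r<m. (\<Prod>s\<in>{..<m}-{r}. (z - X s) / (X r - X s)) * X r ^ j) = z ^ j"
proof -
  define l where "l r = (\<Prod>s\<in>{..<m}-{r}. Polynomial.smult (1 / (X r - X s)) [:- X s, 1:])" for r
  define p where "p = (\<Sum>r<m. Polynomial.smult (X r ^ j) (l r)) - Polynomial.monom 1 j"
  have pl: "poly (l r) y = (\<Prod>s\<in>{..<m}-{r}. (y - X s) / (X r - X s))" for r y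
    by (simp add: l_def poly_prod diff_divide_distrib)
  have dl: "Polynomial.degree (l r) < m" if "r < m" for r
  proof -
    have "Polynomial.degree (l r) \<le> (\<Sum>s\<in>{..<m}-{r}. Polynomial.degree (Polynomial.smult (1 / (X r - X s)) [:- X s, 1:]))"
      unfolding l_def by (rule degree_prod_sum_le[unfolded o_def]) simp
    also have "\<dots> \<le> (\<Sum>s\<in>{..<m}-{r}. 1)"
      by (intro sum_mono order.trans[OF degree_smult_le]) simp
    also have "\<dots> < m" using that by simp
    finally show ?thesis .
  qed
  have "Polynomial.degree (\<Sum>r<m. Polynomial.smult (X r ^ j) (l r)) < m"
  proof (rule degree_sum_less)
    show "Polynomial.degree (Polynomial.smult (X r ^ j) (l r)) < m" if "r \<in> {..<m}" for r
      using dl[of r] that degree_smult_le[of "X r ^ j" "l r"] by simp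
  qed (use j in auto)
  moreover have "Polynomial.degree (Polynomial.monom 1 j :: 'a poly) < m" using j degree_monom_le[of "1::'a" j] by linarith
  ultimately have dp: "Polynomial.degree p < m" unfolding p_def by (rule degree_diff_less)
  have z: "poly p (X i) = 0" if "i < m" for i
  proof -
    have "(\<Sum>r<m. X r ^ j * poly (l r) (X i)) = (\<Sum>r<m. if r = i then X i ^ j else 0)"
    proof (rule sum.cong[OF refl])
      fix r assume r: "r \<in> {..<m}"
      show "X r ^ j * poly (l r) (X i) = (if r = i then X i ^ j else 0)"
      proof (cases "r = i")
        case True
        have "poly (l i) (X i) = 1" unfolding pl
          by (rule prod.neutral) (use inj that in \<open>auto simp: inj_on_def\<close>)
        thus ?thesis using True by simp
      next
        case False
        have "poly (l r) (X i) = 0" unfolding pl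
          by (rule prod_zero) (use False that in auto)
        thus ?thesis using False by simp
      qed
    qed
    also have "\<dots> = X i ^ j" using that by simp
    finally show ?thesis by (simp add: p_def poly_sum poly_monom)
  qed
  have "p = 0"
  proof (rule ccontr)
    assume "p \<noteq> 0"
    hence "card {y. poly p y = 0} \<le> Polynomial.degree p" "finite {y. poly p y = 0}"
      by (rule card_poly_roots_bound, rule poly_roots_finite)
    moreover have "X ` {..<m} \<subseteq> {y. poly p y = 0}" using z by auto
    ultimately have "card (X ` {..<m}) \<le> Polynomial.degree p" by (meson card_mono le_trans)
    thus False using dp card_image[OF inj] by simp
  qed
  hence "poly p z = 0" by simp
  thus ?thesis by (simp add: p_def poly_sum poly_monom pl mult.commute)
qed

text \<open>The iterates of \<open>ebas q j\<close> stay in the span of the monomials of degree at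
  most j, where interpolation at \<open>length x\<close> nodes is exact.\<close>

lemma lagr_ebas:
  fixes q :: "'a :: field"
  assumes q: "q \<noteq> 0" "\<And>n. n > 0 \<Longrightarrow> q ^ n \<noteq> 1" and x: "distinct x" and j: "j < length x"
  shows "(\<Sum>r<length x. lagr q x r k * (stepop q ^^ n) (ebas q j) (x ! r)) = (stepop q ^^ n) (ebas q j) k"
  using j
proof (induction n arbitrary: j)
  case 0
  let ?X = "\<lambda>i. 1 / q ^ (x ! i)"
  have inj: "inj_on ?X {..<length x}"
  proof (rule inj_onI)
    fix i j assume ij: "i \<in> {..<length x}" "j \<in> {..<length x}" "?X i = ?X j"
    have "x ! i = x ! j" using ij(3) inverse_power_inj[OF q, of "x ! i" "x ! j"] by blast
    thus "i = j" using ij x by (simp add: nth_eq_iff_index_eq)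
  qed
  have eb: "ebas q j y = (1 / q ^ y) ^ j / kap q y" for y
    by (simp add: ebas_def power_divide flip: power_mult) (simp add: mult.commute)
  have "(\<Sum>r<length x. lagr q x r k * ebas q j (x ! r)) =
     (\<Sum>r<length x. (\<Prod>s\<in>{..<length x}-{r}. (1 / q ^ k - ?X s) / (?X r - ?X s)) * ?X r ^ j) / kap q k"
    unfolding lagr_def eb sum_divide_distrib using kap_nonzero[OF q] by (intro sum.cong) auto
  thus ?case using lagrange_interpolation_power[OF inj 0] by (simp add: eb)
next
  case (Suc n)
  have *: "(stepop q ^^ Suc n) (ebas q j) a
     = q ^ j * (stepop q ^^ n) (ebas q j) a + (1 - q ^ j) * (stepop q ^^ n) (ebas q (j - 1)) a" for a
    by (simp only: funpow_Suc_right o_apply stepop_ebas[OF q] stepop_pow_lincomb)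
  have "(\<Sum>r<length x. lagr q x r k * (stepop q ^^ Suc n) (ebas q j) (x ! r)) =
     q ^ j * (\<Sum>r<length x. lagr q x r k * (stepop q ^^ n) (ebas q j) (x ! r)) +
     (1 - q ^ j) * (\<Sum>r<length x. lagr q x r k * (stepop q ^^ n) (ebas q (j - 1)) (x ! r))"
    unfolding * sum_distrib_left sum.distrib[symmetric] by (intro sum.cong refl) (simp add: algebra_simps)
  also have "\<dots> = (stepop q ^^ Suc n) (ebas q j) k"
    unfolding * using Suc.IH[of j] Suc.IH[of "j - 1"] Suc.prems by simp
  finally show ?case .
qed

text \<open>Exact interpolation of the T-th iterate is transported back by t inverse steps acting on
  the variable site. Thus the values of that iterate at the starting sites determine the values
  needed at every intermediate time.\<close>

lemma lagr_interpolates: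
  fixes q :: "'a :: field"
  assumes q: "q \<noteq> 0" "\<And>n. n > 0 \<Longrightarrow> q ^ n \<noteq> 1" and x: "distinct x" and j: "j < length x" and t: "t \<le> T"
  shows "(\<Sum>r<length x. (cumop q ^^ t) (lagr q x r) u * (stepop q ^^ T) (ebas q j) (x ! r))
           = (stepop q ^^ (T - t)) (ebas q j) u"
proof -
  have "(\<Sum>r<length x. (cumop q ^^ t) (lagr q x r) u * (stepop q ^^ T) (ebas q j) (x ! r))
     = (cumop q ^^ t) (\<lambda>k. \<Sum>r<length x. (stepop q ^^ T) (ebas q j) (x ! r) * lagr q x r k) u"
    unfolding cumop_pow_sum by (simp only: mult.commute)
  also have "(\<lambda>k. \<Sum>r<length x. (stepop q ^^ T) (ebas q j) (x ! r) * lagr q x r k) = (stepop q ^^ T) (ebas q j)"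
    using lagr_ebas[OF q x j] by (simp add: mult.commute)
  finally show ?thesis using cumop_pow_stepop_pow[OF q(1) t] by simp
qed

section \<open>Determinants\<close>

lemma det_mat_perm:
  "Determinant.det (Matrix.mat n n (\<lambda>(i, j). f i j) :: 'a :: comm_ring_1 mat)
     = (\<Sum>p\<in>{p. p permutes {0..<n}}. signof p * (\<Prod>i<n. f i (p i)))"
proof -
  have "(\<Prod>i = 0..<n. Matrix.mat n n (\<lambda>(i, j). f i j) $$ (i, p i)) = (\<Prod>i<n. f i (p i))"
    if "p permutes {0..<n}" for p
    unfolding lessThan_atLeast0
    by (rule prod.cong[OF refl]) (use permutes_in_image[OF that] in auto)
  thus ?thesis by (subst det_def'[of _ n]) auto
qed

lemma det_mat_transpose:
  "Determinant.det (Matrix.mat n n (\<lambda>(i, j). f j i)) = Determinant.det (Matrix.mat n n (\<lambda>(i, j). f i j))"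
proof -
  have "Matrix.mat n n (\<lambda>(i, j). f j i) = transpose_mat (Matrix.mat n n (\<lambda>(i, j). f i j))"
    by (intro eq_matI) auto
  thus ?thesis using det_transpose[of "Matrix.mat n n (\<lambda>(i, j). f i j)" n] by simp
qed

text \<open>The block matrices [[1, A], [0, 1]] and [[1, -A], [B, 1]] have block triangular products
  in either order, with 1 + A B and 1 + B A as the only nontrivial diagonal blocks.\<close>

lemma det_one_plus_mult_commute:
  fixes A B :: "'a :: idom mat"
  assumes A: "A \<in> carrier_mat m l" and B: "B \<in> carrier_mat l m"
  shows "Determinant.det (1\<^sub>m m + A * B) = Determinant.det (1\<^sub>m l + B * A)"
proof -
  define L where "L = four_block_mat (1\<^sub>m m) A (0\<^sub>m l m) (1\<^sub>m l)"
  define N where "N = four_block_mat (1\<^sub>m m) (- A) B (1\<^sub>m l)"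
  have L: "L \<in> carrier_mat (m + l) (m + l)" and N: "N \<in> carrier_mat (m + l) (m + l)"
    using A B by (auto simp: L_def N_def)
  have mA: "- A \<in> carrier_mat m l" using A by simp
  have zero: "- A + A = 0\<^sub>m m l" "A + - A = 0\<^sub>m m l" using A by (auto intro!: eq_matI)
  have "L * N = four_block_mat (1\<^sub>m m * 1\<^sub>m m + A * B) (1\<^sub>m m * (- A) + A * 1\<^sub>m l)
      (0\<^sub>m l m * 1\<^sub>m m + 1\<^sub>m l * B) (0\<^sub>m l m * (- A) + 1\<^sub>m l * 1\<^sub>m l)"
    unfolding L_def N_def by (rule mult_four_block_mat) (use A B in auto)
  also have "\<dots> = four_block_mat (1\<^sub>m m + A * B) (0\<^sub>m m l) B (1\<^sub>m l)"
  proof -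
    have "- 0\<^sub>m l l + 1\<^sub>m l = (1\<^sub>m l :: 'a mat)" by (intro eq_matI) auto
    thus ?thesis using A B mA zero by simp
  qed
  finally have "Determinant.det (L * N) = Determinant.det (four_block_mat (1\<^sub>m m + A * B) (0\<^sub>m m l) B (1\<^sub>m l))"
    by simp
  also have "\<dots> = Determinant.det (1\<^sub>m m + A * B)"
    by (subst det_four_block_mat_upper_right_zero[OF _ refl B]) (use A B in auto)
  finally have 1: "Determinant.det (L * N) = Determinant.det (1\<^sub>m m + A * B)" .
  have "N * L = four_block_mat (1\<^sub>m m * 1\<^sub>m m + (- A) * 0\<^sub>m l m) (1\<^sub>m m * A + (- A) * 1\<^sub>m l)
      (B * 1\<^sub>m m + 1\<^sub>m l * 0\<^sub>m l m) (B * A + 1\<^sub>m l * 1\<^sub>m l)"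
    unfolding L_def N_def by (rule mult_four_block_mat) (use A B in auto)
  also have "\<dots> = four_block_mat (1\<^sub>m m) (0\<^sub>m m l) B (B * A + 1\<^sub>m l)"
    using A B mA zero by simp
  finally have "Determinant.det (N * L) = Determinant.det (four_block_mat (1\<^sub>m m) (0\<^sub>m m l) B (B * A + 1\<^sub>m l))"
    by simp
  also have "\<dots> = Determinant.det (B * A + 1\<^sub>m l)"
    by (subst det_four_block_mat_upper_right_zero[OF _ refl B]) (use A B in auto)
  also have "B * A + 1\<^sub>m l = 1\<^sub>m l + B * A" using A B by (intro comm_add_mat) auto
  finally have "Determinant.det (N * L) = Determinant.det (1\<^sub>m l + B * A)" .
  with 1 show ?thesis using det_mult[OF L N] det_mult[OF N L] by (simp add: mult.commute)
qed

text \<open>A permutation other than the identity must somewhere fail to increase \<open>\<tau>\<close>.\<close>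

lemma det_strict_rank:
  fixes N :: "nat \<Rightarrow> nat \<Rightarrow> 'a :: comm_ring_1" and \<tau> :: "nat \<Rightarrow> nat"
  assumes N: "\<And>i j. i < n \<Longrightarrow> j < n \<Longrightarrow> \<tau> j \<le> \<tau> i \<Longrightarrow> N i j = 0"
  shows "Determinant.det (Matrix.mat n n (\<lambda>(i, j). of_bool (i = j) + N i j)) = 1"
proof -
  let ?P = "{p. p permutes {0..<n}}"
  have z: "(\<Prod>i<n. of_bool (i = p i) + N i (p i)) = 0" if p: "p permutes {0..<n}" "p \<noteq> id" for p
  proof -
    have "\<exists>i<n. p i \<noteq> i \<and> \<tau> (p i) \<le> \<tau> i"
    proof (rule ccontr)
      assume neg: "\<not> ?thesis"
      hence le: "\<tau> i \<le> \<tau> (p i)" if "i \<in> {0..<n}" for i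
        using that by (cases "p i = i") (auto simp: not_le intro: less_imp_le)
      obtain k where "p k \<noteq> k" using p(2) by (auto simp: fun_eq_iff)
      hence "k \<in> {0..<n}" using p(1) by (meson permutes_not_in)
      moreover from this have "\<tau> k < \<tau> (p k)" using neg \<open>p k \<noteq> k\<close> by (auto simp: not_le)
      ultimately have "(\<Sum>i\<in>{0..<n}. \<tau> i) < (\<Sum>i\<in>{0..<n}. \<tau> (p i))"
        using le by (intro sum_strict_mono_ex1) auto
      moreover have "(\<Sum>i\<in>{0..<n}. \<tau> (p i)) = (\<Sum>i\<in>{0..<n}. \<tau> i)"
        using sum.permute[OF p(1), of \<tau>] by (simp add: o_def)
      ultimately show False by simp
    qed
    then obtain i where "i < n" "p i \<noteq> i" "\<tau> (p i) \<le> \<tau> i" by blast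
    moreover from this have "p i < n" using permutes_in_image[OF p(1), of i] by simp
    ultimately show ?thesis by (intro prod_zero) (auto simp: N intro!: bexI[of _ i])
  qed
  have "Determinant.det (Matrix.mat n n (\<lambda>(i, j). of_bool (i = j) + N i j))
      = (\<Sum>p\<in>?P. signof p * (\<Prod>i<n. of_bool (i = p i) + N i (p i)))"
    by (rule det_mat_perm)
  also have "\<dots> = (\<Sum>p\<in>{id}. signof p * (\<Prod>i<n. of_bool (i = p i) + N i (p i)))"
    by (rule sum.mono_neutral_right) (auto simp: z finite_permutations permutes_id)
  also have "\<dots> = 1" using N by simp
  finally show ?thesis .
qed

text \<open>Each factor is written as (d + K) - d and the product is expanded. The free parameter d
  serves two purposes: d = 1 isolates a joint probability, and d = the diagonal indicator along a
  permutation isolates a determinant.\<close>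

lemma prod_alternating_sum:
  fixes d K :: "nat \<Rightarrow> 'a :: comm_ring_1"
  shows "(\<Prod>i<n. K i) = (\<Sum>R\<in>Pow {..<n}. (- 1) ^ card ({..<n} - R) * (\<Prod>i<n. d i + of_bool (i \<in> R) * K i))"
proof -
  have "(\<Prod>i<n. K i) = (\<Prod>i<n. (d i + K i) + (- d i))"
    by (rule prod.cong) auto
  also have "\<dots> = (\<Sum>R\<in>Pow {..<n}. (\<Prod>i\<in>R. d i + K i) * (\<Prod>i\<in>{..<n}-R. - d i))"
    by (rule prod_add) simp
  also have "\<dots> = (\<Sum>R\<in>Pow {..<n}. (- 1) ^ card ({..<n} - R) * (\<Prod>i<n. d i + of_bool (i \<in> R) * K i))"
  proof (rule sum.cong[OF refl])
    fix R assume R: "R \<in> Pow {..<n}"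
    have "(\<Prod>i\<in>{..<n}-R. - d i) = (- 1) ^ card ({..<n} - R) * (\<Prod>i\<in>{..<n}-R. d i)"
      by (simp only: prod_uminus)
    moreover have "(\<Prod>i<n. d i + of_bool (i \<in> R) * K i)
        = (\<Prod>i\<in>{..<n}-R. d i + of_bool (i \<in> R) * K i) * (\<Prod>i\<in>R. d i + of_bool (i \<in> R) * K i)"
      using R by (intro prod.subset_diff) auto
    moreover have "(\<Prod>i\<in>{..<n}-R. d i + of_bool (i \<in> R) * K i) = (\<Prod>i\<in>{..<n}-R. d i)"
      "(\<Prod>i\<in>R. d i + of_bool (i \<in> R) * K i) = (\<Prod>i\<in>R. d i + K i)"
      by (auto intro!: prod.cong)
    ultimately show "(\<Prod>i\<in>R. d i + K i) * (\<Prod>i\<in>{..<n}-R. - d i) = (- 1) ^ card ({..<n} - R) *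
       (\<Prod>i<n. d i + of_bool (i \<in> R) * K i)" by (simp only: mult_ac)
  qed
  finally show ?thesis .
qed

text \<open>The alternating expansion is applied to every term of the Leibniz formula. It has the
  same coefficients as the one for probabilities, so two families that agree for all R have equal
  top terms.\<close>

lemma det_alternating_sum:
  fixes K :: "nat \<Rightarrow> nat \<Rightarrow> 'a :: comm_ring_1"
  shows "Determinant.det (Matrix.mat n n (\<lambda>(i, j). K i j))
    = (\<Sum>R\<in>Pow {..<n}. (- 1) ^ card ({..<n} - R) *
         Determinant.det (Matrix.mat n n (\<lambda>(i, j). of_bool (i = j) + of_bool (i \<in> R) * K i j)))"
proof -
  have *: "(\<Prod>i<n. K i (p i)) = (\<Sum>R\<in>Pow {..<n}. (- 1) ^ card ({..<n} - R) *
       (\<Prod>i<n. of_bool (i = p i) + of_bool (i \<in> R) * K i (p i)))" for p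
    by (rule prod_alternating_sum)
  show ?thesis
    unfolding det_mat_perm * sum_distrib_left
    by (subst sum.swap) (simp only: mult_ac)
qed

section \<open>One step of noncolliding walkers\<close>

lemma sorted_wrt_map_upt_iff:
  "sorted_wrt (>) (map y [0..<m]) \<longleftrightarrow> (\<forall>i j. i < j \<longrightarrow> j < m \<longrightarrow> y i > (y j :: nat))"
  by (auto simp: sorted_wrt_iff_nth_less)

text \<open>The states that \<open>Upsilon\<close> can reach in one step. Writing the jump with
  \<open>Suc\<close> on the left avoids truncated subtraction at site 0.\<close>

definition succs :: "nat \<Rightarrow> nat list \<Rightarrow> nat list set" where
  "succs m x = {y \<in> W m. \<forall>i<m. y ! i = x ! i \<or> Suc (y ! i) = x ! i}"

definition stepw :: "'a :: field \<Rightarrow> nat \<Rightarrow> nat \<Rightarrow> 'a" where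
  "stepw q a b = (if b = a then q ^ a else if Suc b = a then - (q ^ b) else 0)"

lemma stepop_eq_sum: "stepop q f a = (\<Sum>b\<in>{a - 1..a}. stepw q a b * f b)"
proof (cases a)
  case (Suc c)
  hence "{a - 1..a} = {c, Suc c}" by auto
  thus ?thesis by (simp add: Suc stepw_def)
qed (simp add: stepw_def)

lemma finite_succs: "finite (succs m x)"
proof (rule finite_subset)
  show "succs m x \<subseteq> {xs. set xs \<subseteq> {..Max (insert 0 ((!) x ` {..<m}))} \<and> length xs = m}"
  proof
    fix y assume y: "y \<in> succs m x"
    have "y ! i \<le> Max (insert 0 ((!) x ` {..<m}))" if "i < m" for i
    proof -
      have "y ! i \<le> x ! i" using y that by (auto simp: succs_def)
      also have "\<dots> \<le> Max (insert 0 ((!) x ` {..<m}))" using that by (intro Max_ge) auto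
      finally show ?thesis .
    qed
    thus "y \<in> {xs. set xs \<subseteq> {..Max (insert 0 ((!) x ` {..<m}))} \<and> length xs = m}"
      using y by (auto simp: succs_def W_def in_set_conv_nth)
  qed
qed (rule finite_lists_length_eq, simp)

text \<open>Expanding the rows gives a sum over all moves; the moves leaving the chamber put two walkers
  on the same site, and their determinant has two equal rows.\<close>

lemma det_stepop_expand:
  assumes x: "x \<in> W m"
  shows "Determinant.det (Matrix.mat m m (\<lambda>(i, j). stepop q (f j) (x ! i))) =
    (\<Sum>y\<in>succs m x. (\<Prod>i<m. stepw q (x ! i) (y ! i)) * Determinant.det (Matrix.mat m m (\<lambda>(i, j). f j (y ! i))))"
proof -
  let ?P = "{p. p permutes {0..<m}}"
  define E where "E = (\<Pi>\<^sub>E i\<in>{..<m}. {x ! i - 1..x ! i})"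
  define F where "F y = (\<Prod>i<m. stepw q (x ! i) (y i)) * Determinant.det (Matrix.mat m m (\<lambda>(i, j). f j (y i)))" for y
  have "Determinant.det (Matrix.mat m m (\<lambda>(i, j). stepop q (f j) (x ! i)))
     = (\<Sum>p\<in>?P. signof p * (\<Sum>y\<in>E. \<Prod>i<m. stepw q (x ! i) (y i) * f (p i) (y i)))"
    unfolding det_mat_perm stepop_eq_sum E_def by (subst prod_sum_PiE) auto
  also have "\<dots> = (\<Sum>y\<in>E. \<Sum>p\<in>?P. signof p * (\<Prod>i<m. stepw q (x ! i) (y i) * f (p i) (y i)))"
    unfolding sum_distrib_left by (rule sum.swap)
  also have "\<dots> = (\<Sum>y\<in>E. F y)"
    unfolding F_def det_mat_perm sum_distrib_left prod.distrib by (simp only: mult_ac)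
  also have "\<dots> = (\<Sum>y\<in>{y\<in>E. \<forall>i j. i < j \<longrightarrow> j < m \<longrightarrow> y i > y j}. F y)"
  proof (rule sum.mono_neutral_right)
    show "finite E" unfolding E_def by (intro finite_PiE) auto
    show "\<forall>y\<in>E - {y\<in>E. \<forall>i j. i < j \<longrightarrow> j < m \<longrightarrow> y i > y j}. F y = 0"
    proof
      fix y assume y: "y \<in> E - {y\<in>E. \<forall>i j. i < j \<longrightarrow> j < m \<longrightarrow> y i > y j}"
      then obtain i j where ij: "i < j" "j < m" "y i \<le> y j" by (auto simp: not_less)
      have r: "y k \<in> {x ! k - 1..x ! k}" if "k < m" for k
        using y that by (auto simp: E_def PiE_iff)
      have "x ! i > x ! j" using x ij by (auto simp: W_def sorted_wrt_iff_nth_less)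
      with r[of i] r[of j] ij have eq: "y i = y j" by auto
      have "Determinant.det (Matrix.mat m m (\<lambda>(i, j). f j (y i))) = 0"
        by (rule det_identical_rows[of _ m i j]) (use ij eq in auto)
      thus "F y = 0" by (simp add: F_def)
    qed
  qed auto
  also have "\<dots> = (\<Sum>y\<in>succs m x. F (\<lambda>i. y ! i))"
  \<comment> \<open>The product expansion runs over extensional functions, the chain over
    lists.\<close>
  proof (rule sum.reindex_bij_witness[where j = "\<lambda>y. map y [0..<m]" and i = "\<lambda>l. \<lambda>i\<in>{..<m}. l ! i"])
    fix y assume y: "y \<in> {y\<in>E. \<forall>i j. i < j \<longrightarrow> j < m \<longrightarrow> y i > y j}"
    show "(\<lambda>i\<in>{..<m}. map y [0..<m] ! i) = y" using y by (auto simp: E_def fun_eq_iff PiE_iff extensional_def)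
    have "y i = x ! i \<or> Suc (y i) = x ! i" if "i < m" for i
    proof -
      have "y i \<in> {x ! i - 1..x ! i}" using y that by (auto simp: E_def PiE_iff)
      thus ?thesis by auto
    qed
    thus "map y [0..<m] \<in> succs m x" using y by (auto simp: succs_def W_def sorted_wrt_map_upt_iff)
    have "Matrix.mat m m (\<lambda>(i, j). f j (map y [0..<m] ! i)) = Matrix.mat m m (\<lambda>(i, j). f j (y i))"
      by (intro eq_matI) auto
    thus "F ((!) (map y [0..<m])) = F y" by (simp add: F_def)
  next
    fix l assume l: "l \<in> succs m x"
    show "map (\<lambda>i\<in>{..<m}. l ! i) [0..<m] = l"
      using l by (intro nth_equalityI) (auto simp: succs_def W_def)
    have "l ! i \<in> {x ! i - 1..x ! i}" if "i < m" for i using l that by (auto simp: succs_def)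
    thus "(\<lambda>i\<in>{..<m}. l ! i) \<in> {y\<in>E. \<forall>i j. i < j \<longrightarrow> j < m \<longrightarrow> y i > y j}"
      using l by (auto simp: succs_def W_def E_def sorted_wrt_iff_nth_less)
  qed
  finally show ?thesis by (simp add: F_def)
qed

section \<open>The Vandermonde determinant\<close>

fun newton_coeff :: "(nat \<Rightarrow> 'a :: comm_ring_1) \<Rightarrow> nat \<Rightarrow> nat \<Rightarrow> 'a" where
  "newton_coeff z k 0 = of_bool (k = 0)"
| "newton_coeff z 0 (Suc j) = z 0 * newton_coeff z 0 j"
| "newton_coeff z (Suc k) (Suc j) = newton_coeff z k j + z (Suc k) * newton_coeff z (Suc k) j"

lemma newton_coeff_upper: "j < k \<Longrightarrow> newton_coeff z k j = 0" and newton_coeff_diag: "newton_coeff z j j = 1"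
proof -
  show up: "j < k \<Longrightarrow> newton_coeff z k j = 0" for k j
    by (induction z k j rule: newton_coeff.induct) auto
  show "newton_coeff z j j = 1" for j
    by (induction j) (auto simp: up)
qed

text \<open>\<open>newton_coeff z k j\<close> is the complete homogeneous symmetric polynomial of
  degree j - k in z_0, ..., z_k. Splitting w as (w - z_k) + z_k in front of the k-th Newton
  polynomial gives its recursion.\<close>

lemma newton_expansion:
  assumes "j < m"
  shows "(\<Sum>k<m. (\<Prod>l<k. w - z l) * newton_coeff z k j) = w ^ j"
  using assms
proof (induction j)
  case 0
  have "(\<Sum>k<m. (\<Prod>l<k. w - z l) * newton_coeff z k 0) = (\<Sum>k<m. if k = 0 then 1 else 0)"
    by (rule sum.cong) auto
  thus ?case using 0 by simp
next
  case (Suc j)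
  let ?N = "\<lambda>k. \<Prod>l<k. w - z l"
  obtain m' where m': "m = Suc m'" "j < m'" using Suc.prems by (cases m) auto
  have "(\<Sum>k<m. ?N k * newton_coeff z k (Suc j))
      = (\<Sum>k<m. ?N k * (z k * newton_coeff z k j)) + (\<Sum>k<m'. ?N (Suc k) * newton_coeff z k j)"
    unfolding m' sum.lessThan_Suc_shift
    by (simp add: sum.distrib distrib_left del: prod.lessThan_Suc)
  \<comment> \<open>The added term k = m' has coefficient 0 because j < m'.\<close>
  also have "(\<Sum>k<m'. ?N (Suc k) * newton_coeff z k j) = (\<Sum>k<m. ?N (Suc k) * newton_coeff z k j)"
    using m' by (simp add: newton_coeff_upper del: prod.lessThan_Suc)
  also have "(\<Sum>k<m. ?N k * (z k * newton_coeff z k j)) + \<dots> = (\<Sum>k<m. w * (?N k * newton_coeff z k j))"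
    unfolding sum.distrib[symmetric] by (rule sum.cong) (simp_all add: algebra_simps)
  also have "\<dots> = w ^ Suc j" using Suc by (simp flip: sum_distrib_left)
  finally show ?case .
qed

text \<open>Expanding monomials in the Newton basis factors the matrix into a lower triangular
  matrix of Newton values and a unitriangular matrix of coefficients. No division is involved, so
  any commutative ring will do.\<close>

lemma det_vandermonde:
  fixes z :: "nat \<Rightarrow> 'a :: comm_ring_1"
  shows "Determinant.det (Matrix.mat m m (\<lambda>(i, j). z i ^ j)) = (\<Prod>i<m. \<Prod>l<i. z i - z l)"
proof -
  define A where "A = Matrix.mat m m (\<lambda>(i, k). \<Prod>l<k. z i - z l)"
  define B where "B = Matrix.mat m m (\<lambda>(k, j). newton_coeff z k j)"
  have A: "A \<in> carrier_mat m m" and B: "B \<in> carrier_mat m m" by (auto simp: A_def B_def)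
  have "Matrix.mat m m (\<lambda>(i, j). z i ^ j) = A * B"
    using newton_expansion[of _ m "z _" z]
    by (intro eq_matI) (auto simp: A_def B_def scalar_prod_def lessThan_atLeast0[symmetric])
  hence "Determinant.det (Matrix.mat m m (\<lambda>(i, j). z i ^ j)) = Determinant.det A * Determinant.det B"
    using det_mult[OF A B] by simp
  moreover have "Determinant.det B = 1"
    by (subst det_upper_triangular[OF _ B])
       (auto simp: B_def newton_coeff_upper newton_coeff_diag prod_list_diag_prod)
  moreover have "Determinant.det A = prod_list (diag_mat A)"
    by (rule det_lower_triangular[OF _ A]) (auto simp: A_def intro!: prod_zero)
  moreover have "prod_list (diag_mat A) = (\<Prod>i<m. \<Prod>l<i. z i - z l)"
    unfolding prod_list_diag_prod A_def lessThan_atLeast0[of m] by (auto intro!: prod.cong)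
  ultimately show ?thesis by simp
qed

section \<open>Determinantal weights of noncolliding paths\<close>

text \<open>Every walker is followed backwards in time and picks up the factor \<open>g t a\<close> when it is at \<open>a\<close> at time \<open>t\<close>.\<close>

primrec weighted_iter ::
  "(nat \<Rightarrow> nat \<Rightarrow> 'a) \<Rightarrow> 'a :: field \<Rightarrow> (nat \<Rightarrow> 'a) \<Rightarrow> nat \<Rightarrow> nat \<Rightarrow> nat \<Rightarrow> 'a" where
  "weighted_iter g q e 0 t = e"
| "weighted_iter g q e (Suc n) t = stepop q (\<lambda>a. g (Suc t) a * weighted_iter g q e n (Suc t) a)"

lemma stepop_add: "stepop q (\<lambda>a. f a + g a) b = stepop q f b + stepop q g b"
  by (simp add: stepop_def algebra_simps)

text \<open>Each weight is 1 plus the contributions \<open>f i\<close>. The product of weights along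
  a path is expanded by the first mark at which a contribution \<open>f i\<close> is chosen: before
  it the motion is free, after it all weights are kept.\<close>

lemma weighted_iter_duhamel:
  fixes q :: "'a :: field"
  assumes g: "\<And>t a. g t a = 1 + (\<Sum>i<l. if u i = a \<and> \<tau> i = t then f i else 0)"
  shows "weighted_iter g q e n t a = (stepop q ^^ n) e a +
    (\<Sum>i<l. (if t < \<tau> i \<and> \<tau> i \<le> t + n then f i * weighted_iter g q e (t + n - \<tau> i) (\<tau> i) (u i) else 0)
              * (stepop q ^^ (\<tau> i - t)) (kdelta (u i)) a)"
proof (induction n arbitrary: t a)
  case 0
  have "(\<Sum>i<l. (if t < \<tau> i \<and> \<tau> i \<le> t + 0 then f i * weighted_iter g q e (t + 0 - \<tau> i) (\<tau> i) (u i) else 0)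
              * (stepop q ^^ (\<tau> i - t)) (kdelta (u i)) a) = 0"
    by (intro sum.neutral) auto
  thus ?case by simp
next
  case (Suc n)
  define c where "c i = (if Suc t < \<tau> i \<and> \<tau> i \<le> Suc t + n
      then f i * weighted_iter g q e (Suc t + n - \<tau> i) (\<tau> i) (u i) else 0)" for i
  \<comment> \<open>The marks at time t + 1, met by this very step; the coefficients
    \<open>c\<close> belong to the later marks.\<close>
  define d where "d i = (if \<tau> i = Suc t then f i * weighted_iter g q e n (Suc t) (u i) else 0)" for i
  let ?W = "weighted_iter g q e n (Suc t)"
  let ?F = "\<lambda>i. (stepop q ^^ (\<tau> i - Suc t)) (kdelta (u i))"
  have "g (Suc t) b * ?W b = (stepop q ^^ n) e b + (\<Sum>i<l. c i * ?F i b) + (\<Sum>i<l. d i * kdelta (u i) b)" for b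
  proof -
    have "(\<Sum>i<l. if u i = b \<and> \<tau> i = Suc t then f i else 0) * ?W b = (\<Sum>i<l. d i * kdelta (u i) b)"
      unfolding sum_distrib_right by (auto simp: d_def kdelta_def intro!: sum.cong)
    hence "g (Suc t) b * ?W b = ?W b + (\<Sum>i<l. d i * kdelta (u i) b)"
      by (subst g) (simp add: distrib_right)
    moreover have "?W b = (stepop q ^^ n) e b + (\<Sum>i<l. c i * ?F i b)"
      by (subst Suc.IH) (simp add: c_def)
    ultimately show ?thesis by simp
  qed
  hence "weighted_iter g q e (Suc n) t a
     = stepop q (\<lambda>b. (stepop q ^^ n) e b + (\<Sum>i<l. c i * ?F i b) + (\<Sum>i<l. d i * kdelta (u i) b)) a"
    by (simp only: weighted_iter.simps)
  also have "\<dots> = (stepop q ^^ Suc n) e a + stepop q (\<lambda>b. \<Sum>i<l. c i * ?F i b) a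
        + stepop q (\<lambda>b. \<Sum>i<l. d i * kdelta (u i) b) a"
    by (simp add: stepop_add)
  also have "\<dots> = (stepop q ^^ Suc n) e a +
      (\<Sum>i<l. c i * stepop q (?F i) a + d i * stepop q (kdelta (u i)) a)"
    by (simp add: stepop_sum sum.distrib)
  also have "(\<Sum>i<l. c i * stepop q (?F i) a + d i * stepop q (kdelta (u i)) a) =
    (\<Sum>i<l. (if t < \<tau> i \<and> \<tau> i \<le> t + Suc n then f i * weighted_iter g q e (t + Suc n - \<tau> i) (\<tau> i) (u i) else 0)
              * (stepop q ^^ (\<tau> i - t)) (kdelta (u i)) a)"
  proof (rule sum.cong[OF refl])
    fix i
    consider "\<tau> i = Suc t" | "\<tau> i > Suc t" | "\<tau> i \<le> t" by linarith
    thus "c i * stepop q (?F i) a + d i * stepop q (kdelta (u i)) a =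
      (if t < \<tau> i \<and> \<tau> i \<le> t + Suc n then f i * weighted_iter g q e (t + Suc n - \<tau> i) (\<tau> i) (u i) else 0)
              * (stepop q ^^ (\<tau> i - t)) (kdelta (u i)) a"
    proof cases
      case 1
      thus ?thesis by (simp add: c_def d_def)
    next
      case 2
      hence "\<tau> i - t = Suc (\<tau> i - Suc t)" by simp
      with 2 show ?thesis by (simp add: c_def d_def)
    next
      case 3
      thus ?thesis by (simp add: c_def d_def)
    qed
  qed
  finally show ?case .
qed

definition walk_kernel :: "'a :: field \<Rightarrow> nat list \<Rightarrow> nat \<Rightarrow> nat \<Rightarrow> nat \<Rightarrow> nat \<Rightarrow> 'a" where
  "walk_kernel q x u s v t = (\<Sum>r<length x. (cumop q ^^ s) (lagr q x r) u * (stepop q ^^ t) (kdelta v) (x ! r))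
     - (if s < t then (stepop q ^^ (t - s)) (kdelta v) u else 0)"

text \<open>The first-mark expansion at time 0 reads L = M0 + A W, and at the marks it reads W = B
  M0 + U W; in the latter the free part is interpolated from the values M0 at the starting sites.
  Eliminating W leaves det(1 + A (1 - U)^(-1) B) det M0.\<close>

lemma det_weighted_iter:
  fixes q :: "'a :: field"
  assumes q: "q \<noteq> 0" "\<And>n. n > 0 \<Longrightarrow> q ^ n \<noteq> 1" and x: "distinct x" "length x = m"
    and g: "\<And>t a. g t a = 1 + (\<Sum>i<l. if u i = a \<and> \<tau> i = t then f i else 0)"
    and \<tau>: "\<And>i. i < l \<Longrightarrow> 0 < \<tau> i \<and> \<tau> i \<le> T"
  shows "Determinant.det (Matrix.mat m m (\<lambda>(r, j). weighted_iter g q (ebas q j) T 0 (x ! r))) =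
    Determinant.det (Matrix.mat l l (\<lambda>(i, j). of_bool (i = j) + walk_kernel q x (u i) (\<tau> i) (u j) (\<tau> j) * f j)) *
    Determinant.det (Matrix.mat m m (\<lambda>(r, j). (stepop q ^^ T) (ebas q j) (x ! r)))"
proof -
  let ?w = "\<lambda>j. weighted_iter g q (ebas q j)"
  define M0 where "M0 = Matrix.mat m m (\<lambda>(r, j). (stepop q ^^ T) (ebas q j) (x ! r))"
  define L where "L = Matrix.mat m m (\<lambda>(r, j). ?w j T 0 (x ! r))"
  define A where "A = Matrix.mat m l (\<lambda>(r, i). (stepop q ^^ \<tau> i) (kdelta (u i)) (x ! r) * f i)"
  define B where "B = Matrix.mat l m (\<lambda>(i, r). (cumop q ^^ \<tau> i) (lagr q x r) (u i))"
  define U where "U = Matrix.mat l l (\<lambda>(i, j). (if \<tau> i < \<tau> j then (stepop q ^^ (\<tau> j - \<tau> i)) (kdelta (u j)) (u i) * f j else 0))"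
  define W where "W = Matrix.mat l m (\<lambda>(i, j). ?w j (T - \<tau> i) (\<tau> i) (u i))"
  define I where "I = (1\<^sub>m l :: 'a mat)"
  have carr [simp]: "M0 \<in> carrier_mat m m" "L \<in> carrier_mat m m" "A \<in> carrier_mat m l" "B \<in> carrier_mat l m"
    "U \<in> carrier_mat l l" "W \<in> carrier_mat l m" "I \<in> carrier_mat l l"
    by (auto simp: M0_def L_def A_def B_def U_def W_def I_def)
  have duh: "?w j n t a = (stepop q ^^ n) (ebas q j) a +
    (\<Sum>i<l. (if t < \<tau> i \<and> \<tau> i \<le> t + n then f i * ?w j (t + n - \<tau> i) (\<tau> i) (u i) else 0)
              * (stepop q ^^ (\<tau> i - t)) (kdelta (u i)) a)" for j n t a
    by (rule weighted_iter_duhamel[OF g])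
  have LW: "L = M0 + A * W"
  proof (rule eq_matI)
    fix r j assume "r < dim_row (M0 + A * W)" "j < dim_col (M0 + A * W)"
    hence rj: "r < m" "j < m" by (auto simp: A_def W_def)
    have "?w j T 0 (x ! r) = (stepop q ^^ T) (ebas q j) (x ! r) +
       (\<Sum>i<l. (stepop q ^^ \<tau> i) (kdelta (u i)) (x ! r) * f i * ?w j (T - \<tau> i) (\<tau> i) (u i))"
      by (subst duh) (use \<tau> in \<open>auto intro!: sum.cong simp: mult_ac\<close>)
    thus "L $$ (r, j) = (M0 + A * W) $$ (r, j)"
      using rj by (simp add: L_def M0_def A_def W_def scalar_prod_def lessThan_atLeast0)
  qed (auto simp: L_def A_def W_def)
  have WB: "W = B * M0 + U * W"
  proof (rule eq_matI)
    fix i j assume "i < dim_row (B * M0 + U * W)" "j < dim_col (B * M0 + U * W)"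
    hence ij: "i < l" "j < m" by (auto simp: U_def W_def)
    have "?w j (T - \<tau> i) (\<tau> i) (u i) = (stepop q ^^ (T - \<tau> i)) (ebas q j) (u i) +
       (\<Sum>k<l. (if \<tau> i < \<tau> k then (stepop q ^^ (\<tau> k - \<tau> i)) (kdelta (u k)) (u i) * f k else 0) * ?w j (T - \<tau> k) (\<tau> k) (u k))"
      by (subst duh) (use \<tau> ij in \<open>auto intro!: sum.cong simp: mult_ac\<close>)
    also have "(stepop q ^^ (T - \<tau> i)) (ebas q j) (u i) =
       (\<Sum>r<m. (cumop q ^^ \<tau> i) (lagr q x r) (u i) * (stepop q ^^ T) (ebas q j) (x ! r))"
      using lagr_interpolates[OF q x(1), of j "\<tau> i" T "u i"] ij x(2) \<tau> by simp
    finally show "W $$ (i, j) = (B * M0 + U * W) $$ (i, j)"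
      using ij by (simp add: B_def U_def M0_def W_def scalar_prod_def lessThan_atLeast0)
  qed (auto simp: U_def W_def)
  \<comment> \<open>U links a mark only to strictly later ones, so the adjugate of I - U is its
    inverse.\<close>
  have detU: "Determinant.det (I - U) = 1"
  proof -
    have "I - U = Matrix.mat l l (\<lambda>(i, j). of_bool (i = j) +
        (- (if \<tau> i < \<tau> j then (stepop q ^^ (\<tau> j - \<tau> i)) (kdelta (u j)) (u i) * f j else 0)))"
      by (intro eq_matI) (auto simp: I_def U_def)
    thus ?thesis by (simp only:) (rule det_strict_rank[of _ \<tau>], auto)
  qed
  define V where "V = adj_mat (I - U)"
  have IU: "I - U \<in> carrier_mat l l" by (simp add: minus_carrier_mat)
  have V [simp]: "V \<in> carrier_mat l l" and VI: "(I - U) * V = 1\<^sub>m l" "V * (I - U) = 1\<^sub>m l"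
    using adj_mat[OF IU] detU by (auto simp: V_def)
  have BM: "B * M0 = (I - U) * W"
  proof -
    have "(I - U) * W = I * W - U * W" by (rule minus_mult_distrib_mat[OF carr(7,5,6)])
    also have "I * W = W" unfolding I_def by (rule left_mult_one_mat[OF carr(6)])
    also have "\<dots> - U * W = B * M0"
    proof -
      have "B * M0 + U * W - U * W = B * M0"
        by (intro eq_matI) (auto simp: U_def W_def B_def M0_def)
      thus ?thesis using WB by simp
    qed
    finally show ?thesis by simp
  qed
  define Z where "Z = V * B"
  have Z: "Z \<in> carrier_mat l m" unfolding Z_def by (rule mult_carrier_mat[OF V carr(4)])
  have "Z * M0 = V * (B * M0)" unfolding Z_def by (rule assoc_mult_mat[OF V carr(4,1)])
  also have "\<dots> = (V * (I - U)) * W" unfolding BM by (rule assoc_mult_mat[symmetric, OF V IU carr(6)])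
  also have "\<dots> = W" unfolding VI by (rule left_mult_one_mat[OF carr(6)])
  finally have WZ: "W = Z * M0" by simp
  have AZ: "A * Z \<in> carrier_mat m m" "Z * A \<in> carrier_mat l l"
    using mult_carrier_mat[OF carr(3) Z] mult_carrier_mat[OF Z carr(3)] by auto
  have "L = (1\<^sub>m m + A * Z) * M0"
  proof -
    have "A * (Z * M0) = (A * Z) * M0" by (rule assoc_mult_mat[symmetric, OF carr(3) Z carr(1)])
    moreover have "(1\<^sub>m m + A * Z) * M0 = 1\<^sub>m m * M0 + (A * Z) * M0"
      by (rule add_mult_distrib_mat[OF one_carrier_mat AZ(1) carr(1)])
    moreover have "1\<^sub>m m * M0 = M0" by (rule left_mult_one_mat[OF carr(1)])
    ultimately show ?thesis unfolding LW WZ by simp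
  qed
  hence "Determinant.det L = Determinant.det (1\<^sub>m m + A * Z) * Determinant.det M0"
    using det_mult[OF add_carrier_mat[OF AZ(1)] carr(1)] by simp
  also have "Determinant.det (1\<^sub>m m + A * Z) = Determinant.det (1\<^sub>m l + Z * A)"
    by (rule det_one_plus_mult_commute[OF carr(3) Z])
  \<comment> \<open>Multiplication by I - U, of determinant 1, clears the inverse and leaves I - U +
    B A.\<close>
  also have "\<dots> = Determinant.det ((I - U) * (1\<^sub>m l + Z * A))"
    using det_mult[OF IU add_carrier_mat[OF AZ(2)], of "1\<^sub>m l"] detU by simp
  also have "(I - U) * (1\<^sub>m l + Z * A) = (I - U) + B * A"
  proof -
    have "(I - U) * (1\<^sub>m l + Z * A) = (I - U) * 1\<^sub>m l + (I - U) * (Z * A)"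
      by (rule mult_add_distrib_mat[OF IU one_carrier_mat AZ(2)])
    moreover have "(I - U) * (Z * A) = ((I - U) * Z) * A" by (rule assoc_mult_mat[symmetric, OF IU Z carr(3)])
    moreover have "(I - U) * Z = ((I - U) * V) * B"
      unfolding Z_def by (rule assoc_mult_mat[symmetric, OF IU V carr(4)])
    moreover have "(I - U) * 1\<^sub>m l = I - U" using IU by (rule right_mult_one_mat)
    moreover have "1\<^sub>m l * B = B" by (rule left_mult_one_mat[OF carr(4)])
    ultimately show ?thesis by (simp only: VI)
  qed
  also have "(I - U) + B * A = Matrix.mat l l (\<lambda>(i, j). of_bool (i = j) + walk_kernel q x (u i) (\<tau> i) (u j) (\<tau> j) * f j)"
    by (intro eq_matI)
       (auto simp: I_def U_def B_def A_def walk_kernel_def x scalar_prod_def lessThan_atLeast0 sum_distrib_right sum_distrib_left algebra_simps)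
  finally show ?thesis by (simp only: L_def M0_def)
qed

section \<open>The transition probabilities as a Doob transform\<close>

lemma prod_pairs:
  fixes a :: "nat \<Rightarrow> 'a :: comm_monoid_mult"
  shows "(\<Prod>i<m. \<Prod>l<i. a i * a l) = (\<Prod>i<m. a i) ^ (m - 1)"
proof (induction m)
  case (Suc m)
  have "(\<Prod>i<Suc m. \<Prod>l<i. a i * a l) = (\<Prod>i<m. a i) ^ (m - 1) * (\<Prod>l<m. a m * a l)"
    by (simp add: Suc)
  also have "(\<Prod>l<m. a m * a l) = a m ^ m * (\<Prod>i<m. a i)"
    by (simp add: prod.distrib)
  also have "(\<Prod>i<m. a i) ^ (m - 1) * (a m ^ m * (\<Prod>i<m. a i)) = (\<Prod>i<Suc m. a i) ^ (Suc m - 1)"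
    by (cases m) (simp_all add: power_mult_distrib mult_ac)
  finally show ?case .
qed simp

lemma det_ebas:
  "Determinant.det (Matrix.mat m m (\<lambda>(i, j). ebas q j (y ! i))) =
     (\<Prod>i<m. \<Prod>l<i. 1 / q ^ (y ! i) - 1 / q ^ (y ! l)) / (\<Prod>i<m. kap q (y ! i))"
proof -
  have "Determinant.det (Matrix.mat m m (\<lambda>(i, j). ebas q j (y ! i))) =
    (\<Sum>p\<in>{p. p permutes {0..<m}}. signof p * (\<Prod>i<m. ebas q (p i) (y ! i)))"
    by (rule det_mat_perm)
  also have "\<dots> = (\<Sum>p\<in>{p. p permutes {0..<m}}. signof p * (\<Prod>i<m. (1 / q ^ (y ! i)) ^ p i)) / (\<Prod>i<m. kap q (y ! i))"
    unfolding sum_divide_distrib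
    by (intro sum.cong refl) (simp add: ebas_def prod_dividef prod.distrib power_divide mult.commute flip: power_mult)
  also have "(\<Sum>p\<in>{p. p permutes {0..<m}}. signof p * (\<Prod>i<m. (1 / q ^ (y ! i)) ^ p i))
     = Determinant.det (Matrix.mat m m (\<lambda>(i, j). (1 / q ^ (y ! i)) ^ j))"
    by (rule det_mat_perm[symmetric])
  finally show ?thesis by (simp only: det_vandermonde)
qed

lemma real_power_neq_one:
  fixes q :: real
  assumes "0 < q" "q < 1" "n > 0"
  shows "q ^ n \<noteq> 1"
  using assms power_Suc_less_one[of q "n - 1"] by simp

lemma det_ebas_nonzero:
  fixes q :: "'a :: field"
  assumes q: "q \<noteq> 0" "\<And>n. n > 0 \<Longrightarrow> q ^ n \<noteq> 1" and x: "x \<in> W m"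
  shows "Determinant.det (Matrix.mat m m (\<lambda>(i, j). ebas q j (x ! i))) \<noteq> 0"
proof -
  have "1 / q ^ (x ! i) - 1 / q ^ (x ! l) \<noteq> 0" if "i < m" "l < i" for i l
  proof -
    have "x ! l > x ! i" using x that by (simp add: W_def sorted_wrt_iff_nth_less)
    thus ?thesis using inverse_power_inj[OF q, of "x ! i" "x ! l"] by auto
  qed
  thus ?thesis by (auto simp: det_ebas kap_nonzero[OF q])
qed

text \<open>Passing from q^y to q^(-y) extracts q^(y_i + y_j) from every pair. Each site occurs in m
  - 1 pairs, so this cancels the power of q^(|x| - |y|) in \<open>Upsilon\<close>, and the signs
  cancel in the ratio. The Vandermonde products over \<open>kap\<close> are the determinants of
  \<open>ebas\<close>.\<close>

lemma Upsilon_eq_det_ratio: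
  fixes q :: real
  assumes q: "0 < q" "q < 1" and x: "x \<in> W m" and y: "y \<in> succs m x"
  shows "Upsilon q m x y * q ^ (m choose 2) * Determinant.det (Matrix.mat m m (\<lambda>(i, j). ebas q j (x ! i)))
     = (\<Prod>i<m. stepw q (x ! i) (y ! i)) * Determinant.det (Matrix.mat m m (\<lambda>(i, j). ebas q j (y ! i)))"
proof -
  define V where "V z = (\<Prod>i<m. \<Prod>l<i. 1 / q ^ (z ! i) - 1 / q ^ (z ! l))" for z :: "nat list"
  define k where "k z = (\<Prod>i<m. kap q (z ! i))" for z
  have neq: "q \<noteq> 0" "\<And>n. n > 0 \<Longrightarrow> q ^ n \<noteq> 1" using q real_power_neq_one by auto
  have k: "k z \<noteq> 0" for z by (simp add: k_def kap_nonzero[OF neq])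
  have pairs: "(\<Prod>(i, j) \<in> {(i, j). i < j \<and> j < m}. h i j) = (\<Prod>j<m. \<Prod>i<j. h i j)" for h :: "nat \<Rightarrow> nat \<Rightarrow> real"
  proof -
    have "(\<Prod>j<m. \<Prod>i<j. h i j) = (\<Prod>(j, i)\<in>Sigma {..<m} (\<lambda>j. {..<j}). h i j)"
      by (rule prod.Sigma) auto
    also have "\<dots> = (\<Prod>(i, j) \<in> {(i, j). i < j \<and> j < m}. h i j)"
      by (rule prod.reindex_bij_witness[where i = prod.swap and j = prod.swap]) auto
    finally show ?thesis by simp
  qed
  have vand: "(\<Prod>j<m. \<Prod>i<j. q ^ (z ! j) - q ^ (z ! i)) =
      (\<Prod>j<m. \<Prod>i<j. -1) * (q ^ sum_list z) ^ (m - 1) * V z" if "length z = m" for z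
  proof -
    have "(\<Prod>j<m. \<Prod>i<j. q ^ (z ! j) - q ^ (z ! i)) =
       (\<Prod>j<m. \<Prod>i<j. (- 1) * (q ^ (z ! j) * q ^ (z ! i)) * (1 / q ^ (z ! j) - 1 / q ^ (z ! i)))"
      using q(1) by (intro prod.cong refl) (simp add: field_simps)
    also have "\<dots> = (\<Prod>j<m. \<Prod>i<j. -1) * (\<Prod>j<m. \<Prod>i<j. q ^ (z ! j) * q ^ (z ! i)) * V z"
      by (simp only: prod.distrib V_def)
    also have "(\<Prod>j<m. \<Prod>i<j. q ^ (z ! j) * q ^ (z ! i)) = (\<Prod>i<m. q ^ (z ! i)) ^ (m - 1)"
      by (rule prod_pairs)
    also have "(\<Prod>i<m. q ^ (z ! i)) = q ^ sum_list z"
      using that by (simp add: power_sum[symmetric] sum_list_sum_nth lessThan_atLeast0)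
    finally show ?thesis .
  qed
  have len: "length x = m" "length y = m" using x y by (auto simp: W_def succs_def)
  have V0: "V x \<noteq> 0"
    using det_ebas_nonzero[OF neq x] by (auto simp: det_ebas V_def)
  \<comment> \<open>A single-walker probability is the corresponding entry of \<open>stepop\<close>
    with the conjugation by \<open>kap\<close> undone.\<close>
  have w: "q ^ (x ! i) * of_bool (int (y ! i) = int (x ! i)) + (1 - q ^ (x ! i)) * of_bool (int (y ! i) = int (x ! i) - 1)
      = stepw q (x ! i) (y ! i) * kap q (x ! i) / kap q (y ! i)" if i: "i < m" for i
  proof -
    consider "y ! i = x ! i" | "x ! i = Suc (y ! i)" using y i by (auto simp: succs_def)
    thus ?thesis
    proof cases
      case 1
      thus ?thesis using kap_nonzero[OF neq] by (simp add: stepw_def)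
    next
      case 2
      have "q ^ (y ! i) * kap q (Suc (y ! i)) / kap q (y ! i) = - (1 - q ^ Suc (y ! i))"
        using kap_nonzero[OF neq, of "y ! i"] by (simp only: kap_Suc[OF neq(1)]) simp
      thus ?thesis unfolding 2 by (simp add: stepw_def)
    qed
  qed
  define c where "c = (\<Prod>j<m. \<Prod>i<j. -1 :: real)"
  have c: "c \<noteq> 0" by (simp add: c_def)
  have ratio: "(\<Prod>(i, j) \<in> {(i, j). i < j \<and> j < m}. (q ^ (y ! j) - q ^ (y ! i)) / (q ^ (x ! j) - q ^ (x ! i)))
     = (q ^ sum_list y) ^ (m - 1) / (q ^ sum_list x) ^ (m - 1) * (V y / V x)"
    unfolding pairs prod_dividef vand[OF len(1)] vand[OF len(2)] c_def[symmetric] using c by simp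
  have pw: "q powi (- int (m choose 2) + (int m - 1) * (int (sum_list x) - int (sum_list y)))
     = (q ^ sum_list x) ^ (m - 1) / (q ^ sum_list y) ^ (m - 1) / q ^ (m choose 2)"
  \<comment> \<open>For m = 0 the integer m - 1 and the natural number \<open>m - 1\<close> differ,
    but both coordinate sums are empty.\<close>
  proof (cases "m = 0")
    case True
    moreover have "0 choose 2 = (0 :: nat)" by (simp add: numeral_2_eq_2)
    ultimately show ?thesis using len by (simp del: binomial_eq_0_iff)
  next
    case False
    hence e: "- int (m choose 2) + (int m - 1) * (int (sum_list x) - int (sum_list y))
      = int (sum_list x * (m - 1)) - int (sum_list y * (m - 1)) - int (m choose 2)"
      by (simp add: algebra_simps of_nat_diff)
    show ?thesis unfolding e using q(1)
      by (simp only: power_int_diff power_int_of_nat power_mult order_less_imp_not_eq2 disjI1 not_False_eq_True)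
  qed
  have prodw: "(\<Prod>i<m. q ^ (x ! i) * of_bool (int (y ! i) = int (x ! i)) + (1 - q ^ (x ! i)) * of_bool (int (y ! i) = int (x ! i) - 1))
     = (\<Prod>i<m. stepw q (x ! i) (y ! i)) * k x / k y"
  proof -
    have "(\<Prod>i<m. q ^ (x ! i) * of_bool (int (y ! i) = int (x ! i)) + (1 - q ^ (x ! i)) * of_bool (int (y ! i) = int (x ! i) - 1))
     = (\<Prod>i<m. stepw q (x ! i) (y ! i) * kap q (x ! i) / kap q (y ! i))"
      by (rule prod.cong) (simp_all add: w del: of_nat_eq_iff)
    thus ?thesis by (simp add: prod_dividef prod.distrib k_def)
  qed
  have "Upsilon q m x y = (\<Prod>i<m. stepw q (x ! i) (y ! i)) * k x / k y * (V y / V x) / q ^ (m choose 2)"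
    unfolding Upsilon_def ratio pw prodw using q(1) by (simp add: mult_ac)
  thus ?thesis unfolding det_ebas V_def[symmetric] k_def[symmetric]
    using k V0 q(1) by simp
qed

text \<open>The expectation of the product of \<open>G\<close> over the next n times, given state s
  at time t. As in \<open>weighted_iter\<close>, the current time t carries no weight.\<close>

primrec pathsum :: "real \<Rightarrow> nat \<Rightarrow> (nat \<Rightarrow> nat list \<Rightarrow> real) \<Rightarrow> nat \<Rightarrow> nat \<Rightarrow> nat list \<Rightarrow> real" where
  "pathsum q m G 0 t s = 1"
| "pathsum q m G (Suc n) t s = (\<Sum>y\<in>succs m s. Upsilon q m s y * G (Suc t) y * pathsum q m G n (Suc t) y)"

text \<open>Every step trades the determinant at its start for the one at its end, so along a path
  these ratios telescope. The sum over the next state is then the row expansion of the determinant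
  of the weighted functions.\<close>

lemma pathsum_eq_det:
  fixes q :: real
  assumes q: "0 < q" "q < 1"
  assumes G: "\<And>t y. G t y = (\<Prod>i<m. g t (y ! i))"
  shows "s \<in> W m \<Longrightarrow> pathsum q m G n t s * (q ^ (m choose 2)) ^ n
      * Determinant.det (Matrix.mat m m (\<lambda>(i, j). ebas q j (s ! i)))
    = Determinant.det (Matrix.mat m m (\<lambda>(i, j). weighted_iter g q (ebas q j) n t (s ! i)))"
proof (induction n arbitrary: t s)
  case (Suc n)
  let ?D = "\<lambda>s. Determinant.det (Matrix.mat m m (\<lambda>(i, j). ebas q j (s ! i)))"
  have "pathsum q m G (Suc n) t s * (q ^ (m choose 2)) ^ Suc n * ?D s =
    (\<Sum>y\<in>succs m s. (Upsilon q m s y * q ^ (m choose 2) * ?D s) * G (Suc t) y * (pathsum q m G n (Suc t) y * (q ^ (m choose 2)) ^ n))"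
    by (simp add: sum_distrib_left sum_distrib_right mult_ac)
  also have "\<dots> = (\<Sum>y\<in>succs m s. (\<Prod>i<m. stepw q (s ! i) (y ! i)) * (G (Suc t) y * (pathsum q m G n (Suc t) y * (q ^ (m choose 2)) ^ n * ?D y)))"
  proof (intro sum.cong refl)
    fix y assume y: "y \<in> succs m s"
    show "(Upsilon q m s y * q ^ (m choose 2) * ?D s) * G (Suc t) y * (pathsum q m G n (Suc t) y * (q ^ (m choose 2)) ^ n)
      = (\<Prod>i<m. stepw q (s ! i) (y ! i)) * (G (Suc t) y * (pathsum q m G n (Suc t) y * (q ^ (m choose 2)) ^ n * ?D y))"
      unfolding Upsilon_eq_det_ratio[OF q Suc.prems y] by (simp only: mult_ac)
  qed
  also have "\<dots> = (\<Sum>y\<in>succs m s. (\<Prod>i<m. stepw q (s ! i) (y ! i)) *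
       Determinant.det (Matrix.mat m m (\<lambda>(i, j). g (Suc t) (y ! i) * weighted_iter g q (ebas q j) n (Suc t) (y ! i))))"
  proof (intro sum.cong refl arg_cong2[where f = times])
    fix y assume "y \<in> succs m s"
    hence "y \<in> W m" by (simp add: succs_def)
    hence "pathsum q m G n (Suc t) y * (q ^ (m choose 2)) ^ n * ?D y
       = Determinant.det (Matrix.mat m m (\<lambda>(i, j). weighted_iter g q (ebas q j) n (Suc t) (y ! i)))"
      by (rule Suc.IH)
    thus "G (Suc t) y * (pathsum q m G n (Suc t) y * (q ^ (m choose 2)) ^ n * ?D y) =
      Determinant.det (Matrix.mat m m (\<lambda>(i, j). g (Suc t) (y ! i) * weighted_iter g q (ebas q j) n (Suc t) (y ! i)))"
      by (simp only: det_mat_perm G prod.distrib sum_distrib_left mult_ac)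
  qed
  also have "\<dots> = Determinant.det (Matrix.mat m m (\<lambda>(i, j). weighted_iter g q (ebas q j) (Suc n) t (s ! i)))"
    using det_stepop_expand[OF Suc.prems, of q "\<lambda>j a. g (Suc t) a * weighted_iter g q (ebas q j) n (Suc t) a"]
    by simp
  finally show ?case .
qed simp

section \<open>Correlation functions of the chain\<close>

locale q_walks = prob_space M for M :: "'w measure" +
  fixes q :: real and m :: nat and x :: "nat list" and Y :: "nat \<Rightarrow> 'w \<Rightarrow> nat list"
  assumes q: "0 < q" "q < 1" and x: "x \<in> W m" and mc: "markov_chain M (W m) (Upsilon q m) x Y"

lemma (in q_walks) chain_in_W: "\<omega> \<in> space M \<Longrightarrow> Y t \<omega> \<in> W m"
  using mc measurable_space[of "Y t" M "count_space (W m)" \<omega>] by (simp add: markov_chain_def)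

lemma (in q_walks) chain_measurable: "Y t \<in> measurable M (count_space UNIV)"
proof -
  have "Y t \<in> measurable M (count_space (W m))" using mc by (simp add: markov_chain_def)
  thus ?thesis by (rule measurable_compose) simp
qed

lemma (in q_walks) chain_fun_measurable: "(\<lambda>\<omega>. F (Y t \<omega>)) \<in> borel_measurable M"
  for F :: "nat list \<Rightarrow> real"
  by (rule measurable_compose[OF chain_measurable]) simp

definition (in q_walks) prefix_event :: "nat \<Rightarrow> (nat \<Rightarrow> nat list) \<Rightarrow> 'w set" where
  "prefix_event t s = {\<omega> \<in> space M. \<forall>i\<le>t. Y i \<omega> = s i}"

lemma (in q_walks) chain_eq_sets: "{\<omega> \<in> space M. Y t \<omega> = c} \<in> sets M"
proof -
  have "{\<omega> \<in> space M. Y t \<omega> = c} = Y t -` {c} \<inter> space M" by auto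
  thus ?thesis using measurable_sets[OF chain_measurable, of "{c}"] by simp
qed

lemma (in q_walks) prefix_event_sets [measurable]: "prefix_event t s \<in> sets M"
proof -
  have "prefix_event t s = (\<Inter>i\<in>{..t}. {\<omega> \<in> space M. Y i \<omega> = s i})"
    by (auto simp: prefix_event_def)
  also have "\<dots> \<in> sets M" by (rule sets.finite_INT) (auto simp: chain_eq_sets)
  finally show ?thesis .
qed

lemma all_le_Suc: "(\<forall>i\<le>Suc t. P i) \<longleftrightarrow> (\<forall>i\<le>t. P i) \<and> P (Suc t)"
  by (auto simp: le_Suc_eq)

text \<open>The Markov property constrains only conditioning on events of positive probability. If
  the shorter prefix is null, monotonicity makes the longer one null as well.\<close>

lemma (in q_walks) prefix_event_Suc:
  assumes s: "\<And>i. i \<le> Suc t \<Longrightarrow> s i \<in> W m"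
  shows "prob (prefix_event (Suc t) s) = prob (prefix_event t s) * Upsilon q m (s t) (s (Suc t))"
proof (cases "prob (prefix_event t s) > 0")
  case True
  have "cond_prob M (\<lambda>\<omega>. Y (Suc t) \<omega> = s (Suc t)) (\<lambda>\<omega>. \<forall>i\<le>t. Y i \<omega> = s i) = Upsilon q m (s t) (s (Suc t))"
  proof -
    have pos: "prob {\<omega> \<in> space M. \<forall>i\<le>t. Y i \<omega> = s i} > 0" using True by (simp only: prefix_event_def)
    show ?thesis
      by (rule mc[unfolded markov_chain_def, THEN conjunct2, THEN conjunct2, THEN conjunct2, rule_format])
         (use s pos in auto)
  qed
  moreover have "{\<omega> \<in> space M. Y (Suc t) \<omega> = s (Suc t) \<and> (\<forall>i\<le>t. Y i \<omega> = s i)} = prefix_event (Suc t) s"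
    unfolding prefix_event_def all_le_Suc by blast
  moreover have "{\<omega> \<in> space M. \<forall>i\<le>t. Y i \<omega> = s i} = prefix_event t s" by (simp add: prefix_event_def)
  ultimately have "prob (prefix_event (Suc t) s) / prob (prefix_event t s) = Upsilon q m (s t) (s (Suc t))"
    by (simp only: cond_prob_def)
  thus ?thesis using True by (simp add: divide_eq_eq)
next
  case False
  hence "prob (prefix_event t s) = 0" using measure_nonneg[of M "prefix_event t s"] by linarith
  moreover have "prob (prefix_event (Suc t) s) \<le> prob (prefix_event t s)"
  proof (rule finite_measure_mono[OF _ prefix_event_sets])
    show "prefix_event (Suc t) s \<subseteq> prefix_event t s" unfolding prefix_event_def all_le_Suc by blast
  qed
  ultimately show ?thesis using measure_nonneg[of M "prefix_event (Suc t) s"] by simp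
qed

lemma (in q_walks) Upsilon_eq_0:
  assumes "y \<in> W m" "y \<notin> succs m s"
  shows "Upsilon q m s y = 0"
proof -
  obtain i where "i < m" "y ! i \<noteq> s ! i" "Suc (y ! i) \<noteq> s ! i" using assms by (auto simp: succs_def)
  hence "(\<Prod>i<m. q ^ (s ! i) * of_bool (int (y ! i) = int (s ! i)) + (1 - q ^ (s ! i)) * of_bool (int (y ! i) = int (s ! i) - 1)) = 0"
    by (intro prod_zero) (auto intro!: bexI[of _ i])
  thus ?thesis unfolding Upsilon_def by (simp only: mult_zero_right)
qed

text \<open>Each state outside \<open>succs\<close> extends the prefix with probability 0, and there
  are only countably many states to discard.\<close>

lemma (in q_walks) AE_next_in_succs:
  assumes s: "\<And>i. i \<le> t \<Longrightarrow> s i \<in> W m"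
  shows "AE \<omega> in M. \<omega> \<in> prefix_event t s \<longrightarrow> Y (Suc t) \<omega> \<in> succs m (s t)"
proof -
  have "AE \<omega> in M. \<not> (\<omega> \<in> prefix_event t s \<and> Y (Suc t) \<omega> = y)" if y: "y \<in> W m - succs m (s t)" for y
  proof -
    let ?s = "s(Suc t := y)"
    have "prob (prefix_event (Suc t) ?s) = 0"
      using y s by (subst prefix_event_Suc) (auto simp: Upsilon_eq_0)
    hence "prefix_event (Suc t) ?s \<in> null_sets M"
      by (intro null_setsI) (auto simp: emeasure_eq_measure)
    moreover have "prefix_event (Suc t) ?s = {\<omega> \<in> space M. \<omega> \<in> prefix_event t s \<and> Y (Suc t) \<omega> = y}"
      unfolding prefix_event_def all_le_Suc by auto
    ultimately have "{\<omega> \<in> space M. \<omega> \<in> prefix_event t s \<and> Y (Suc t) \<omega> = y} \<in> null_sets M" by simp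
    from AE_not_in[OF this] AE_space show ?thesis by eventually_elim auto
  qed
  hence "AE \<omega> in M. \<forall>y\<in>W m - succs m (s t). \<not> (\<omega> \<in> prefix_event t s \<and> Y (Suc t) \<omega> = y)"
    by (subst AE_ball_countable) auto
  with AE_space show ?thesis by eventually_elim (use chain_in_W in blast)
qed

text \<open>Up to a null set, the prefix event splits into finitely many prefixes longer by one
  state; the induction therefore varies both the time and the prefix. The bound \<open>C\<close>
  supplies integrability.\<close>

lemma (in q_walks) integral_prefix_event:
  assumes G: "\<And>t y. y \<in> W m \<Longrightarrow> \<bar>G t y\<bar> \<le> C"
  shows "(\<And>i. i \<le> t \<Longrightarrow> s i \<in> W m) \<Longrightarrow>
    (\<integral>\<omega>. indicator (prefix_event t s) \<omega> * (\<Prod>k\<in>{t<..t+n}. G k (Y k \<omega>)) \<partial>M)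
      = prob (prefix_event t s) * pathsum q m G n t (s t)"
proof (induction n arbitrary: t s)
  case 0
  thus ?case by simp
next
  case (Suc n)
  let ?P = "\<lambda>\<omega>. \<Prod>k\<in>{Suc t<..Suc t+n}. G k (Y k \<omega>)"
  let ?s = "\<lambda>y. s(Suc t := y)"
  have meas [measurable]: "(\<lambda>\<omega>. \<Prod>k\<in>K. G k (Y k \<omega>)) \<in> borel_measurable M" for K
    by (intro borel_measurable_prod chain_fun_measurable)
  have int: "integrable M (\<lambda>\<omega>. indicator (prefix_event (Suc t) (?s y)) \<omega> * ?P \<omega>)" for y
  proof (rule integrable_const_bound[where B = "\<bar>C\<bar> ^ n"])
    show "AE \<omega> in M. norm (indicator (prefix_event (Suc t) (?s y)) \<omega> * ?P \<omega>) \<le> \<bar>C\<bar> ^ n"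
    proof (rule AE_I2)
      fix \<omega> assume "\<omega> \<in> space M"
      hence "\<bar>G k (Y k \<omega>)\<bar> \<le> \<bar>C\<bar>" for k using G[of "Y k \<omega>" k] chain_in_W[of \<omega> k] by linarith
      hence "\<bar>?P \<omega>\<bar> \<le> (\<Prod>k\<in>{Suc t<..Suc t+n}. \<bar>C\<bar>)" unfolding abs_prod by (intro prod_mono) auto
      thus "norm (indicator (prefix_event (Suc t) (?s y)) \<omega> * ?P \<omega>) \<le> \<bar>C\<bar> ^ n"
        by (auto simp: indicator_def)
    qed
  qed measurable
  have "(\<integral>\<omega>. indicator (prefix_event t s) \<omega> * (\<Prod>k\<in>{t<..t+Suc n}. G k (Y k \<omega>)) \<partial>M)
     = (\<integral>\<omega>. (\<Sum>y\<in>succs m (s t). G (Suc t) y * (indicator (prefix_event (Suc t) (?s y)) \<omega> * ?P \<omega>)) \<partial>M)"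
  proof (rule integral_cong_AE)
    have next_succ: "AE \<omega> in M. \<omega> \<in> prefix_event t s \<longrightarrow> Y (Suc t) \<omega> \<in> succs m (s t)"
      by (rule AE_next_in_succs) (rule Suc.prems)
    show "AE \<omega> in M. indicator (prefix_event t s) \<omega> * (\<Prod>k\<in>{t<..t+Suc n}. G k (Y k \<omega>))
      = (\<Sum>y\<in>succs m (s t). G (Suc t) y * (indicator (prefix_event (Suc t) (?s y)) \<omega> * ?P \<omega>))"
      using next_succ
    proof eventually_elim
      case (elim \<omega>)
      show ?case
      proof (cases "\<omega> \<in> prefix_event t s")
        case True
        with elim have Y: "Y (Suc t) \<omega> \<in> succs m (s t)" by simp
        have ind: "indicator (prefix_event (Suc t) (?s y)) \<omega> = (of_bool (y = Y (Suc t) \<omega>) :: real)" for y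
          using True unfolding prefix_event_def all_le_Suc by (auto simp: indicator_def)
        have "{t<..t+Suc n} = insert (Suc t) {Suc t<..Suc t+n}" by auto
        moreover have "(\<Sum>y\<in>succs m (s t). G (Suc t) y * (of_bool (y = Y (Suc t) \<omega>) * ?P \<omega>))
          = (\<Sum>y\<in>succs m (s t). if y = Y (Suc t) \<omega> then G (Suc t) y * ?P \<omega> else 0)"
          by (rule sum.cong) auto
        ultimately show ?thesis using True Y finite_succs by (simp add: ind)
      next
        case False
        hence "\<omega> \<notin> prefix_event (Suc t) (?s y)" for y unfolding prefix_event_def all_le_Suc by simp
        thus ?thesis using False by simp
      qed
    qed
  qed measurable
  also have "\<dots> = (\<Sum>y\<in>succs m (s t). G (Suc t) y * (\<integral>\<omega>. indicator (prefix_event (Suc t) (?s y)) \<omega> * ?P \<omega> \<partial>M))"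
    by (subst Bochner_Integration.integral_sum, rule integrable_mult_right, rule int) (simp only: integral_mult_right_zero)
  also have "\<dots> = (\<Sum>y\<in>succs m (s t). G (Suc t) y * (prob (prefix_event t s) * Upsilon q m (s t) y * pathsum q m G n (Suc t) y))"
  proof (rule sum.cong[OF refl])
    fix y assume y: "y \<in> succs m (s t)"
    hence w: "?s y i \<in> W m" if "i \<le> Suc t" for i using Suc.prems[of i] that by (auto simp: succs_def)
    have "prefix_event t (?s y) = prefix_event t s" by (auto simp: prefix_event_def)
    moreover have "(\<integral>\<omega>. indicator (prefix_event (Suc t) (?s y)) \<omega> * ?P \<omega> \<partial>M)
       = prob (prefix_event (Suc t) (?s y)) * pathsum q m G n (Suc t) (?s y (Suc t))"
      by (rule Suc.IH) (rule w)
    ultimately show "G (Suc t) y * (\<integral>\<omega>. indicator (prefix_event (Suc t) (?s y)) \<omega> * ?P \<omega> \<partial>M)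
       = G (Suc t) y * (prob (prefix_event t s) * Upsilon q m (s t) y * pathsum q m G n (Suc t) y)"
      by (simp add: prefix_event_Suc[of t "?s y", OF w])
  qed
  also have "\<dots> = prob (prefix_event t s) * pathsum q m G (Suc n) t (s t)"
    by (simp add: sum_distrib_left mult_ac)
  finally show ?case .
qed

lemma (in q_walks) expectation_eq_pathsum:
  assumes G: "\<And>t y. y \<in> W m \<Longrightarrow> \<bar>G t y\<bar> \<le> C"
  shows "(\<integral>\<omega>. (\<Prod>k\<in>{1..n}. G k (Y k \<omega>)) \<partial>M) = pathsum q m G n 0 x"
proof -
  have [measurable]: "(\<lambda>\<omega>. \<Prod>k\<in>K. G k (Y k \<omega>)) \<in> borel_measurable M" for K
    by (intro borel_measurable_prod chain_fun_measurable)
  have Y0: "AE \<omega> in M. Y 0 \<omega> = x" using mc by (simp add: markov_chain_def)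
  have one: "prob (prefix_event 0 (\<lambda>_. x)) = 1"
    using Y0 by (subst prob_eq_1[OF prefix_event_sets]) (auto simp: prefix_event_def)
  have "(\<integral>\<omega>. (\<Prod>k\<in>{1..n}. G k (Y k \<omega>)) \<partial>M)
     = (\<integral>\<omega>. indicator (prefix_event 0 (\<lambda>_. x)) \<omega> * (\<Prod>k\<in>{0<..0+n}. G k (Y k \<omega>)) \<partial>M)"
  proof (rule integral_cong_AE)
    show "AE \<omega> in M. (\<Prod>k\<in>{1..n}. G k (Y k \<omega>)) = indicator (prefix_event 0 (\<lambda>_. x)) \<omega> * (\<Prod>k\<in>{0<..0+n}. G k (Y k \<omega>))"
      using Y0 AE_space by eventually_elim (auto simp: prefix_event_def atLeastSucAtMost_greaterThanAtMost)
  qed measurable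
  also have "\<dots> = pathsum q m G n 0 x"
    using integral_prefix_event[of G C 0 "\<lambda>_. x" n] G x one by simp
  finally show ?thesis .
qed

lemma (in q_walks) expectation_eq_det:
  assumes \<tau>: "\<And>i. i < l \<Longrightarrow> 0 < \<tau> i \<and> \<tau> i \<le> T"
    and g: "\<And>t a. g t a = 1 + (\<Sum>i<l. if u i = a \<and> \<tau> i = t then f i else 0)"
  shows "(\<integral>\<omega>. (\<Prod>k\<in>{1..T}. \<Prod>i<m. g k (Y k \<omega> ! i)) \<partial>M)
     = Determinant.det (Matrix.mat l l (\<lambda>(i, j). of_bool (i = j) + walk_kernel q x (u i) (\<tau> i) (u j) (\<tau> j) * f j))"
proof -
  have neq: "q \<noteq> 0" "\<And>n. n > 0 \<Longrightarrow> q ^ n \<noteq> 1" using q real_power_neq_one by auto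
  have dx: "distinct x" "length x = m"
    using x by (auto simp: W_def sorted_wrt_iff_nth_less distinct_conv_nth) (metis less_irrefl linorder_neqE_nat)
  let ?D = "Determinant.det (Matrix.mat m m (\<lambda>(i, j). ebas q j (x ! i)))"
  let ?M0 = "Determinant.det (Matrix.mat m m (\<lambda>(r, j). (stepop q ^^ T) (ebas q j) (x ! r)))"
  let ?Q = "(q ^ (m choose 2)) ^ T"
  \<comment> \<open>Stated for arbitrary marks because it is applied twice: to the given family, and
    to the empty one, which fixes the normalisation.\<close>
  have main: "(\<integral>\<omega>. (\<Prod>k\<in>{1..T}. \<Prod>i<m. g k (Y k \<omega> ! i)) \<partial>M) * (?Q * ?D) =
     Determinant.det (Matrix.mat l l (\<lambda>(i, j). of_bool (i = j) + walk_kernel q x (u i) (\<tau> i) (u j) (\<tau> j) * f j)) * ?M0"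
    if g: "\<And>t a. g t a = 1 + (\<Sum>i<l. if u i = a \<and> \<tau> i = t then f i else 0)"
      and \<tau>: "\<And>i. i < l \<Longrightarrow> 0 < \<tau> i \<and> \<tau> i \<le> T"
    for g :: "nat \<Rightarrow> nat \<Rightarrow> real" and l :: nat and u \<tau> :: "nat \<Rightarrow> nat" and f :: "nat \<Rightarrow> real"
  proof -
    define G where "G t y = (\<Prod>i<m. g t (y ! i))" for t and y :: "nat list"
    have "\<bar>g t a\<bar> \<le> 1 + (\<Sum>i<l. \<bar>f i\<bar>)" for t a
    proof -
      have "\<bar>\<Sum>i<l. if u i = a \<and> \<tau> i = t then f i else 0\<bar> \<le> (\<Sum>i<l. \<bar>f i\<bar>)"
        by (rule order.trans[OF sum_abs]) (auto intro: sum_mono)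
      thus ?thesis unfolding g by linarith
    qed
    hence "\<bar>G t y\<bar> \<le> (\<Prod>i<m. 1 + (\<Sum>i<l. \<bar>f i\<bar>))" for t y
      unfolding G_def abs_prod by (intro prod_mono) auto
    hence "(\<integral>\<omega>. (\<Prod>k\<in>{1..T}. G k (Y k \<omega>)) \<partial>M) = pathsum q m G T 0 x"
      by (intro expectation_eq_pathsum) auto
    thus ?thesis
      using pathsum_eq_det[where G = G and g = g and n = T and t = 0, OF q G_def x] det_weighted_iter[OF neq dx g \<tau>]
      by (simp add: mult.assoc flip: G_def)
  qed
  \<comment> \<open>Without marks the expectation is 1. Total probability thus evaluates the
    determinant of T free steps, with no need for the eigenvalues.\<close>
  have "?Q * ?D = ?M0"
    using main[of "\<lambda>_ _. 1" "\<lambda>_. 0" "\<lambda>_. 0" "\<lambda>_. 0" 0] by (simp add: prob_space)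
  moreover have "?Q * ?D \<noteq> 0" using det_ebas_nonzero[OF neq x] neq by simp
  ultimately show ?thesis using main[OF g \<tau>] by auto
qed

text \<open>For a set R of marks, the expectation of the product of 1 + c_i over i in R is known as
  a determinant. The same alternating sum over R turns the expectations into the probability that
  all marks are occupied and the determinants into the determinant of the kernel.\<close>

lemma (in q_walks) walks_correlation:
  assumes \<tau>: "\<And>i. i < l \<Longrightarrow> 0 < \<tau> i" and inj: "inj_on (\<lambda>i. (u i, \<tau> i)) {..<l}"
  shows "prob {\<omega> \<in> space M. \<forall>i<l. (u i, \<tau> i) \<in> configuration m Y \<omega>}
     = Determinant.det (Matrix.mat l l (\<lambda>(i, j). walk_kernel q x (u i) (\<tau> i) (u j) (\<tau> j)))"
proof -
  define T where "T = Max (insert 0 (\<tau> ` {..<l}))"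
  have T: "0 < \<tau> i \<and> \<tau> i \<le> T" if "i < l" for i
    using \<tau>[OF that] that unfolding T_def by (auto intro!: Max_ge)
  define c where "c i \<omega> = (of_bool ((u i, \<tau> i) \<in> configuration m Y \<omega>) :: real)" for i \<omega>
  define g where "g R t a = 1 + (\<Sum>i<l. if u i = a \<and> \<tau> i = t then of_bool (i \<in> R) else (0 :: real))" for R t a
  have conf: "(a, k) \<in> configuration m Y \<omega> \<longleftrightarrow> a \<in> set (Y k \<omega>)" if "\<omega> \<in> space M" for a k \<omega>
    using chain_in_W[OF that, of k] by (auto simp: configuration_def W_def in_set_conv_nth)
  have [measurable]: "c i \<in> borel_measurable M" for i
  proof -
    have "(\<lambda>\<omega>. of_bool (u i \<in> set (Y (\<tau> i) \<omega>)) :: real) \<in> borel_measurable M"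
      by (rule chain_fun_measurable)
    thus ?thesis by (rule measurable_cong[THEN iffD2, rotated]) (auto simp: c_def conf)
  qed
  \<comment> \<open>A product over all walkers and times becomes a product over the marks: the
    walkers occupy distinct sites at each time, and the weight is 1 away from the marks.\<close>
  have prod_eq: "(\<Prod>k\<in>{1..T}. \<Prod>r<m. g R k (Y k \<omega> ! r)) = (\<Prod>i<l. 1 + of_bool (i \<in> R) * c i \<omega>)"
    if \<omega>: "\<omega> \<in> space M" for R \<omega>
  proof -
    let ?p = "\<lambda>i. (u i, \<tau> i)"
    \<comment> \<open>The weight of a space-time point; as the marks are distinct, at most one term
      of the sum is present.\<close>
    define H where "H p = 1 + (\<Sum>i<l. if ?p i = p then of_bool (i \<in> R) else (0 :: real))" for p
    define S where "S = {(a, k). k \<in> {1..T} \<and> a \<in> set (Y k \<omega>)}"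
    have dist: "distinct (Y k \<omega>)" "length (Y k \<omega>) = m" for k
      using chain_in_W[OF \<omega>, of k]
      by (auto simp: W_def sorted_wrt_iff_nth_less distinct_conv_nth) (metis less_irrefl linorder_neqE_nat)
    have S: "S = prod.swap ` Sigma {1..T} (\<lambda>k. set (Y k \<omega>))" by (auto simp: S_def image_iff)
    hence finS: "finite S" by simp
    have Hp: "H (?p i) = 1 + of_bool (i \<in> R)" if "i < l" for i
    proof -
      have "(\<Sum>j<l. if ?p j = ?p i then of_bool (j \<in> R) else (0 :: real)) = (\<Sum>j<l. if j = i then of_bool (i \<in> R) else 0)"
        using inj that by (intro sum.cong) (auto simp: inj_on_def)
      thus ?thesis using that by (simp add: H_def)
    qed
    have "(\<Prod>r<m. g R k (Y k \<omega> ! r)) = (\<Prod>a\<in>set (Y k \<omega>). H (a, k))" for k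
    proof -
      have "(\<Prod>r<m. g R k (Y k \<omega> ! r)) = (\<Prod>r<m. H (Y k \<omega> ! r, k))"
        by (auto simp: g_def H_def intro!: prod.cong sum.cong)
      also have "\<dots> = (\<Prod>a\<in>set (Y k \<omega>). H (a, k))"
        using dist bij_betw_nth[OF dist(1) refl refl, of k] by (intro prod.reindex_bij_betw) (simp add: lessThan_def)
      finally show ?thesis .
    qed
    hence "(\<Prod>k\<in>{1..T}. \<Prod>r<m. g R k (Y k \<omega> ! r)) = (\<Prod>k\<in>{1..T}. \<Prod>a\<in>set (Y k \<omega>). H (a, k))" by simp
    also have "\<dots> = (\<Prod>(k, a)\<in>Sigma {1..T} (\<lambda>k. set (Y k \<omega>)). H (a, k))"
      by (rule prod.Sigma) auto
    also have "\<dots> = (\<Prod>p\<in>S. H p)"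
      unfolding S by (subst prod.reindex) (auto simp: prod.swap_def intro!: prod.cong)
    also have "\<dots> = (\<Prod>p\<in>?p ` {i\<in>{..<l}. ?p i \<in> S}. H p)"
      by (rule prod.mono_neutral_right[OF finS]) (auto simp: H_def intro!: sum.neutral)
    also have "\<dots> = (\<Prod>i\<in>{i\<in>{..<l}. ?p i \<in> S}. H (?p i))"
      by (subst prod.reindex) (auto intro: inj_on_subset[OF inj])
    also have "\<dots> = (\<Prod>i\<in>{i\<in>{..<l}. ?p i \<in> S}. 1 + of_bool (i \<in> R) * c i \<omega>)"
      using \<omega> by (intro prod.cong) (auto simp: Hp S_def c_def conf)
    also have "\<dots> = (\<Prod>i<l. 1 + of_bool (i \<in> R) * c i \<omega>)"
      using \<omega> T by (intro prod.mono_neutral_left) (auto simp: S_def c_def conf Suc_le_eq)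
    finally show ?thesis .
  qed
  have int: "integrable M (\<lambda>\<omega>. \<Prod>i<l. 1 + of_bool (i \<in> R) * c i \<omega>)" for R
  proof (rule integrable_const_bound[where B = "2 ^ l"])
    have "\<bar>\<Prod>i<l. 1 + of_bool (i \<in> R) * c i \<omega>\<bar> \<le> (\<Prod>i<l. 2)" for \<omega>
      unfolding abs_prod by (intro prod_mono) (auto simp: c_def)
    thus "AE \<omega> in M. norm (\<Prod>i<l. 1 + of_bool (i \<in> R) * c i \<omega>) \<le> 2 ^ l" by simp
  qed measurable
  \<comment> \<open>The kernel is transposed here because the weights scale columns in
    \<open>expectation_eq_det\<close> but rows in \<open>det_alternating_sum\<close>.\<close>
  have E: "(\<integral>\<omega>. (\<Prod>i<l. 1 + of_bool (i \<in> R) * c i \<omega>) \<partial>M) =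
    Determinant.det (Matrix.mat l l (\<lambda>(i, j). of_bool (i = j) + of_bool (i \<in> R) * walk_kernel q x (u j) (\<tau> j) (u i) (\<tau> i)))" for R
  proof -
    have "(\<integral>\<omega>. (\<Prod>i<l. 1 + of_bool (i \<in> R) * c i \<omega>) \<partial>M) = (\<integral>\<omega>. (\<Prod>k\<in>{1..T}. \<Prod>r<m. g R k (Y k \<omega> ! r)) \<partial>M)"
      by (rule Bochner_Integration.integral_cong[OF refl]) (rule prod_eq[symmetric])
    also have "\<dots> = Determinant.det (Matrix.mat l l (\<lambda>(i, j). of_bool (i = j) + walk_kernel q x (u i) (\<tau> i) (u j) (\<tau> j) * of_bool (j \<in> R)))"
      by (rule expectation_eq_det[OF T g_def])
    also have "\<dots> = Determinant.det (Matrix.mat l l (\<lambda>(i, j). of_bool (j = i) + walk_kernel q x (u j) (\<tau> j) (u i) (\<tau> i) * of_bool (i \<in> R)))"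
      by (rule det_mat_transpose[symmetric])
    also have "Matrix.mat l l (\<lambda>(i, j). of_bool (j = i) + walk_kernel q x (u j) (\<tau> j) (u i) (\<tau> i) * of_bool (i \<in> R))
       = Matrix.mat l l (\<lambda>(i, j). of_bool (i = j) + of_bool (i \<in> R) * walk_kernel q x (u j) (\<tau> j) (u i) (\<tau> i))"
      by (intro eq_matI) auto
    finally show ?thesis .
  qed
  let ?A = "{\<omega> \<in> space M. \<forall>i<l. (u i, \<tau> i) \<in> configuration m Y \<omega>}"
  have "?A \<inter> space M = ?A" by blast
  hence "(\<integral>\<omega>. (indicator ?A \<omega> :: real) \<partial>M) = prob ?A"
    by (simp only: Bochner_Integration.integral_indicator)
  from this[symmetric] have "prob ?A = (\<integral>\<omega>. (indicator ?A \<omega> :: real) \<partial>M)" .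
  also have "\<dots> = (\<integral>\<omega>. (\<Prod>i<l. c i \<omega>) \<partial>M)"
    by (rule Bochner_Integration.integral_cong) (auto simp: c_def indicator_def prod_zero_iff)
  also have "\<dots> = (\<integral>\<omega>. (\<Sum>R\<in>Pow {..<l}. (- 1) ^ card ({..<l} - R) * (\<Prod>i<l. 1 + of_bool (i \<in> R) * c i \<omega>)) \<partial>M)"
    by (subst prod_alternating_sum[where d = "\<lambda>_. 1"]) simp
  also have "\<dots> = (\<Sum>R\<in>Pow {..<l}. (- 1) ^ card ({..<l} - R) * (\<integral>\<omega>. (\<Prod>i<l. 1 + of_bool (i \<in> R) * c i \<omega>) \<partial>M))"
    by (subst Bochner_Integration.integral_sum) (auto intro!: integrable_mult_right int)
  also have "\<dots> = Determinant.det (Matrix.mat l l (\<lambda>(i, j). walk_kernel q x (u j) (\<tau> j) (u i) (\<tau> i)))"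
    unfolding E by (rule det_alternating_sum[symmetric])
  also have "\<dots> = Determinant.det (Matrix.mat l l (\<lambda>(i, j). walk_kernel q x (u i) (\<tau> i) (u j) (\<tau> j)))"
    by (rule det_mat_transpose)
  finally show ?thesis .
qed

section \<open>The infinite product and inversion of contours\<close>

lemma complex_power_neq_one:
  fixes q :: real
  assumes "0 < q" "q < 1" "n > 0"
  shows "complex_of_real q ^ n \<noteq> 1"
proof -
  have "norm (complex_of_real q ^ n) < 1"
    using assms power_Suc_less_one[of q "n - 1"] by (simp add: norm_power)
  thus ?thesis by (metis less_irrefl norm_one)
qed

lemma qpoch_inf_LIMSEQ:
  fixes q :: real
  assumes "0 < q" "q < 1"
  shows "(\<lambda>N. \<Prod>i<N. 1 - a * complex_of_real q ^ i) \<longlonglongrightarrow> qpoch_inf a (of_real q)"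
  using convergent_prod_LIMSEQ[OF qpoch_inf_holomorphic(2)[OF assms, of a]]
  unfolding qpoch_inf_def by (simp add: LIMSEQ_lessThan_iff_atMost)

lemma qpoch_inf_split:
  fixes q :: real
  assumes "0 < q" "q < 1"
  shows "qpoch_inf a (of_real q) = (\<Prod>i<n. 1 - a * of_real q ^ i) * qpoch_inf (a * of_real q ^ n) (of_real q)"
proof (rule LIMSEQ_unique)
  let ?q = "complex_of_real q"
  show "(\<lambda>N. \<Prod>i<N + n. 1 - a * ?q ^ i) \<longlonglongrightarrow> qpoch_inf a ?q"
    using qpoch_inf_LIMSEQ[OF assms] by (rule LIMSEQ_ignore_initial_segment)
  have "(\<Prod>i<N + n. 1 - a * ?q ^ i) = (\<Prod>i<n. 1 - a * ?q ^ i) * (\<Prod>i<N. 1 - (a * ?q ^ n) * ?q ^ i)" for N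
    by (induction N) (simp_all add: power_add mult_ac)
  thus "(\<lambda>N. \<Prod>i<N + n. 1 - a * ?q ^ i) \<longlonglongrightarrow> (\<Prod>i<n. 1 - a * ?q ^ i) * qpoch_inf (a * ?q ^ n) ?q"
    using tendsto_mult_left[OF qpoch_inf_LIMSEQ[OF assms, of "a * ?q ^ n"]] by simp
qed

lemma qpoch_inf_nonzero:
  fixes q :: real
  assumes "0 < q" "q < 1" "\<And>k. a * complex_of_real q ^ k \<noteq> 1"
  shows "qpoch_inf a (of_real q) \<noteq> 0"
proof -
  have "1 - a * complex_of_real q ^ k \<noteq> 0" for k using assms(3)[of k] by auto
  thus ?thesis unfolding qpoch_inf_def
    by (intro prodinf_nonzero[OF qpoch_inf_holomorphic(2)[OF assms(1,2)]])
qed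

lemma qpoch_inf_zero:
  fixes q :: real
  assumes "0 < q" "q < 1"
  shows "qpoch_inf (1 / of_real q ^ k) (of_real q) = 0"
  using assms by (subst qpoch_inf_split[OF assms, of _ "Suc k"]) simp

lemma qpoch_inf_eq_0_iff:
  fixes q :: real
  assumes "0 < q" "q < 1"
  shows "qpoch_inf a (of_real q) = 0 \<longleftrightarrow> (\<exists>k. a = 1 / of_real q ^ k)"
proof
  assume "qpoch_inf a (of_real q) = 0"
  then obtain k where "a * complex_of_real q ^ k = 1" using qpoch_inf_nonzero[OF assms] by blast
  hence "a = 1 / of_real q ^ k" using assms by (simp add: field_simps)
  thus "\<exists>k. a = 1 / of_real q ^ k" by blast
qed (auto simp: qpoch_inf_zero[OF assms])

text \<open>Isolating the factor 1 - a q^k leaves a holomorphic cofactor g, so the derivative at the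
  zero is -q^k g(q^(-k)). Reversing the finite product over i < k in g produces
  \<open>kap\<close>.\<close>

lemma qpoch_inf_deriv:
  fixes q :: real
  assumes q: "0 < q" "q < 1"
  shows "((\<lambda>a. qpoch_inf a (of_real q)) has_field_derivative
            - (qpoch_inf (of_real q) (of_real q) * kap (of_real q) k)) (at (1 / of_real q ^ k))"
proof -
  let ?q = "complex_of_real q"
  define g where "g a = (\<Prod>i<k. 1 - a * ?q ^ i) * qpoch_inf (a * ?q ^ Suc k) ?q" for a
  have eq: "qpoch_inf a ?q = (1 - a * ?q ^ k) * g a" for a
    by (subst qpoch_inf_split[OF q, of _ "Suc k"]) (simp add: g_def mult_ac)
  have "(\<lambda>a. qpoch_inf (a * ?q ^ Suc k) ?q) holomorphic_on UNIV"
    using holomorphic_on_compose_gen[OF _ qpoch_inf_holomorphic(1)[OF q], of "\<lambda>a. a * ?q ^ Suc k" UNIV]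
    by (simp add: o_def holomorphic_intros)
  hence "g holomorphic_on UNIV" unfolding g_def by (intro holomorphic_intros)
  then obtain g' where "(g has_field_derivative g') (at (1 / ?q ^ k))"
    using holomorphic_derivI[of g UNIV] by blast
  hence "((\<lambda>a. (1 - a * ?q ^ k) * g a) has_field_derivative
      (- (?q ^ k)) * g (1 / ?q ^ k) + g' * (1 - 1 / ?q ^ k * ?q ^ k)) (at (1 / ?q ^ k))"
    by (auto intro!: derivative_eq_intros)
  moreover have "(\<Prod>i<k. 1 - 1 / ?q ^ k * ?q ^ i) = (\<Prod>i<k. 1 - 1 / ?q ^ Suc i)"
  proof (rule prod.reindex_bij_witness[where i = "\<lambda>i. k - Suc i" and j = "\<lambda>i. k - Suc i"])
    fix i assume "i \<in> {..<k}"
    hence "?q ^ k = ?q ^ i * ?q ^ Suc (k - Suc i)" by (simp flip: power_add power_Suc)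
    thus "1 - 1 / ?q ^ Suc (k - Suc i) = 1 - 1 / ?q ^ k * ?q ^ i" using q by simp
  qed auto
  hence "?q ^ k * g (1 / ?q ^ k) = qpoch_inf ?q ?q * kap ?q k"
    using q by (simp add: g_def kap_def mult_ac)
  ultimately show ?thesis using q unfolding eq by simp
qed

lemma qpoch_inf_self_nonzero:
  fixes q :: real
  assumes q: "0 < q" "q < 1"
  shows "qpoch_inf (of_real q) (of_real q) \<noteq> 0"
  using complex_power_neq_one[OF q, of "Suc _"] by (intro qpoch_inf_nonzero[OF q]) simp

lemma holomorphic_on_qpoch_inf [holomorphic_intros]:
  fixes q :: real
  assumes "0 < q" "q < 1" "f holomorphic_on S"
  shows "(\<lambda>z. qpoch_inf (f z) (of_real q)) holomorphic_on S"
  using holomorphic_on_compose_gen[OF assms(3) qpoch_inf_holomorphic(1)[OF assms(1,2)]] by (simp add: o_def)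

section \<open>Contour integrals and winding numbers under z -> 1/z\<close>

lemma valid_path_inverse_comp:
  assumes "valid_path \<gamma>" "(0 :: complex) \<notin> path_image \<gamma>"
  shows "valid_path (inverse \<circ> \<gamma>)"
  by (rule valid_path_compose_holomorphic[OF assms(1), of _ "-{0}"])
     (use assms in \<open>auto intro!: holomorphic_intros\<close>)

lemma contour_integral_inverse_comp:
  assumes "valid_path \<gamma>" "(0 :: complex) \<notin> path_image \<gamma>"
  shows "contour_integral (inverse \<circ> \<gamma>) f = - contour_integral \<gamma> (\<lambda>w. f (inverse w) / w\<^sup>2)"
proof -
  have "contour_integral (inverse \<circ> \<gamma>) f = contour_integral \<gamma> (\<lambda>w. deriv inverse w * f (inverse w))"
  proof (rule contour_integral_comp_analyticW[OF _ assms(1)])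
    show "inverse analytic_on (-{0 :: complex})"
      by (subst analytic_on_open) (auto intro!: holomorphic_intros)
  qed (use assms in auto)
  also have "\<dots> = contour_integral \<gamma> (\<lambda>w. - (f (inverse w) / w\<^sup>2))"
  proof (rule contour_integral_cong[OF refl])
    fix w assume "w \<in> path_image \<gamma>"
    hence "w \<noteq> 0" using assms by auto
    hence "deriv inverse w = - (1 / w\<^sup>2)"
      by (intro DERIV_imp_deriv) (auto intro!: derivative_eq_intros simp: power2_eq_square field_simps)
    thus "deriv inverse w * f (inverse w) = - (f (inverse w) / w\<^sup>2)" by simp
  qed
  finally show ?thesis by (simp add: contour_integral_neg)
qed

lemma contour_integral_via_inverse:
  assumes "valid_path \<gamma>" "(0 :: complex) \<notin> path_image \<gamma>"
  shows "contour_integral \<gamma> f = - contour_integral (inverse \<circ> \<gamma>) (\<lambda>w. f (inverse w) / w\<^sup>2)"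
proof -
  have "contour_integral \<gamma> (\<lambda>w. f (inverse (inverse w)) / (inverse w)\<^sup>2 / w\<^sup>2) = contour_integral \<gamma> f"
    by (rule contour_integral_cong[OF refl]) (use assms in \<open>auto simp: field_simps\<close>)
  thus ?thesis by (simp add: contour_integral_inverse_comp[OF assms])
qed

text \<open>By partial fractions, dw/(w - 1/p) pulls back under inversion to dw/(w - p) - dw/w. So a
  point encircled as often as 0 is no longer encircled after inversion.\<close>

lemma winding_number_inverse_comp:
  assumes \<gamma>: "valid_path \<gamma>" "(0 :: complex) \<notin> path_image \<gamma>" and p: "p \<notin> path_image \<gamma>" "p \<noteq> 0"
  shows "winding_number (inverse \<circ> \<gamma>) (inverse p) = winding_number \<gamma> p - winding_number \<gamma> 0"
proof -
  have "inverse p \<notin> path_image (inverse \<circ> \<gamma>)" using p by (auto simp: path_image_def)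
  hence "winding_number (inverse \<circ> \<gamma>) (inverse p)
      = 1 / (2 * pi * \<i>) * contour_integral (inverse \<circ> \<gamma>) (\<lambda>w. 1 / (w - inverse p))"
    by (intro winding_number_valid_path valid_path_inverse_comp \<gamma>)
  also have "contour_integral (inverse \<circ> \<gamma>) (\<lambda>w. 1 / (w - inverse p))
      = - contour_integral \<gamma> (\<lambda>w. 1 / (inverse w - inverse p) / w\<^sup>2)"
    by (rule contour_integral_inverse_comp[OF \<gamma>])
  also have "contour_integral \<gamma> (\<lambda>w. 1 / (inverse w - inverse p) / w\<^sup>2)
      = contour_integral \<gamma> (\<lambda>w. 1 / (w - 0) - 1 / (w - p))"
  proof (rule contour_integral_cong[OF refl])
    fix w assume "w \<in> path_image \<gamma>"
    hence "w \<noteq> 0" "w \<noteq> p" using assms by auto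
    thus "1 / (inverse w - inverse p) / w\<^sup>2 = 1 / (w - 0) - 1 / (w - p)"
      using p(2) by (simp add: divide_simps power2_eq_square) (simp add: algebra_simps)
  qed
  also have "\<dots> = contour_integral \<gamma> (\<lambda>w. 1 / (w - 0)) - contour_integral \<gamma> (\<lambda>w. 1 / (w - p))"
    by (rule contour_integral_diff) (intro contour_integrable_inversediff \<gamma> p)+
  finally show ?thesis
    unfolding winding_number_valid_path[OF \<gamma>] winding_number_valid_path[OF \<gamma>(1) p(1)]
    by (simp only: right_diff_distrib mult_minus_right minus_diff_eq)
qed

lemma residue_simple_zero_ratio:
  assumes S: "open S" "p \<in> S" and A: "A holomorphic_on S" and g: "g holomorphic_on S"
    and g0: "g p = 0" "(g has_field_derivative g') (at p)" "g' \<noteq> 0" and nz: "\<And>z. z \<in> S - {p} \<Longrightarrow> g z \<noteq> 0"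
  shows "residue (\<lambda>z. A z / g z) p = A p / g'"
proof (rule residue_simple'[OF S])
  show "(\<lambda>z. A z / g z) holomorphic_on S - {p}"
    by (intro holomorphic_on_divide holomorphic_on_subset[OF A] holomorphic_on_subset[OF g]) (use nz in auto)
  have "((\<lambda>z. (g z - g p) / (z - p)) \<longlongrightarrow> g') (at p)"
    using g0(2) by (simp add: has_field_derivative_iff)
  moreover have "(A \<longlongrightarrow> A p) (at p)"
    using holomorphic_on_imp_continuous_on[OF A] S by (simp add: continuous_on_eq_continuous_at isCont_def)
  ultimately have "((\<lambda>z. A z / ((g z - g p) / (z - p))) \<longlongrightarrow> A p / g') (at p)"
    using g0(3) by (intro tendsto_divide)
  thus "((\<lambda>z. A z / g z * (z - p)) \<longlongrightarrow> A p / g') (at p)"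
    by (simp add: g0(1))
qed

section \<open>The two contour integrals\<close>

text \<open>Inversion moves the accumulation point 0 to infinity. The points 1/w and q^(-j) with j
  >= y + t then have winding number 0, and only finitely many residues remain. The winding numbers
  about the other q^k are not assumed, so they survive in the factor 1 - winding number.\<close>

lemma z_contour_integral:
  fixes q :: real and x :: "nat list"
  defines "Q \<equiv> complex_of_real q"
  assumes q: "0 < q" "q < 1" and t: "t > 0"
    and \<gamma>: "valid_path \<gamma>" "pathfinish \<gamma> = pathstart \<gamma>"
    and \<gamma>E: "\<And>z. z \<in> path_image \<gamma> \<Longrightarrow> qpoch_inf (inverse z) Q \<noteq> 0"
    and zero: "0 \<notin> path_image \<gamma>" "winding_number \<gamma> 0 = 1"
    and w: "w \<noteq> 0" "w \<notin> path_image \<gamma>" "winding_number \<gamma> w = 1" "\<And>k. w \<noteq> Q ^ k"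
    and inner: "\<And>j. j \<ge> y + t \<Longrightarrow> winding_number \<gamma> (Q ^ j) = 1"
  shows "contour_integral \<gamma> (\<lambda>z. z powi (- int t) / (w - z) * qpoch (z * Q powi (1 - int y - int t)) Q (t - 1)
            / qpoch_inf (inverse z) Q * (\<Prod>r<length x. 1 - Q ^ (x ! r) / z))
       = 2 * pi * \<i> * (\<Sum>k\<in>{..y} - set x. (1 - winding_number \<gamma> (Q ^ k)) *
           ((\<Prod>i\<in>{y<..<y+t}. 1 / Q ^ k - 1 / Q ^ i) * (\<Prod>r<length x. 1 - Q ^ (x ! r) / Q ^ k)
             / ((w / Q ^ k - 1) * (- (qpoch_inf Q Q * kap Q k)))))"
proof -
  let ?E = "\<lambda>\<zeta>. qpoch_inf \<zeta> Q"
  define F where "F = (\<lambda>z. z powi (- int t) / (w - z) * qpoch (z * Q powi (1 - int y - int t)) Q (t - 1)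
            / qpoch_inf (inverse z) Q * (\<Prod>r<length x. 1 - Q ^ (x ! r) / z))"
  define N where "N \<zeta> = (\<Prod>i\<in>{y<..<y+t}. \<zeta> - 1 / Q ^ i) * (\<Prod>r<length x. 1 - Q ^ (x ! r) * \<zeta>)" for \<zeta>
  define f where "f = (\<lambda>\<zeta>. N \<zeta> / (w * \<zeta> - 1) / ?E \<zeta>)"
  define M where "M = y + t"
  define \<delta> where "\<delta> = inverse \<circ> \<gamma>"
  obtain s where s: "t = Suc s" using t by (cases t) auto
  have Q0: "Q \<noteq> 0" and Qn: "\<And>n. n > 0 \<Longrightarrow> Q ^ n \<noteq> 1" using q complex_power_neq_one[OF q] by (auto simp: Q_def)
  have inj: "1 / Q ^ a = 1 / Q ^ b \<longleftrightarrow> a = b" for a b by (rule inverse_power_inj[OF Q0 Qn])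
  have E0: "?E \<zeta> = 0 \<longleftrightarrow> (\<exists>k. \<zeta> = 1 / Q ^ k)" for \<zeta>
    using qpoch_inf_eq_0_iff[OF q] by (simp add: Q_def)
  have Ehol: "?E holomorphic_on A" for A
    unfolding Q_def by (intro holomorphic_intros q)
  have Nhol: "(\<lambda>\<zeta>. N \<zeta> / (w * \<zeta> - 1)) holomorphic_on A" if "1 / w \<notin> A" for A
  proof -
    have "w * \<zeta> - 1 \<noteq> 0" if "\<zeta> \<in> A" for \<zeta>
    proof
      assume "w * \<zeta> - 1 = 0"
      hence "\<zeta> = 1 / w" using w(1) by (simp add: field_simps)
      thus False using that \<open>1 / w \<notin> A\<close> by simp
    qed
    thus ?thesis unfolding N_def by (intro holomorphic_intros)
  qed
  have pQ: "Q ^ k \<notin> path_image \<gamma>" for k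
    using \<gamma>E[of "Q ^ k"] E0[of "1 / Q ^ k"] by (auto simp: inverse_eq_divide)
  \<comment> \<open>The exponents t, 1 and -(t - 1) of \<zeta> add up to 2, which the Jacobian of
    the inversion removes exactly; so \<open>f\<close> has no pole at 0.\<close>
  have invert: "F (inverse \<zeta>) / \<zeta>\<^sup>2 = f \<zeta>" if \<zeta>: "\<zeta> \<noteq> 0" for \<zeta>
  proof -
    have "qpoch (inverse \<zeta> * Q powi (1 - int y - int t)) Q (t - 1) = (\<Prod>i<s. 1 - 1 / (\<zeta> * Q ^ (y + s - i)))"
      unfolding qpoch_def s
    proof (rule prod.cong)
      fix i assume i: "i \<in> {..<s}"
      have "Q powi (1 - int y - int (Suc s)) * Q ^ i = Q powi (- int (y + s - i))"
        using Q0 i by (simp flip: power_int_of_nat power_int_add add: of_nat_diff algebra_simps)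
      also have "\<dots> = 1 / Q ^ (y + s - i)"
        by (simp only: power_int_minus power_int_of_nat inverse_eq_divide)
      finally show "1 - inverse \<zeta> * Q powi (1 - int y - int (Suc s)) * Q ^ i = 1 - 1 / (\<zeta> * Q ^ (y + s - i))"
        using \<zeta> by (simp add: inverse_eq_divide)
    qed simp
    also have "\<dots> = (\<Prod>i\<in>{y<..<y+t}. 1 - 1 / (\<zeta> * Q ^ i))"
      by (rule prod.reindex_bij_witness[where i = "\<lambda>i. y + s - i" and j = "\<lambda>i. y + s - i"]) (auto simp: s)
    also have "\<dots> = (\<Prod>i\<in>{y<..<y+t}. (\<zeta> - 1 / Q ^ i) / \<zeta>)"
      using \<zeta> Q0 by (intro prod.cong) (auto simp: field_simps)
    also have "\<dots> = (\<Prod>i\<in>{y<..<y+t}. \<zeta> - 1 / Q ^ i) / \<zeta> ^ s"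
      by (simp add: prod_dividef s)
    finally have qp: "qpoch (inverse \<zeta> * Q powi (1 - int y - int t)) Q (t - 1) = (\<Prod>i\<in>{y<..<y+t}. \<zeta> - 1 / Q ^ i) / \<zeta> ^ s" .
    have "1 / (w - inverse \<zeta>) = \<zeta> / (w * \<zeta> - 1)"
      using \<zeta> by (simp add: divide_simps)
    moreover have "inverse \<zeta> powi (- int t) = \<zeta> ^ t"
      by (simp add: power_int_minus power_inverse)
    moreover have "F (inverse \<zeta>) = inverse \<zeta> powi (- int t) * (1 / (w - inverse \<zeta>)) *
        qpoch (inverse \<zeta> * Q powi (1 - int y - int t)) Q (t - 1) / ?E \<zeta> * (\<Prod>r<length x. 1 - Q ^ (x ! r) * \<zeta>)"
      by (simp only: F_def divide_inverse inverse_inverse_eq mult_1_left)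
    ultimately have "F (inverse \<zeta>) = \<zeta> ^ t * (\<zeta> / (w * \<zeta> - 1)) * ((\<Prod>i\<in>{y<..<y+t}. \<zeta> - 1 / Q ^ i) / \<zeta> ^ s)
        / ?E \<zeta> * (\<Prod>r<length x. 1 - Q ^ (x ! r) * \<zeta>)"
      by (simp only: qp)
    also have "\<dots> = \<zeta>\<^sup>2 * f \<zeta>"
      using \<zeta> by (simp add: f_def N_def s power2_eq_square)
    finally show ?thesis using \<zeta> by simp
  qed
  have vd: "valid_path \<delta>" unfolding \<delta>_def by (rule valid_path_inverse_comp) fact+
  have pd: "pathfinish \<delta> = pathstart \<delta>" using \<gamma>(2) by (simp add: \<delta>_def pathfinish_def pathstart_def)
  have imd: "path_image \<delta> = inverse ` path_image \<gamma>" by (simp add: \<delta>_def path_image_compose)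
  define Z where "Z = insert (1 / w) ((\<lambda>j. 1 / Q ^ j) ` {M..})"
  define S where "S = - Z"
  define pts where "pts = (\<lambda>j. 1 / Q ^ j) ` {..<M}"
  \<comment> \<open>The infinite tail of poles is the zero set of one entire function, so deleting
    it leaves an open domain.\<close>
  have tail: "?E (\<zeta> * Q ^ M) = 0 \<longleftrightarrow> \<zeta> \<in> (\<lambda>j. 1 / Q ^ j) ` {M..}" for \<zeta>
  proof
    assume "?E (\<zeta> * Q ^ M) = 0"
    then obtain k where "\<zeta> * Q ^ M = 1 / Q ^ k" using E0 by blast
    hence "\<zeta> = 1 / Q ^ (M + k)" using Q0 by (simp add: field_simps power_add)
    thus "\<zeta> \<in> (\<lambda>j. 1 / Q ^ j) ` {M..}" by (intro image_eqI) auto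
  next
    assume "\<zeta> \<in> (\<lambda>j. 1 / Q ^ j) ` {M..}"
    then obtain j where j: "j \<ge> M" "\<zeta> = 1 / Q ^ j" by auto
    have "Q ^ j = Q ^ (j - M) * Q ^ M" using j by (simp flip: power_add)
    hence "\<zeta> * Q ^ M = 1 / Q ^ (j - M)" using j Q0 by (simp add: field_simps)
    thus "?E (\<zeta> * Q ^ M) = 0" using E0 by blast
  qed
  have "open S"
  proof -
    have "S = (\<lambda>\<zeta>. (\<zeta> - 1 / w) * ?E (\<zeta> * Q ^ M)) -` (- {0})"
    proof -
      have "\<zeta> \<in> S \<longleftrightarrow> (\<zeta> - 1 / w) * ?E (\<zeta> * Q ^ M) \<noteq> 0" for \<zeta>
        by (simp only: S_def Z_def Compl_iff insert_iff tail mult_eq_0_iff right_minus_eq de_Morgan_disj)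
      thus ?thesis by (simp only: set_eq_iff vimage_eq Compl_iff singleton_iff simp_thms)
    qed
    moreover have "(\<lambda>\<zeta>. (\<zeta> - 1 / w) * ?E (\<zeta> * Q ^ M)) holomorphic_on UNIV"
      unfolding Q_def by (intro holomorphic_intros q)
    ultimately show ?thesis
      by (auto intro!: open_vimage holomorphic_on_imp_continuous_on)
  qed
  have "connected S"
    unfolding S_def by (intro path_connected_imp_connected path_connected_complement_countable) (auto simp: Z_def)
  have off: "1 / Q ^ j \<in> S" if "j < M" for j
  proof -
    have "1 / Q ^ j \<noteq> 1 / w" using w(1) w(4)[of j] Q0 by (auto simp: field_simps)
    moreover have "1 / Q ^ j \<noteq> 1 / Q ^ i" if "i \<ge> M" for i using inj[of j i] that \<open>j < M\<close> by simp
    ultimately show ?thesis by (auto simp: S_def Z_def)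
  qed
  have Enz: "?E \<zeta> \<noteq> 0" if "\<zeta> \<in> S - pts" for \<zeta>
  proof
    assume "?E \<zeta> = 0"
    then obtain k where "\<zeta> = 1 / Q ^ k" using E0 by blast
    thus False using that by (cases "k < M") (auto simp: S_def Z_def pts_def not_less)
  qed
  have wS: "1 / w \<notin> S" by (simp add: S_def Z_def)
  have wind: "winding_number \<delta> (1 / p) = winding_number \<gamma> p - 1" if "p \<noteq> 0" "p \<notin> path_image \<gamma>" for p
    using winding_number_inverse_comp[OF \<gamma>(1) zero(1) that(2,1)] zero(2) by (simp add: \<delta>_def inverse_eq_divide)
  have int: "contour_integral \<delta> f = 2 * pi * \<i> * (\<Sum>p\<in>pts. winding_number \<delta> p * residue f p)"
  proof (rule Residue_theorem[OF \<open>open S\<close> \<open>connected S\<close> _ _ vd pd])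
    show "f holomorphic_on S - pts" unfolding f_def
      by (intro holomorphic_on_divide Nhol Ehol Enz) (use wS in auto)
    show "path_image \<delta> \<subseteq> S - pts"
    proof
      fix \<zeta> assume "\<zeta> \<in> path_image \<delta>"
      then obtain z where z: "z \<in> path_image \<gamma>" "\<zeta> = inverse z" by (auto simp: imd)
      have "\<zeta> \<noteq> 1 / w" using z w(2) by (auto simp: inverse_eq_divide)
      moreover have "\<zeta> \<noteq> 1 / Q ^ k" for k using z \<gamma>E[OF z(1)] E0 by auto
      ultimately show "\<zeta> \<in> S - pts" by (auto simp: S_def Z_def pts_def)
    qed
    \<comment> \<open>The deleted points are those about which \<gamma> winds once, as it does about
      0.\<close>
    show "\<forall>z. z \<notin> S \<longrightarrow> winding_number \<delta> z = 0"
    proof (intro allI impI)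
      fix z assume "z \<notin> S"
      then consider "z = 1 / w" | j where "j \<ge> M" "z = 1 / Q ^ j" by (auto simp: S_def Z_def)
      thus "winding_number \<delta> z = 0"
        by cases (use wind w inner Q0 pQ in \<open>auto simp: M_def\<close>)
    qed
  qed (auto simp: pts_def)
  have res: "residue f (1 / Q ^ j) = N (1 / Q ^ j) / (w / Q ^ j - 1) / (- (qpoch_inf Q Q * kap Q j))" if j: "j < M" for j
  proof -
    have "residue f (1 / Q ^ j) = N (1 / Q ^ j) / (w * (1 / Q ^ j) - 1) / (- (qpoch_inf Q Q * kap Q j))"
      unfolding f_def
    proof (rule residue_simple_zero_ratio)
      show "open (S - (pts - {1 / Q ^ j}))" using \<open>open S\<close> by (intro open_Diff finite_imp_closed) (auto simp: pts_def)
      show "1 / Q ^ j \<in> S - (pts - {1 / Q ^ j})" using off[OF j] by simp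
      show "(\<lambda>\<zeta>. N \<zeta> / (w * \<zeta> - 1)) holomorphic_on S - (pts - {1 / Q ^ j})"
        by (rule Nhol) (use wS in auto)
      show "(?E has_field_derivative - (qpoch_inf Q Q * kap Q j)) (at (1 / Q ^ j))"
        unfolding Q_def by (rule qpoch_inf_deriv[OF q])
      show "- (qpoch_inf Q Q * kap Q j) \<noteq> 0"
        using qpoch_inf_self_nonzero[OF q] kap_nonzero[OF Q0 Qn] by (simp add: Q_def)
    qed (use E0 Enz Ehol in auto)
    thus ?thesis by simp
  qed
  have "contour_integral \<gamma> F = - contour_integral \<delta> (\<lambda>\<zeta>. F (inverse \<zeta>) / \<zeta>\<^sup>2)"
    unfolding \<delta>_def by (rule contour_integral_via_inverse) fact+
  also have "contour_integral \<delta> (\<lambda>\<zeta>. F (inverse \<zeta>) / \<zeta>\<^sup>2) = contour_integral \<delta> f"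
  proof (rule contour_integral_cong[OF refl])
    fix \<zeta> assume "\<zeta> \<in> path_image \<delta>"
    hence "\<zeta> \<noteq> 0" using zero by (auto simp: imd)
    thus "F (inverse \<zeta>) / \<zeta>\<^sup>2 = f \<zeta>" by (rule invert)
  qed
  also have "- contour_integral \<delta> f = 2 * pi * \<i> * (\<Sum>p\<in>pts. (- winding_number \<delta> p) * residue f p)"
    unfolding int by (simp add: sum_negf)
  also have "(\<Sum>p\<in>pts. (- winding_number \<delta> p) * residue f p)
      = (\<Sum>j<M. (- winding_number \<delta> (1 / Q ^ j)) * residue f (1 / Q ^ j))"
    unfolding pts_def using inj by (subst sum.reindex) (auto simp: inj_on_def)
  also have "\<dots> = (\<Sum>j<M. (1 - winding_number \<gamma> (Q ^ j)) *
      (N (1 / Q ^ j) / ((w / Q ^ j - 1) * (- (qpoch_inf Q Q * kap Q j)))))"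
    by (intro sum.cong refl) (use wind Q0 pQ res in \<open>simp add: divide_divide_eq_left\<close>)
  also have "\<dots> = (\<Sum>j\<in>{..y} - set x. (1 - winding_number \<gamma> (Q ^ j)) *
      (N (1 / Q ^ j) / ((w / Q ^ j - 1) * (- (qpoch_inf Q Q * kap Q j)))))"
  \<comment> \<open>The numerator vanishes at the sites of x and at the sites strictly between y and
    y + t, which removes all but the sites up to y outside x.\<close>
  proof (rule sum.mono_neutral_right)
    show "\<forall>j\<in>{..<M} - ({..y} - set x). (1 - winding_number \<gamma> (Q ^ j)) *
      (N (1 / Q ^ j) / ((w / Q ^ j - 1) * (- (qpoch_inf Q Q * kap Q j)))) = 0"
    proof
      fix j assume j: "j \<in> {..<M} - ({..y} - set x)"
      have "N (1 / Q ^ j) = 0"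
      proof (cases "j \<in> set x")
        case True
        then obtain r where "r < length x" "x ! r = j" by (auto simp: in_set_conv_nth)
        hence "(\<Prod>r<length x. 1 - Q ^ (x ! r) * (1 / Q ^ j)) = 0"
          using Q0 by (intro prod_zero) (auto intro!: bexI[of _ r])
        thus ?thesis by (simp add: N_def)
      next
        case False
        hence "j \<in> {y<..<y+t}" using j by (auto simp: M_def)
        hence "(\<Prod>i\<in>{y<..<y+t}. 1 / Q ^ j - 1 / Q ^ i) = 0" by (intro prod_zero) auto
        thus ?thesis by (simp add: N_def)
      qed
      thus "(1 - winding_number \<gamma> (Q ^ j)) *
        (N (1 / Q ^ j) / ((w / Q ^ j - 1) * (- (qpoch_inf Q Q * kap Q j)))) = 0" by simp
    qed
  qed (use t in \<open>auto simp: M_def\<close>)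
  finally show ?thesis by (simp add: F_def N_def)
qed

text \<open>When the circle passes through \<open>q\<^sup>k\<close> or leaves it outside, the second alternative makes every pole of
  the integrand cancel against a zero of the infinite product.\<close>

lemma w_contour_integral:
  fixes q \<epsilon> :: real and b t k :: nat and X :: "nat set"
  defines "Q \<equiv> complex_of_real q" and "B \<equiv> insert k X"
  assumes q: "0 < q" "q < 1" and \<epsilon>: "\<epsilon> > 0" and X: "finite X" "k \<notin> X"
    and small: "\<And>i. i \<in> {b..b+t} \<union> X \<Longrightarrow> \<epsilon> < q ^ i"
    and k: "\<epsilon> < q ^ k \<or> {b..b+t} \<inter> B = {}"
  obtains h where "continuous_on (sphere 0 \<epsilon>) h"
    "\<And>w. norm w = \<epsilon> \<Longrightarrow> w \<noteq> of_real \<epsilon> \<Longrightarrow> h w = qpoch_inf (inverse w) Q /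
        ((\<Prod>i\<in>{b..b+t}. inverse w - 1 / Q ^ i) * (\<Prod>i\<in>B. inverse w - 1 / Q ^ i)) / w\<^sup>2"
    "contour_integral (circlepath 0 \<epsilon>) h = 2 * pi * \<i> *
       (\<Sum>i\<in>B. - (qpoch_inf Q Q * kap Q i) * divdiff_weight Q t b i / (\<Prod>j\<in>B-{i}. 1 / Q ^ i - 1 / Q ^ j))"
proof -
  let ?E = "\<lambda>\<zeta>. qpoch_inf \<zeta> Q"
  let ?z = "\<lambda>i. 1 / Q ^ i"
  define A where "A = {b..b+t}"
  define f where "f = (\<lambda>\<omega>. ?E \<omega> / ((\<Prod>i\<in>A. \<omega> - ?z i) * (\<Prod>i\<in>B. \<omega> - ?z i)))"
  define \<delta> where "\<delta> = inverse \<circ> circlepath 0 \<epsilon>"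
  have fin: "finite A" "finite B" using X by (auto simp: A_def B_def)
  have Q0: "Q \<noteq> 0" and Qn: "\<And>n. n > 0 \<Longrightarrow> Q ^ n \<noteq> 1" using q complex_power_neq_one[OF q] by (auto simp: Q_def)
  have inj: "?z i = ?z j \<longleftrightarrow> i = j" for i j by (rule inverse_power_inj[OF Q0 Qn])
  have E0: "?E (?z i) = 0" for i using qpoch_inf_zero[OF q] by (simp add: Q_def)
  have Ehol: "?E holomorphic_on S" for S unfolding Q_def by (intro holomorphic_intros q)
  have Ederiv: "(?E has_field_derivative - (qpoch_inf Q Q * kap Q i)) (at (?z i))" for i
    unfolding Q_def by (rule qpoch_inf_deriv[OF q])
  have fhol: "f holomorphic_on S" if "S \<inter> ?z ` (A \<union> B) = {}" for S
    unfolding f_def using that fin by (intro holomorphic_intros Ehol) auto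
  have vc: "valid_path (circlepath 0 \<epsilon>)" "0 \<notin> path_image (circlepath 0 \<epsilon>)" using \<epsilon> by auto
  have vd: "valid_path \<delta>" unfolding \<delta>_def by (rule valid_path_inverse_comp[OF vc])
  have pd: "pathfinish \<delta> = pathstart \<delta>" by (simp add: \<delta>_def pathfinish_compose pathstart_compose)
  have imd: "path_image \<delta> = inverse ` sphere 0 \<epsilon>" using \<epsilon> by (simp add: \<delta>_def path_image_compose path_image_circlepath)
  have via: "contour_integral (circlepath 0 \<epsilon>) (\<lambda>w. g (inverse w) / w\<^sup>2) = - contour_integral \<delta> g" for g
    using contour_integral_inverse_comp[OF vc, of g] by (simp add: \<delta>_def)
  have cont_inv: "continuous_on (sphere 0 \<epsilon>) (\<lambda>w. g (inverse w) / w\<^sup>2)" if "continuous_on (inverse ` sphere 0 \<epsilon>) g" for g :: "complex \<Rightarrow> complex"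
    using \<epsilon> by (intro continuous_intros continuous_on_compose2[OF that]) auto
  have nQ: "norm (Q ^ i) = q ^ i" for i using q by (simp add: Q_def norm_power)
  define V where "V i = - (qpoch_inf Q Q * kap Q i) * divdiff_weight Q t b i / (\<Prod>j\<in>B-{i}. ?z i - ?z j)" for i
  show thesis
  proof (cases "A \<inter> B = {}")
    \<comment> \<open>Some node is shared, so the first alternative on k holds and every q^i with i
      a node lies outside the circle.\<close>
    case False
    hence small': "\<epsilon> < q ^ i" if "i \<in> A \<union> B" for i
      using k small[of i] that by (auto simp: A_def B_def)
    have off: "inverse ` sphere 0 \<epsilon> \<inter> ?z ` (A \<union> B) = {}"
    proof -
      have "inverse w \<noteq> ?z i" if "norm w = \<epsilon>" "i \<in> A \<union> B" for w i
        using small'[OF that(2)] that(1) nQ[of i] by (auto simp: inverse_eq_divide[symmetric])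
      thus ?thesis by auto
    qed
    \<comment> \<open>The infinite product has a simple zero at every node. The denominator has a
      double zero exactly at shared nodes, which are the true poles; at the other nodes the
      singularity is removable and the residue is 0.\<close>
    have res: "residue f (?z i) = (if i \<in> B then V i else 0)" if i: "i \<in> A \<union> B" for i
    proof (rule residue_simple')
      define S where "S = - ?z ` (A \<union> B - {i})"
      show "open S" unfolding S_def using fin by (intro open_Compl finite_imp_closed) auto
      show "?z i \<in> S" using inj by (auto simp: S_def)
      show "f holomorphic_on S - {?z i}" by (rule fhol) (auto simp: S_def)
      have split: "(\<Prod>j\<in>D. \<omega> - ?z j) = (\<omega> - ?z i) * (\<Prod>j\<in>D-{i}. \<omega> - ?z j)" if "i \<in> D" "finite D" for D \<omega>
        using that by (rule prod.remove[rotated])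
      have lim: "((\<lambda>\<omega>. \<Prod>j\<in>D. \<omega> - ?z j) \<longlongrightarrow> (\<Prod>j\<in>D. ?z i - ?z j)) (at (?z i))" for D
        by (intro tendsto_intros)
      have nz: "(\<Prod>j\<in>D-{i}. ?z i - ?z j) \<noteq> 0" if "finite D" for D
      proof -
        have "?z i - ?z j \<noteq> 0" if "j \<in> D - {i}" for j using inj[of i j] that by auto
        thus ?thesis using that by (subst prod_zero_iff) auto
      qed
      have limE: "(?E \<longlongrightarrow> 0) (at (?z i))"
        using DERIV_isCont[OF Ederiv[of i]] by (simp add: isCont_def E0)
      have limE': "((\<lambda>\<omega>. ?E \<omega> / (\<omega> - ?z i)) \<longlongrightarrow> - (qpoch_inf Q Q * kap Q i)) (at (?z i))"
        using Ederiv[of i] by (simp add: has_field_derivative_iff E0)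
      have cong: "((\<lambda>\<omega>. f \<omega> * (\<omega> - ?z i)) \<longlongrightarrow> L) (at (?z i))"
        if "(g \<longlongrightarrow> L) (at (?z i))" "\<And>\<omega>. \<omega> \<noteq> ?z i \<Longrightarrow> f \<omega> * (\<omega> - ?z i) = g \<omega>" for g L
        by (rule Lim_transform_eventually[OF that(1)]) (use that(2) in \<open>auto simp: eventually_at intro!: exI[of _ 1]\<close>)
      consider "i \<in> A" "i \<in> B" | "i \<in> A" "i \<notin> B" | "i \<notin> A" "i \<in> B" using i by auto
      thus "((\<lambda>\<omega>. f \<omega> * (\<omega> - ?z i)) \<longlongrightarrow> (if i \<in> B then V i else 0)) (at (?z i))"
      proof cases
        case 1
        show ?thesis
        proof (rule cong)
          show "((\<lambda>\<omega>. ?E \<omega> / (\<omega> - ?z i) / ((\<Prod>j\<in>A-{i}. \<omega> - ?z j) * (\<Prod>j\<in>B-{i}. \<omega> - ?z j)))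
              \<longlongrightarrow> (if i \<in> B then V i else 0)) (at (?z i))"
          proof -
            have "V i = - (qpoch_inf Q Q * kap Q i) / ((\<Prod>j\<in>A-{i}. ?z i - ?z j) * (\<Prod>j\<in>B-{i}. ?z i - ?z j))"
              using 1 by (simp add: V_def divdiff_weight_def A_def[symmetric] prod_dividef)
            moreover have "((\<lambda>\<omega>. ?E \<omega> / (\<omega> - ?z i) / ((\<Prod>j\<in>A-{i}. \<omega> - ?z j) * (\<Prod>j\<in>B-{i}. \<omega> - ?z j)))
              \<longlongrightarrow> - (qpoch_inf Q Q * kap Q i) / ((\<Prod>j\<in>A-{i}. ?z i - ?z j) * (\<Prod>j\<in>B-{i}. ?z i - ?z j))) (at (?z i))"
              using nz[OF fin(1)] nz[OF fin(2)] by (intro tendsto_divide tendsto_mult limE' lim) auto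
            ultimately show ?thesis using 1 by (simp only: if_True)
          qed
        qed (use 1 fin in \<open>simp add: f_def split\<close>)
      next
        case 2
        show ?thesis
        proof (rule cong)
          have "((\<lambda>\<omega>. ?E \<omega> / ((\<Prod>j\<in>A-{i}. \<omega> - ?z j) * (\<Prod>j\<in>B. \<omega> - ?z j)))
              \<longlongrightarrow> 0 / ((\<Prod>j\<in>A-{i}. ?z i - ?z j) * (\<Prod>j\<in>B. ?z i - ?z j))) (at (?z i))"
            using 2 nz[OF fin(1)] nz[OF fin(2)] by (intro tendsto_divide tendsto_mult limE lim) auto
          thus "((\<lambda>\<omega>. ?E \<omega> / ((\<Prod>j\<in>A-{i}. \<omega> - ?z j) * (\<Prod>j\<in>B. \<omega> - ?z j)))
              \<longlongrightarrow> (if i \<in> B then V i else 0)) (at (?z i))" using 2 by simp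
        qed (use 2 fin in \<open>simp add: f_def split\<close>)
      next
        case 3
        show ?thesis
        proof (rule cong)
          have "((\<lambda>\<omega>. ?E \<omega> / ((\<Prod>j\<in>A. \<omega> - ?z j) * (\<Prod>j\<in>B-{i}. \<omega> - ?z j)))
              \<longlongrightarrow> 0 / ((\<Prod>j\<in>A. ?z i - ?z j) * (\<Prod>j\<in>B-{i}. ?z i - ?z j))) (at (?z i))"
            using 3 nz[OF fin(1)] nz[OF fin(2)] by (intro tendsto_divide tendsto_mult limE lim) auto
          moreover have "V i = 0" unfolding V_def divdiff_weight_def A_def[symmetric] using 3 by simp
          ultimately show "((\<lambda>\<omega>. ?E \<omega> / ((\<Prod>j\<in>A. \<omega> - ?z j) * (\<Prod>j\<in>B-{i}. \<omega> - ?z j)))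
              \<longlongrightarrow> (if i \<in> B then V i else 0)) (at (?z i))" using 3 by simp
        qed (use 3 fin in \<open>simp add: f_def split\<close>)
      qed
    qed
    have wind: "winding_number \<delta> (?z i) = -1" if "i \<in> A \<union> B" for i
    proof -
      have "winding_number (circlepath 0 \<epsilon>) (Q ^ i) = 0"
        using winds_circle_out[of \<epsilon> "Q ^ i"] small'[OF that] nQ[of i] \<epsilon> by (simp add: winds_def)
      moreover have "winding_number (circlepath 0 \<epsilon>) 0 = 1"
        using winds_circle_in[of 0 \<epsilon>] \<epsilon> by (simp add: winds_def)
      moreover have "Q ^ i \<notin> path_image (circlepath 0 \<epsilon>)" using small'[OF that] nQ[of i] \<epsilon> by auto
      ultimately show ?thesis
        using winding_number_inverse_comp[OF vc, of "Q ^ i"] Q0 by (simp add: \<delta>_def inverse_eq_divide)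
    qed
    have "contour_integral \<delta> f = 2 * pi * \<i> * (\<Sum>p\<in>?z ` (A \<union> B). winding_number \<delta> p * residue f p)"
    proof (rule Residue_theorem[of UNIV, OF _ _ _ _ vd pd])
      show "f holomorphic_on UNIV - ?z ` (A \<union> B)" by (rule fhol) auto
    qed (use fin off in \<open>auto simp: imd\<close>)
    also have "(\<Sum>p\<in>?z ` (A \<union> B). winding_number \<delta> p * residue f p)
        = (\<Sum>i\<in>A \<union> B. winding_number \<delta> (?z i) * residue f (?z i))"
      using inj by (subst sum.reindex) (auto simp: inj_on_def)
    also have "\<dots> = (\<Sum>i\<in>A \<union> B. - (if i \<in> B then V i else 0))"
      by (intro sum.cong refl) (simp add: wind res)
    also have "\<dots> = - (\<Sum>i\<in>B. V i)"
      using fin by (simp add: sum_negf sum.If_cases Int_absorb1)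
    finally have "contour_integral (circlepath 0 \<epsilon>) (\<lambda>w. f (inverse w) / w\<^sup>2) = 2 * pi * \<i> * (\<Sum>i\<in>B. V i)"
      unfolding via by simp
    moreover have "continuous_on (sphere 0 \<epsilon>) (\<lambda>w. f (inverse w) / w\<^sup>2)"
      by (intro cont_inv holomorphic_on_imp_continuous_on fhol off)
    ultimately show thesis
      by (intro that[of "\<lambda>w. f (inverse w) / w\<^sup>2"]) (simp_all add: f_def A_def V_def)
  next
    \<comment> \<open>Without shared nodes each zero of the denominator cancels a factor of the
      infinite product. The resulting entire function \<open>g\<close> replaces the quotient even if
      the circle meets some q^i.\<close>
    case True
    define n where "n = Suc (Max (A \<union> B))"
    have sub: "A \<union> B \<subseteq> {..<n}" using fin by (auto simp: n_def less_Suc_eq_le intro!: Max_ge)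
    define g where "g \<omega> = (\<Prod>i\<in>A \<union> B. - (Q ^ i)) * (\<Prod>i\<in>{..<n} - (A \<union> B). 1 - \<omega> * Q ^ i) * ?E (\<omega> * Q ^ n)" for \<omega>
    have ghol: "g holomorphic_on UNIV" unfolding g_def Q_def by (intro holomorphic_intros q)
    have fg: "f \<omega> = g \<omega>" if \<omega>: "\<omega> \<notin> ?z ` (A \<union> B)" for \<omega>
    proof -
      have "?E \<omega> = (\<Prod>i<n. 1 - \<omega> * Q ^ i) * ?E (\<omega> * Q ^ n)"
        unfolding Q_def by (rule qpoch_inf_split[OF q])
      also have "(\<Prod>i<n. 1 - \<omega> * Q ^ i) = (\<Prod>i\<in>{..<n} - (A \<union> B). 1 - \<omega> * Q ^ i) * (\<Prod>i\<in>A \<union> B. 1 - \<omega> * Q ^ i)"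
        using sub by (intro prod.subset_diff) auto
      also have "(\<Prod>i\<in>A \<union> B. 1 - \<omega> * Q ^ i) = (\<Prod>i\<in>A \<union> B. - (Q ^ i) * (\<omega> - ?z i))"
        using Q0 by (intro prod.cong refl) (simp add: field_simps)
      also have "\<dots> = (\<Prod>i\<in>A \<union> B. - (Q ^ i)) * ((\<Prod>i\<in>A. \<omega> - ?z i) * (\<Prod>i\<in>B. \<omega> - ?z i))"
        using fin True by (simp only: prod.distrib prod.union_disjoint)
      finally have "?E \<omega> = g \<omega> * ((\<Prod>i\<in>A. \<omega> - ?z i) * (\<Prod>i\<in>B. \<omega> - ?z i))"
        by (simp add: g_def mult_ac)
      moreover have "(\<Prod>i\<in>A. \<omega> - ?z i) * (\<Prod>i\<in>B. \<omega> - ?z i) \<noteq> 0" using \<omega> fin by auto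
      ultimately show ?thesis by (simp add: f_def)
    qed
    \<comment> \<open>A point q^i on the circle must be its positive real point, the only place
      where division by zero could falsify the quotient.\<close>
    have eq: "g (inverse w) / w\<^sup>2 = f (inverse w) / w\<^sup>2" if w: "norm w = \<epsilon>" "w \<noteq> of_real \<epsilon>" for w
    proof -
      have "inverse w \<noteq> ?z i" for i
      proof
        assume "inverse w = ?z i"
        hence eq: "w = of_real (q ^ i)" by (simp add: inverse_eq_divide Q_def)
        have "norm w = q ^ i" unfolding eq norm_of_real using q by simp
        thus False using w eq by simp
      qed
      thus ?thesis by (subst fg) auto
    qed
    have "contour_integral \<delta> g = 0"
      by (rule contour_integral_unique, rule Cauchy_theorem_convex_simple[OF ghol]) (use vd pd in auto)
    moreover have "(\<Sum>i\<in>B. V i) = 0"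
      by (rule sum.neutral) (use True in \<open>auto simp: V_def divdiff_weight_def A_def\<close>)
    ultimately have "contour_integral (circlepath 0 \<epsilon>) (\<lambda>w. g (inverse w) / w\<^sup>2) = 2 * pi * \<i> * (\<Sum>i\<in>B. V i)"
      unfolding via by simp
    moreover have "continuous_on (sphere 0 \<epsilon>) (\<lambda>w. g (inverse w) / w\<^sup>2)"
      by (intro cont_inv holomorphic_on_imp_continuous_on holomorphic_on_subset[OF ghol]) auto
    ultimately show thesis using eq
      by (intro that[of "\<lambda>w. g (inverse w) / w\<^sup>2"]) (simp_all add: f_def A_def V_def)
  qed
qed

section \<open>Evaluation of the residues by Lagrange interpolation\<close>

lemma lagr_node:
  fixes q :: "'a :: field"
  assumes q: "q \<noteq> 0" "\<And>n. n > 0 \<Longrightarrow> q ^ n \<noteq> 1" and x: "distinct x" and rs: "r < length x" "s < length x"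
  shows "lagr q x r (x ! s) = (if r = s then 1 else 0)"
proof (cases "r = s")
  case True
  have "1 / q ^ (x ! s) - 1 / q ^ (x ! i) \<noteq> 0" if "i \<in> {..<length x} - {s}" for i
    using that rs x inverse_power_inj[OF q, of "x ! s" "x ! i"] by (auto simp: nth_eq_iff_index_eq)
  hence "(\<Prod>i\<in>{..<length x}-{s}. (1 / q ^ (x ! s) - 1 / q ^ (x ! i)) / (1 / q ^ (x ! s) - 1 / q ^ (x ! i))) = 1"
    by (intro prod.neutral ballI divide_self)
  thus ?thesis using True kap_nonzero[OF q] by (simp add: lagr_def)
next
  case False
  hence "(\<Prod>i\<in>{..<length x}-{r}. (1 / q ^ (x ! s) - 1 / q ^ (x ! i)) / (1 / q ^ (x ! r) - 1 / q ^ (x ! i))) = 0"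
    using rs by (intro prod_zero) (auto intro!: bexI[of _ s])
  thus ?thesis using False by (simp add: lagr_def)
qed

lemma contour_integral_cmult: "contour_integral g (\<lambda>z. c * f z) = c * contour_integral g f"
  unfolding contour_integral_integral by (simp add: mult.assoc)

lemma prod_nth_distinct:
  assumes "distinct x"
  shows "(\<Prod>r<length x. f (x ! r)) = (\<Prod>i\<in>set x. f i)"
  using prod.reindex_bij_betw[OF bij_betw_nth[OF assms refl refl], of f] by (simp add: lessThan_def)

lemma sum_nth_distinct:
  assumes "distinct x"
  shows "(\<Sum>r<length x. f (x ! r)) = (\<Sum>i\<in>set x. f i)"
  using sum.reindex_bij_betw[OF bij_betw_nth[OF assms refl refl], of f] by (simp add: lessThan_def)

text \<open>Newton's remainder formula for F = kap * d: the sum is, up to a constant, the divided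
  difference of F over q^(-k) and the nodes of x. Multiplied by the product of node differences it
  is the interpolation error at k.\<close>

lemma residue_sum_eq_lagrange:
  fixes q e :: "'a :: field"
  assumes q: "q \<noteq> 0" "\<And>n. n > 0 \<Longrightarrow> q ^ n \<noteq> 1" and x: "distinct x" and k: "k \<notin> set x" and e: "e \<noteq> 0"
  shows "(\<Prod>r<length x. 1 / q ^ k - 1 / q ^ (x ! r)) / (- (e * kap q k)) *
     (\<Sum>i\<in>insert k (set x). - (e * kap q i) * d i / (\<Prod>j\<in>insert k (set x)-{i}. 1 / q ^ i - 1 / q ^ j))
    = d k - (\<Sum>r<length x. lagr q x r k * d (x ! r))"
proof -
  let ?z = "\<lambda>i. 1 / q ^ i"
  define D where "D = (\<Prod>r<length x. ?z k - ?z (x ! r))"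
  have inj: "?z i = ?z j \<longleftrightarrow> i = j" for i j by (rule inverse_power_inj[OF q])
  have nk: "k \<noteq> x ! r" if "r < length x" for r using that k by auto
  have D0: "D \<noteq> 0" using nk inj by (auto simp: D_def)
  have kp: "kap q i \<noteq> 0" for i by (rule kap_nonzero[OF q])
  have "insert k (set x) - {k} = set x" using k by auto
  hence "(\<Prod>j\<in>insert k (set x)-{k}. ?z k - ?z j) = D"
    using prod_nth_distinct[OF x, of "\<lambda>j. ?z k - ?z j"] by (simp add: D_def)
  hence 1: "D / (- (e * kap q k)) * (- (e * kap q k) * d k / (\<Prod>j\<in>insert k (set x)-{k}. ?z k - ?z j)) = d k"
    using D0 e kp[of k] by simp
  have 2: "D / (- (e * kap q k)) * (- (e * kap q (x ! r)) * d (x ! r) / (\<Prod>j\<in>insert k (set x)-{x ! r}. ?z (x ! r) - ?z j))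
     = - (lagr q x r k * d (x ! r))" if r: "r < length x" for r
  proof -
    define R where "R = (\<Prod>s\<in>{..<length x}-{r}. ?z (x ! r) - ?z (x ! s))"
    define R' where "R' = (\<Prod>s\<in>{..<length x}-{r}. ?z k - ?z (x ! s))"
    have "insert k (set x) - {x ! r} = insert k (set x - {x ! r})" using nk[OF r] by auto
    hence "(\<Prod>j\<in>insert k (set x)-{x ! r}. ?z (x ! r) - ?z j) = (?z (x ! r) - ?z k) * (\<Prod>j\<in>set x - {x ! r}. ?z (x ! r) - ?z j)"
      using k by simp
    also have "(\<Prod>j\<in>set x - {x ! r}. ?z (x ! r) - ?z j) = R"
      unfolding R_def
    proof (rule prod.reindex_bij_betw[symmetric])
      have "bij_betw ((!) x) ({..<length x} - {r}) (set x - (!) x ` {r})"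
        using bij_betw_nth[OF x refl refl] r by (intro bij_betw_DiffI) (auto simp: bij_betw_def lessThan_def)
      thus "bij_betw ((!) x) ({..<length x} - {r}) (set x - {x ! r})" by simp
    qed
    finally have den: "(\<Prod>j\<in>insert k (set x)-{x ! r}. ?z (x ! r) - ?z j) = (?z (x ! r) - ?z k) * R" .
    have D: "D = (?z k - ?z (x ! r)) * R'"
      unfolding D_def R'_def by (rule prod.remove) (use r in auto)
    have la: "lagr q x r k = kap q (x ! r) / kap q k * (R' / R)"
      by (simp add: lagr_def R_def R'_def prod_dividef)
    have "v * R' / (- (e * a)) * (- (e * c) * b / (- v * R)) = - (c / a * (R' / R) * b)"
      if "v \<noteq> 0" "a \<noteq> 0" for v a b c :: 'a
      using that e by (simp add: field_simps)
    from this[of "?z k - ?z (x ! r)" "kap q k" "kap q (x ! r)" "d (x ! r)"] show ?thesis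
      unfolding den D la using inj[of k "x ! r"] nk[OF r] kp by simp
  qed
  have "D / (- (e * kap q k)) *
     (\<Sum>i\<in>insert k (set x). - (e * kap q i) * d i / (\<Prod>j\<in>insert k (set x)-{i}. ?z i - ?z j))
    = d k + (\<Sum>i\<in>set x. D / (- (e * kap q k)) * (- (e * kap q i) * d i / (\<Prod>j\<in>insert k (set x)-{i}. ?z i - ?z j)))"
    using k by (simp only: sum.insert[OF finite_set k] distrib_left 1 sum_distrib_left)
  also have "(\<Sum>i\<in>set x. D / (- (e * kap q k)) * (- (e * kap q i) * d i / (\<Prod>j\<in>insert k (set x)-{i}. ?z i - ?z j)))
     = (\<Sum>r<length x. - (lagr q x r k * d (x ! r)))"
    unfolding sum_nth_distinct[OF x, symmetric] by (rule sum.cong) (simp_all only: 2 lessThan_iff)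
  finally show ?thesis by (simp add: D_def sum_negf)
qed

text \<open>In the coordinate 1/w every factor is a product over nodes. The denominator w/q^k - 1
  left by the z residue adds k to the nodes of x, and the powers of w collapse to w^(-2), the
  Jacobian of the inversion.\<close>

lemma w_factor_eq:
  fixes q w :: "'a :: field"
  assumes q: "q \<noteq> 0" and x: "distinct x" and k: "k \<notin> set x" and w: "w \<noteq> 0"
  shows "w ^ t * (c / qpoch (w * q powi (- int y - int t)) q (t + 1)) / c' * e / (\<Prod>r<length x. 1 - q ^ (x ! r) / w)
      / (w / q ^ k - 1)
    = - (c / c') / (\<Prod>r<length x. - (q ^ (x ! r))) *
      (e / ((\<Prod>i\<in>{y..y+t}. inverse w - 1 / q ^ i) * (\<Prod>i\<in>insert k (set x). inverse w - 1 / q ^ i)) / w\<^sup>2)"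
proof -
  define A where "A = (\<Prod>i\<in>{y..y+t}. inverse w - 1 / q ^ i)"
  define B where "B = (\<Prod>r<length x. inverse w - 1 / q ^ (x ! r))"
  define C where "C = (\<Prod>r<length x. - (q ^ (x ! r)))"
  have "qpoch (w * q powi (- int y - int t)) q (t + 1) = (\<Prod>i<t + 1. w * (inverse w - 1 / q ^ (y + t - i)))"
    unfolding qpoch_def
  proof (rule prod.cong)
    fix i assume i: "i \<in> {..<t + 1}"
    have "q powi (- int y - int t) * q ^ i = q powi (- int (y + t - i))"
      using q i by (simp flip: power_int_of_nat power_int_add add: of_nat_diff algebra_simps)
    also have "\<dots> = 1 / q ^ (y + t - i)"
      by (simp only: power_int_minus power_int_of_nat inverse_eq_divide)
    finally show "1 - w * q powi (- int y - int t) * q ^ i = w * (inverse w - 1 / q ^ (y + t - i))"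
      using w by (simp add: mult.assoc right_diff_distrib)
  qed simp
  also have "\<dots> = (\<Prod>i\<in>{y..y+t}. w * (inverse w - 1 / q ^ i))"
    by (rule prod.reindex_bij_witness[where i = "\<lambda>i. y + t - i" and j = "\<lambda>i. y + t - i"]) auto
  also have "\<dots> = w ^ (t + 1) * A" by (simp add: prod.distrib A_def)
  finally have 1: "qpoch (w * q powi (- int y - int t)) q (t + 1) = w ^ (t + 1) * A" .
  have 2: "(\<Prod>r<length x. 1 - q ^ (x ! r) / w) = C * B"
    unfolding C_def B_def prod.distrib[symmetric] using q w by (intro prod.cong) (auto simp: field_simps)
  have 3: "w / q ^ k - 1 = - w * (inverse w - 1 / q ^ k)"
    using w by (simp add: right_diff_distrib)
  have 4: "(\<Prod>i\<in>insert k (set x). inverse w - 1 / q ^ i) = (inverse w - 1 / q ^ k) * B"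
    using k prod_nth_distinct[OF x, of "\<lambda>i. inverse w - 1 / q ^ i"] by (simp add: B_def)
  have "w ^ t * (c / (w ^ (t + 1) * A)) / c' * e / (C * B) / (- w * v) = - (c / c') / C * (e / (A * (v * B)) / w\<^sup>2)" for v
  proof -
    have e1: "w ^ t * (c / (w ^ (t + 1) * A)) = c / (w * A)" using w by simp
    show ?thesis unfolding e1 by (simp add: divide_inverse power2_eq_square mult_ac)
  qed
  thus ?thesis unfolding 1 2 3 4 A_def[symmetric] C_def[symmetric] .
qed

text \<open>Admissibility controls only genuine poles, so cancellation has to be ruled out. The
  finite q-Pochhammer symbol in z vanishes only at q^i with y2 < i < y2 + t2, and the last product
  only at the q^(x_r).\<close>

lemma is_pole_walks_integrand:
  fixes q :: real and x :: "nat list"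
  defines "Q \<equiv> complex_of_real q"
  assumes q: "0 < q" "q < 1" and k: "k \<le> y2" "k \<notin> set x"
    and w: "w \<noteq> 0" "w \<noteq> Q ^ k" "qpoch_inf (inverse w) Q \<noteq> 0"
      "qpoch (w * Q powi (- int y1 - int t1)) Q (t1 + 1) \<noteq> 0" "\<And>r. r < length x \<Longrightarrow> 1 - Q ^ (x ! r) / w \<noteq> 0"
  shows "is_pole (walks_integrand Q x (int y1) t1 (int y2) t2 w) (Q ^ k)"
proof -
  have Q0: "Q \<noteq> 0" and Qn: "\<And>n. n > 0 \<Longrightarrow> Q ^ n \<noteq> 1" using q complex_power_neq_one[OF q] by (auto simp: Q_def)
  have inj: "1 / Q ^ a = 1 / Q ^ b \<longleftrightarrow> a = b" for a b by (rule inverse_power_inj[OF Q0 Qn])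
  have injQ: "Q ^ a = Q ^ b \<longleftrightarrow> a = b" for a b using inj[of a b] Q0 by (auto simp: field_simps)
  have qq: "qpoch Q Q n \<noteq> 0" for n
    using Qn[of "Suc _"] by (simp add: qpoch_def)
  define g where "g z = z powi (- int t2) * w ^ t1 / (w - z)
     * (qpoch Q Q t1 / qpoch (w * Q powi (- int y1 - int t1)) Q (t1 + 1))
     * ((\<Prod>i<t2 - 1. 1 - z * Q powi (1 - int y2 - int t2) * Q ^ i) / qpoch Q Q (t2 - 1))
     * qpoch_inf (inverse w) Q * (\<Prod>r<length x. (1 - Q ^ (x ! r) / z) / (1 - Q ^ (x ! r) / w))" for z
  have eq: "walks_integrand Q x (int y1) t1 (int y2) t2 w = (\<lambda>z. g z / qpoch_inf (inverse z) Q)"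
    by (simp add: walks_integrand_def g_def qpoch_def fun_eq_iff)
  have Ei: "((\<lambda>z. qpoch_inf (inverse z) Q) has_field_derivative
      - (qpoch_inf Q Q * kap Q k) * (- (inverse (Q ^ k) * inverse (Q ^ k)))) (at (Q ^ k))"
  proof -
    have "((\<lambda>a. qpoch_inf a Q) has_field_derivative - (qpoch_inf Q Q * kap Q k)) (at (inverse (Q ^ k)))"
      using qpoch_inf_deriv[OF q, of k] by (simp add: Q_def inverse_eq_divide)
    moreover have "(inverse has_field_derivative - (inverse (Q ^ k) * inverse (Q ^ k))) (at (Q ^ k))"
      using Q0 by (intro DERIV_inverse'[OF DERIV_ident, simplified]) auto
    ultimately show ?thesis by (rule DERIV_chain2)
  qed
  have E0: "qpoch_inf (inverse (Q ^ k)) Q = 0"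
    using qpoch_inf_zero[OF q, of k] by (simp add: Q_def inverse_eq_divide)
  show ?thesis unfolding eq
  proof (rule is_pole_divide)
    show "isCont g (Q ^ k)"
      unfolding g_def using w Q0 qq by (intro continuous_intros) auto
    show "filterlim (\<lambda>z. qpoch_inf (inverse z) Q) (at 0) (at (Q ^ k))"
    proof (rule filterlim_atI)
      show "((\<lambda>z. qpoch_inf (inverse z) Q) \<longlongrightarrow> 0) (at (Q ^ k))"
        using DERIV_isCont[OF Ei] by (simp add: isCont_def E0)
      have "- (qpoch_inf Q Q * kap Q k) * (- (inverse (Q ^ k) * inverse (Q ^ k))) \<noteq> 0"
        using qpoch_inf_self_nonzero[OF q] kap_nonzero[OF Q0 Qn] Q0 by (simp add: Q_def)
      hence "\<forall>\<^sub>F z in at (Q ^ k). (qpoch_inf (inverse z) Q - qpoch_inf (inverse (Q ^ k)) Q) / (z - Q ^ k) \<noteq> 0"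
        using Ei by (intro tendsto_imp_eventually_ne) (auto simp: has_field_derivative_iff)
      thus "\<forall>\<^sub>F z in at (Q ^ k). qpoch_inf (inverse z) Q \<noteq> 0"
        by eventually_elim (auto simp: E0)
    qed
    have "1 - Q ^ k * Q powi (1 - int y2 - int t2) * Q ^ i \<noteq> 0" if "i < t2 - 1" for i
    proof -
      have "Q ^ k * Q powi (1 - int y2 - int t2) * Q ^ i = Q powi (- int (y2 + t2 - 1 - i - k))"
        using Q0 that k by (simp flip: power_int_of_nat power_int_add add: of_nat_diff algebra_simps)
      also have "\<dots> = 1 / Q ^ (y2 + t2 - 1 - i - k)"
        by (simp only: power_int_minus power_int_of_nat inverse_eq_divide)
      also have "\<dots> \<noteq> 1" using Qn[of "y2 + t2 - 1 - i - k"] that k(1) Q0 by (auto simp: field_simps)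
      finally show ?thesis by simp
    qed
    moreover have "1 - Q ^ (x ! r) / Q ^ k \<noteq> 0" if "r < length x" for r
      using injQ[of "x ! r" k] Q0 that k(2) by (auto simp: field_simps)
    ultimately show "g (Q ^ k) \<noteq> 0"
      using w Q0 qq by (auto simp: g_def)
  qed
qed

text \<open>Each z residue at q^k leaves a w integral that is an interpolation error. Under the last
  hypothesis, for every k either q^k is a pole off the w circle, about which \<gamma> has winding
  number 0, or the w integral vanishes; in both cases the unknown factor 1 - winding number may be
  replaced by 1.\<close>

lemma contour_double_integral:
  fixes q e :: real and x :: "nat list" and \<gamma> :: "real \<Rightarrow> complex"
  defines "Q \<equiv> complex_of_real q"
  assumes q: "0 < q" "q < 1" and x: "distinct x" and t2: "t2 > 0"
    and adm: "admissible_contours Q x (int y1) t1 (int y2) t2 e \<gamma>"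
    and dich: "(\<exists>a\<in>set x. y2 \<le> a) \<or> (\<forall>a\<in>set x. a < y1)"
  shows "contour_integral (circlepath 0 e) (\<lambda>w. contour_integral \<gamma> (\<lambda>z. walks_integrand Q x (int y1) t1 (int y2) t2 w z))
    = - ((2 * pi * \<i>)\<^sup>2 * (qpoch Q Q t1 / qpoch Q Q (t2 - 1)) *
        (\<Sum>k\<le>y2. (\<Prod>i\<in>{y2<..<y2+t2}. 1 / Q ^ k - 1 / Q ^ i) *
           (divdiff_weight Q t1 y1 k - (\<Sum>r<length x. lagr Q x r k * divdiff_weight Q t1 y1 (x ! r)))))"
proof -
  let ?E = "\<lambda>\<zeta>. qpoch_inf \<zeta> Q"
  let ?n = "\<lambda>k. winding_number \<gamma> (Q ^ k)"
  define P where "P k = (\<Prod>i\<in>{y2<..<y2+t2}. 1 / Q ^ k - 1 / Q ^ i)" for k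
  define br where "br k = divdiff_weight Q t1 y1 k - (\<Sum>r<length x. lagr Q x r k * divdiff_weight Q t1 y1 (x ! r))" for k
  define H where "H = {..y2} - set x"
  have Q0: "Q \<noteq> 0" and Qn: "\<And>n. n > 0 \<Longrightarrow> Q ^ n \<noteq> 1" using q complex_power_neq_one[OF q] by (auto simp: Q_def)
  have inj: "1 / Q ^ a = 1 / Q ^ b \<longleftrightarrow> a = b" for a b by (rule inverse_power_inj[OF Q0 Qn])
  have nQ: "norm (Q ^ i) = q ^ i" for i using q by (simp add: Q_def norm_power)
  have EQ: "?E Q \<noteq> 0" using qpoch_inf_self_nonzero[OF q] by (simp add: Q_def)
  have e: "e > 0"
    and c1: "\<And>w. 0 < norm w \<Longrightarrow> norm w \<le> e \<Longrightarrow> qpoch (w * Q powi (- int y1 - int t1)) Q (t1 + 1) \<noteq> 0"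
    and c2: "\<And>w r. 0 < norm w \<Longrightarrow> norm w \<le> e \<Longrightarrow> r < length x \<Longrightarrow> 1 - Q ^ (x ! r) / w \<noteq> 0"
    and \<gamma>: "valid_path \<gamma>" "pathfinish \<gamma> = pathstart \<gamma>"
    and \<gamma>E: "\<And>z. z \<in> path_image \<gamma> \<Longrightarrow> ?E (inverse z) \<noteq> 0"
    and w0: "winds \<gamma> 1 0"
    and ww: "\<And>w. norm w = e \<Longrightarrow> winds \<gamma> 1 w"
    and wi: "\<And>k. winds \<gamma> 1 (Q powi (int y2 + int t2 + int k))"
    and wp: "\<And>w p. norm w = e \<Longrightarrow> is_pole (walks_integrand Q x (int y1) t1 (int y2) t2 w) p \<Longrightarrow>
        p \<noteq> 0 \<Longrightarrow> norm p \<noteq> e \<Longrightarrow> p \<notin> range (\<lambda>k. Q powi (int y2 + int t2 + int k)) \<Longrightarrow> winds \<gamma> 0 p"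
    using adm unfolding admissible_contours_def by auto
  have powi: "Q powi (int y2 + int t2 + int k) = Q ^ (y2 + t2 + k)" for k
    by (simp flip: power_int_of_nat)
  \<comment> \<open>A violation would put a zero of a w denominator into the punctured disc where
    admissibility forbids it.\<close>
  have small: "e < q ^ i" if i: "i \<in> {y1..y1+t1} \<union> set x" for i
  proof (rule ccontr)
    assume "\<not> e < q ^ i"
    hence ni: "0 < norm (Q ^ i)" "norm (Q ^ i) \<le> e" using q nQ by auto
    show False
    proof (cases "i \<in> set x")
      case True
      then obtain r where "r < length x" "x ! r = i" by (auto simp: in_set_conv_nth)
      thus False using c2[OF ni, of r] Q0 by simp
    next
      case False
      hence "i \<ge> y1" "i \<le> y1 + t1" using i by auto
      hence "Q ^ i * Q powi (- int y1 - int t1) * Q ^ (y1 + t1 - i) = Q powi 0"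
        using Q0 by (simp flip: power_int_of_nat power_int_add add: of_nat_diff)
      hence "qpoch (Q ^ i * Q powi (- int y1 - int t1)) Q (t1 + 1) = 0"
        unfolding qpoch_def using \<open>i \<ge> y1\<close> by (intro prod_zero) (auto intro!: bexI[of _ "y1 + t1 - i"])
      thus False using c1[OF ni] by simp
    qed
  qed
  \<comment> \<open>If k <= y2 <= a for a starting site a, then q^k >= q^a > e. If all starting
    sites lie below y1, only k itself can meet {y1..y1+t1}, and in that case again e < q^k.\<close>
  have alt: "e < q ^ k \<or> {y1..y1+t1} \<inter> insert k (set x) = {}" if k: "k \<in> H" for k
    using dich
  proof
    assume "\<exists>a\<in>set x. y2 \<le> a"
    then obtain a where a: "a \<in> set x" "y2 \<le> a" by blast
    have "q ^ a \<le> q ^ k" using q a k by (intro power_decreasing) (auto simp: H_def)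
    thus ?thesis using small[of a] a by auto
  next
    assume "\<forall>a\<in>set x. a < y1"
    thus ?thesis using small[of k] by (cases "k \<in> {y1..y1+t1}") auto
  qed
  have n0: "?n k = 0" if k: "k \<in> H" "e < q ^ k" for k
  proof -
    \<comment> \<open>Any point of the circle may witness the pole; the negative one cannot be a
      power of q, so the factor (1/w; q)_infinity is nonzero.\<close>
    define w where "w = - complex_of_real e"
    have nw: "norm w = e" "w \<noteq> 0" using e by (auto simp: w_def)
    have "is_pole (walks_integrand Q x (int y1) t1 (int y2) t2 w) (Q ^ k)"
      unfolding Q_def
    proof (rule is_pole_walks_integrand[OF q])
      show "qpoch_inf (inverse w) (complex_of_real q) \<noteq> 0"
      proof
        assume "qpoch_inf (inverse w) (complex_of_real q) = 0"
        then obtain j where "inverse w = 1 / complex_of_real q ^ j" using qpoch_inf_eq_0_iff[OF q] by blast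
        hence "w = of_real (q ^ j)" by (simp add: inverse_eq_divide)
        hence "Re w = q ^ j" by simp
        moreover have "Re w < 0" using e by (simp add: w_def)
        moreover have "q ^ j > 0" using q by simp
        ultimately show False by linarith
      qed
    qed (use k nw c1 c2 nQ[of k] in \<open>auto simp: H_def Q_def\<close>)
    moreover have "Q ^ k \<notin> range (\<lambda>j. Q powi (int y2 + int t2 + int j))"
    proof
      assume "Q ^ k \<in> range (\<lambda>j. Q powi (int y2 + int t2 + int j))"
      then obtain j where "Q ^ k = Q ^ (y2 + t2 + j)" unfolding powi by blast
      hence "k = y2 + t2 + j" using inj[of k "y2 + t2 + j"] by simp
      thus False using k t2 by (simp add: H_def)
    qed
    ultimately have "winds \<gamma> 0 (Q ^ k)" using wp[OF nw(1)] k nQ[of k] Q0 by auto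
    thus ?thesis by (simp add: winds_def)
  qed
  define C1 where "C1 = - (qpoch Q Q t1 / qpoch Q Q (t2 - 1)) / (\<Prod>r<length x. - (Q ^ (x ! r)))"
  define tgt where "tgt k w = ?E (inverse w) / ((\<Prod>i\<in>{y1..y1+t1}. inverse w - 1 / Q ^ i) *
       (\<Prod>i\<in>insert k (set x). inverse w - 1 / Q ^ i)) / w\<^sup>2" for k w
  define V where "V k = (\<Sum>i\<in>insert k (set x). - (?E Q * kap Q i) * divdiff_weight Q t1 y1 i / (\<Prod>j\<in>insert k (set x)-{i}. 1 / Q ^ i - 1 / Q ^ j))" for k
  define co where "co k = (1 - ?n k) * (P k * (\<Prod>r<length x. 1 - Q ^ (x ! r) / Q ^ k) / (- (?E Q * kap Q k)))" for k
  \<comment> \<open>At w = e the target may contain a division by zero; a continuous representative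
    makes every w integral exist.\<close>
  define good where "good k h \<longleftrightarrow> continuous_on (sphere 0 e) h \<and> (\<forall>w. norm w = e \<longrightarrow> w \<noteq> of_real e \<longrightarrow> h w = tgt k w) \<and>
     contour_integral (circlepath 0 e) h = 2 * pi * \<i> * V k" for k h
  have "\<exists>h. good k h" if k: "k \<in> H" for k
  proof -
    have kx: "k \<notin> set x" using k by (simp add: H_def)
    show ?thesis
      unfolding good_def tgt_def V_def Q_def
    proof (rule w_contour_integral[OF q e finite_set kx small alt[OF k]], goal_cases)
      case (2 h)
      show ?case
        by (intro exI[of _ h] conjI allI impI; (rule 2(1) | rule 2(3) | (rule 2(2); assumption)))
    qed
  qed
  hence "\<forall>k\<in>H. \<exists>h. good k h" by blast
  from bchoice[OF this] obtain h where good: "\<forall>k\<in>H. good k (h k)" by blast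
  have h: "continuous_on (sphere 0 e) (h k)" "norm w = e \<Longrightarrow> w \<noteq> of_real e \<Longrightarrow> h k w = tgt k w"
    "contour_integral (circlepath 0 e) (h k) = 2 * pi * \<i> * V k" if "k \<in> H" for k w
    using good that by (simp_all add: good_def)
  have inner: "contour_integral \<gamma> (\<lambda>z. walks_integrand Q x (int y1) t1 (int y2) t2 w z)
     = (\<Sum>k\<in>H. 2 * pi * \<i> * co k * C1 * h k w)" if w: "norm w = e" "w \<noteq> of_real e" for w
  proof -
    have wn: "w \<noteq> 0" using w e by auto
    have wQ: "w \<noteq> Q ^ k" for k
    proof
      assume eq: "w = Q ^ k"
      hence "e = q ^ k" using w nQ by simp
      thus False using eq w by (simp add: Q_def)
    qed
    define cw where "cw = w ^ t1 * (qpoch Q Q t1 / qpoch (w * Q powi (- int y1 - int t1)) Q (t1 + 1)) / qpoch Q Q (t2 - 1)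
        * ?E (inverse w) / (\<Prod>r<length x. 1 - Q ^ (x ! r) / w)"
    have "walks_integrand Q x (int y1) t1 (int y2) t2 w z = cw * (z powi (- int t2) / (w - z) *
        qpoch (z * Q powi (1 - int y2 - int t2)) Q (t2 - 1) / ?E (inverse z) * (\<Prod>r<length x. 1 - Q ^ (x ! r) / z))" for z
      unfolding walks_integrand_def prod_dividef cw_def by (simp add: divide_inverse mult_ac)
    hence "contour_integral \<gamma> (\<lambda>z. walks_integrand Q x (int y1) t1 (int y2) t2 w z)
      = cw * contour_integral \<gamma> (\<lambda>z. z powi (- int t2) / (w - z) *
        qpoch (z * Q powi (1 - int y2 - int t2)) Q (t2 - 1) / ?E (inverse z) * (\<Prod>r<length x. 1 - Q ^ (x ! r) / z))"
      by (simp only: contour_integral_cmult)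
    also have "contour_integral \<gamma> (\<lambda>z. z powi (- int t2) / (w - z) *
        qpoch (z * Q powi (1 - int y2 - int t2)) Q (t2 - 1) / ?E (inverse z) * (\<Prod>r<length x. 1 - Q ^ (x ! r) / z))
       = 2 * pi * \<i> * (\<Sum>k\<in>H. (1 - ?n k) * (P k * (\<Prod>r<length x. 1 - Q ^ (x ! r) / Q ^ k)
             / ((w / Q ^ k - 1) * (- (?E Q * kap Q k)))))"
      unfolding H_def P_def Q_def
    proof (rule z_contour_integral[OF q t2 \<gamma>])
      show "winding_number \<gamma> (complex_of_real q ^ j) = 1" if "j \<ge> y2 + t2" for j
        using wi[of "j - (y2 + t2)"] that unfolding powi by (simp add: winds_def Q_def)
    qed (use \<gamma>E w0 ww[OF w(1)] wn wQ in \<open>auto simp: winds_def Q_def\<close>)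
    also have "cw * (2 * pi * \<i> * (\<Sum>k\<in>H. (1 - ?n k) * (P k * (\<Prod>r<length x. 1 - Q ^ (x ! r) / Q ^ k)
             / ((w / Q ^ k - 1) * (- (?E Q * kap Q k))))))
       = (\<Sum>k\<in>H. 2 * pi * \<i> * co k * (cw / (w / Q ^ k - 1)))"
      unfolding sum_distrib_left co_def by (intro sum.cong refl) (simp add: divide_inverse mult_ac)
    also have "\<dots> = (\<Sum>k\<in>H. 2 * pi * \<i> * co k * C1 * h k w)"
    proof (rule sum.cong[OF refl])
      fix k assume k: "k \<in> H"
      hence "k \<notin> set x" by (simp add: H_def)
      hence "cw / (w / Q ^ k - 1) = C1 * tgt k w"
        unfolding cw_def C1_def tgt_def by (rule w_factor_eq[OF Q0 x _ wn])
      thus "2 * pi * \<i> * co k * (cw / (w / Q ^ k - 1)) = 2 * pi * \<i> * co k * C1 * h k w"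
        using h(2)[OF k w] by simp
    qed
    finally show ?thesis .
  qed
  \<comment> \<open>The point w = e, the only one of the circle that can be a power of q, is dropped
    as a finite exceptional set.\<close>
  have "contour_integral (circlepath 0 e) (\<lambda>w. contour_integral \<gamma> (\<lambda>z. walks_integrand Q x (int y1) t1 (int y2) t2 w z))
     = contour_integral (circlepath 0 e) (\<lambda>w. \<Sum>k\<in>H. 2 * pi * \<i> * co k * C1 * h k w)"
    by (rule contour_integral_spike_finite_simple_path[where A = "{of_real e}"])
       (use e inner in \<open>auto simp: simple_path_circlepath path_image_circlepath\<close>)
  also have "\<dots> = (\<Sum>k\<in>H. contour_integral (circlepath 0 e) (\<lambda>w. 2 * pi * \<i> * co k * C1 * h k w))"
    by (rule contour_integral_sum)
       (use e h(1) in \<open>auto simp: H_def path_image_circlepath intro!: contour_integrable_continuous_circlepath continuous_intros\<close>)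
  also have "\<dots> = (\<Sum>k\<in>H. 2 * pi * \<i> * co k * C1 * (2 * pi * \<i> * V k))"
    by (intro sum.cong refl) (simp only: contour_integral_cmult h(3))
  also have "\<dots> = (\<Sum>k\<in>H. - ((2 * pi * \<i>)\<^sup>2 * (qpoch Q Q t1 / qpoch Q Q (t2 - 1)) * (P k * br k)))"
  proof (rule sum.cong[OF refl])
    fix k assume k: "k \<in> H"
    hence kx: "k \<notin> set x" by (simp add: H_def)
    define D where "D = (\<Prod>r<length x. 1 / Q ^ k - 1 / Q ^ (x ! r))"
    define PX where "PX = (\<Prod>r<length x. - (Q ^ (x ! r)))"
    have PX: "PX \<noteq> 0" using Q0 by (simp add: PX_def)
    \<comment> \<open>Either the winding number is known to be 0, or no node is shared and every
      divided difference weight in the sum is 0.\<close>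
    have nV: "(1 - ?n k) * V k = V k"
    proof (cases "e < q ^ k")
      case True
      thus ?thesis using n0[OF k] by simp
    next
      case False
      with alt[OF k] have "{y1..y1+t1} \<inter> insert k (set x) = {}" by simp
      hence "V k = 0" unfolding V_def by (intro sum.neutral) (auto simp: divdiff_weight_def)
      thus ?thesis by simp
    qed
    have "(\<Prod>r<length x. 1 - Q ^ (x ! r) / Q ^ k) = PX * D"
      unfolding PX_def D_def prod.distrib[symmetric] using Q0 by (intro prod.cong) (auto simp: field_simps)
    hence "co k = (1 - ?n k) * (P k * (PX * D) / (- (?E Q * kap Q k)))" by (simp add: co_def)
    hence "2 * pi * \<i> * co k * C1 * (2 * pi * \<i> * V k)
      = - ((2 * pi * \<i>)\<^sup>2 * (qpoch Q Q t1 / qpoch Q Q (t2 - 1)) * (P k * (D / (- (?E Q * kap Q k)) * ((1 - ?n k) * V k))))"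
      unfolding C1_def PX_def[symmetric] using PX by (simp add: power2_eq_square divide_inverse mult_ac)
    also have "D / (- (?E Q * kap Q k)) * ((1 - ?n k) * V k) = br k"
      unfolding nV unfolding D_def V_def br_def by (rule residue_sum_eq_lagrange[OF Q0 Qn x kx EQ])
    finally show "2 * pi * \<i> * co k * C1 * (2 * pi * \<i> * V k)
      = - ((2 * pi * \<i>)\<^sup>2 * (qpoch Q Q t1 / qpoch Q Q (t2 - 1)) * (P k * br k))" .
  qed
  also have "\<dots> = - ((2 * pi * \<i>)\<^sup>2 * (qpoch Q Q t1 / qpoch Q Q (t2 - 1)) * (\<Sum>k\<in>H. P k * br k))"
    by (simp only: sum_negf sum_distrib_left)
  \<comment> \<open>The sum extends to the sites of x because the interpolation error vanishes
    there.\<close>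
  also have "(\<Sum>k\<in>H. P k * br k) = (\<Sum>k\<le>y2. P k * br k)"
  proof (rule sum.mono_neutral_left)
    show "\<forall>k\<in>{..y2} - H. P k * br k = 0"
    proof
      fix k assume "k \<in> {..y2} - H"
      then obtain s where s: "s < length x" "x ! s = k" by (auto simp: H_def in_set_conv_nth)
      have "(\<Sum>r<length x. lagr Q x r k * divdiff_weight Q t1 y1 (x ! r)) = (\<Sum>r<length x. if r = s then divdiff_weight Q t1 y1 k else 0)"
        using lagr_node[OF Q0 Qn x _ s(1)] s by (intro sum.cong) auto
      thus "P k * br k = 0" using s(1) by (simp add: br_def)
    qed
  qed (auto simp: H_def)
  finally show ?thesis by (simp only: P_def br_def)
qed

section \<open>The kernel\<close>

text \<open>The diagonal conjugation between the contour kernel and the transposed walk kernel: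
  q^(-t-y) (q; q)_t divided by the constant in \<open>stepop_pow_kdelta\<close>.\<close>

definition gauge :: "'a :: field \<Rightarrow> nat \<Rightarrow> nat \<Rightarrow> 'a" where
  "gauge q y t = (- 1) ^ t * q ^ (t choose 2) / q ^ y"

lemma Suc_choose_two: "Suc t choose 2 = (t choose 2) + t"
  by (simp add: numeral_2_eq_2)

lemma inverse_minus_one_power: "inverse ((- 1 :: 'a :: field) ^ n) = (- 1) ^ n"
  by (induction n) simp_all

lemma gauge_nonzero: "q \<noteq> 0 \<Longrightarrow> gauge q y t \<noteq> 0"
  by (simp add: gauge_def)

lemma qpoch_self:
  fixes q :: "'a :: field"
  assumes "q \<noteq> 0"
  shows "qpoch q q t = (- 1) ^ t * q ^ (Suc t choose 2) * (\<Prod>i<t. 1 - 1 / q ^ Suc i)"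
proof (induction t)
  case (Suc t)
  have "q ^ Suc t * (1 - 1 / q ^ Suc t) = - (1 - q ^ Suc t)"
    using assms by (simp add: right_diff_distrib)
  hence "1 - q ^ Suc t = - (q ^ Suc t * (1 - 1 / q ^ Suc t))" by simp
  moreover have "qpoch q q (Suc t) = qpoch q q t * (1 - q ^ Suc t)" by (simp add: qpoch_def)
  ultimately have "qpoch q q (Suc t) = qpoch q q t * - (q ^ Suc t * (1 - 1 / q ^ Suc t))" by (simp only:)
  moreover have "(- 1) ^ Suc t = - ((- 1) ^ t :: 'a)" by simp
  ultimately show ?case
    unfolding prod.lessThan_Suc Suc Suc_choose_two[of "Suc t"] power_add
    by (simp only: mult_minus_left mult_minus_right mult_ac)
qed (simp add: qpoch_def numeral_2_eq_2)

lemma prod_power_shift: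
  fixes q :: "'a :: comm_monoid_mult"
  shows "(\<Prod>i<s. q ^ (c + Suc i)) = q ^ (c * s) * q ^ (Suc s choose 2)"
proof (induction s)
  case (Suc s)
  show ?case unfolding prod.lessThan_Suc Suc Suc_choose_two[of "Suc s"]
    by (simp add: power_add mult_ac)
qed (simp add: numeral_2_eq_2)

text \<open>The z residue at q^k carries the entry (y, k) of the t-th inverse power: after powers of
  q are extracted, both are products of 1 - q^(y - k + i) over 1 <= i < t.\<close>

lemma prod_geometric_nodes:
  fixes q :: "'a :: field"
  assumes q: "q \<noteq> 0" "\<And>n. n > 0 \<Longrightarrow> q ^ n \<noteq> 1" and k: "k \<le> y" and t: "t > 0"
  shows "(\<Prod>i\<in>{y<..<y+t}. 1 / q ^ k - 1 / q ^ i) = - (qpoch q q (t - 1) / gauge q y t * (cumop q ^^ t) (kdelta k) y)"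
proof -
  obtain s where s: "t = Suc s" using t by (cases t) auto
  define N where "N = (\<Prod>i<s. 1 - q ^ (y - k + Suc i))"
  have "(\<Prod>i\<in>{y<..<y+t}. 1 / q ^ k - 1 / q ^ i) = (\<Prod>i<s. 1 / q ^ k - 1 / q ^ (y + Suc i))"
    by (rule prod.reindex_bij_witness[where i = "\<lambda>i. y + Suc i" and j = "\<lambda>i. i - Suc y"]) (auto simp: s)
  also have "\<dots> = (\<Prod>i<s. - (1 - q ^ (y - k + Suc i)) / q ^ (y + Suc i))"
  proof (rule prod.cong[OF refl])
    fix i
    have "q ^ (y + Suc i) = q ^ k * q ^ (y - k + Suc i)" using k by (simp flip: power_add)
    thus "1 / q ^ k - 1 / q ^ (y + Suc i) = - (1 - q ^ (y - k + Suc i)) / q ^ (y + Suc i)"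
      using q(1) by (simp add: diff_divide_distrib)
  qed
  also have "\<dots> = (- 1) ^ s * N / (q ^ (y * s) * q ^ (t choose 2))"
    unfolding prod_dividef prod_power_shift s N_def by (simp only: prod_uminus card_lessThan)
  finally have l: "(\<Prod>i\<in>{y<..<y+t}. 1 / q ^ k - 1 / q ^ i) = (- 1) ^ s * N / (q ^ (y * s) * q ^ (t choose 2))" .
  have qp: "qpoch q q s = (\<Prod>i<s. 1 - q ^ Suc i)" by (simp add: qpoch_def)
  have "qpoch q q s \<noteq> 0" unfolding qp using q(2)[of "Suc _"] by (auto simp del: power_Suc)
  moreover have "(cumop q ^^ t) (kdelta k) y = N / qpoch q q s / (q ^ y * q ^ (y * s))"
  proof -
    have "(cumop q ^^ Suc s) (kdelta k) y = (if k \<le> y then (\<Prod>i<s. (1 - q ^ (y - k + Suc i)) / (1 - q ^ Suc i)) / q ^ (Suc s * y) else 0)"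
      by (rule cumop_pow_kdelta[OF q])
    moreover have "q ^ (Suc s * y) = q ^ y * q ^ (y * s)" by (simp add: power_add mult.commute)
    ultimately show ?thesis using k by (simp only: s if_True prod_dividef N_def qp)
  qed
  ultimately show ?thesis
    unfolding l gauge_def using q(1)
    by (simp add: s divide_inverse inverse_minus_one_power mult_ac) (simp add: field_simps)
qed

text \<open>The explicit term of the kernel is an entry of the inverse power t2 - t1 in disguise;
  reversing its finite product gives the Gaussian binomial of \<open>cumop_pow_kdelta\<close>, and
  the minus sign comes from the ratio of gauges.\<close>

lemma transition_term_eq:
  fixes q :: "'a :: field"
  assumes q: "q \<noteq> 0" "\<And>n. n > 0 \<Longrightarrow> q ^ n \<noteq> 1" and t: "t1 < t2"
  shows "of_bool (int y2 + int t2 > int y1 + int t1)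
       * (q powi ((int t1 - int t2) * (int y1 + int t1))
          * qpoch (q powi (int y1 - int y2 + int t1 - int t2 + 1)) q (t2 - t1 - 1)
          / qpoch q q (t2 - t1 - 1))
     = - (gauge q y1 t1 / gauge q y2 t2 * (cumop q ^^ (t2 - t1)) (kdelta y1) y2)"
proof -
  obtain s where s: "t2 = t1 + Suc s" using t less_iff_Suc_add by auto
  hence e: "t2 - t1 - 1 = s" "t2 - t1 = Suc s" by auto
  have cum: "(cumop q ^^ Suc s) (kdelta y1) y2 = (if y1 \<le> y2 then (\<Prod>i<s. (1 - q ^ (y2 - y1 + Suc i)) / (1 - q ^ Suc i)) / q ^ (Suc s * y2) else 0)"
    by (rule cumop_pow_kdelta[OF q])
  show ?thesis
  proof (cases "y1 \<le> y2")
    case False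
    \<comment> \<open>The indicator can be 1 although y2 < y1, but then the q-Pochhammer symbol
      contains the factor 1 - q^0.\<close>
    have "qpoch (q powi (int y1 - int y2 + int t1 - int t2 + 1)) q s = 0" if "y1 + t1 < y2 + t2"
    proof -
      define j where "j = s - (y1 - y2)"
      have j: "j < s" "int y1 - int y2 + int t1 - int t2 + 1 = - int j" using that False s by (auto simp: j_def)
      have "q powi (- int j) * q ^ j = 1" using q(1) by (simp add: power_int_minus)
      thus ?thesis unfolding qpoch_def j(2) using j(1) by (intro prod_zero) (auto intro!: bexI[of _ j])
    qed
    thus ?thesis using False unfolding e cum by (simp add: of_bool_def)
  next
    case True
    define d where "d = y2 - y1"
    have y2: "y2 = y1 + d" using True by (simp add: d_def)
    define N where "N = (\<Prod>i<s. 1 - q ^ (d + Suc i))"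
    have "qpoch (q powi (int y1 - int y2 + int t1 - int t2 + 1)) q s = (\<Prod>i<s. 1 - 1 / q ^ (d + (s - i)))"
      unfolding qpoch_def
    proof (rule prod.cong[OF refl])
      fix i assume i: "i \<in> {..<s}"
      have "q powi (int y1 - int y2 + int t1 - int t2 + 1) * q ^ i = q powi (- int (d + (s - i)))"
        using q(1) i by (simp flip: power_int_of_nat power_int_add add: of_nat_diff y2 s algebra_simps)
      also have "\<dots> = 1 / q ^ (d + (s - i))"
        by (simp only: power_int_minus power_int_of_nat inverse_eq_divide)
      finally show "1 - q powi (int y1 - int y2 + int t1 - int t2 + 1) * q ^ i = 1 - 1 / q ^ (d + (s - i))" by simp
    qed
    also have "\<dots> = (\<Prod>i<s. 1 - 1 / q ^ (d + Suc i))"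
      by (rule prod.reindex_bij_witness[where i = "\<lambda>i. s - Suc i" and j = "\<lambda>i. s - Suc i"])
         (auto simp: Suc_diff_Suc simp del: power_Suc simp flip: power_Suc)
    also have "\<dots> = (\<Prod>i<s. - (1 - q ^ (d + Suc i)) / q ^ (d + Suc i))"
      using q(1) by (intro prod.cong) (auto simp: diff_divide_distrib)
    also have "\<dots> = (- 1) ^ s * N / (q ^ (d * s) * q ^ (Suc s choose 2))"
      unfolding prod_dividef prod_power_shift N_def by (simp only: prod_uminus card_lessThan)
    finally have l: "qpoch (q powi (int y1 - int y2 + int t1 - int t2 + 1)) q s = (- 1) ^ s * N / (q ^ (d * s) * q ^ (Suc s choose 2))" .
    have qp: "qpoch q q s = (\<Prod>i<s. 1 - q ^ Suc i)" by (simp add: qpoch_def)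
    have r: "(cumop q ^^ (t2 - t1)) (kdelta y1) y2 = N / qpoch q q s / q ^ (Suc s * y2)"
      unfolding e cum using y2 by (simp add: prod_dividef N_def qp del: power_Suc mult_Suc)
    have ch: "(t2 choose 2) = (t1 choose 2) + (Suc s choose 2) + t1 * Suc s"
    proof -
      have "(t1 + n choose 2) = (t1 choose 2) + (n choose 2) + t1 * n" for n
        by (induction n) (simp_all add: Suc_choose_two)
      thus ?thesis by (simp only: s)
    qed
    have p: "q powi ((int t1 - int t2) * (int y1 + int t1)) = 1 / q ^ (Suc s * (y1 + t1))"
    proof -
      have "(int t1 - int t2) * (int y1 + int t1) = - int (Suc s * (y1 + t1))" by (simp add: s algebra_simps)
      thus ?thesis by (simp only: power_int_minus power_int_of_nat inverse_eq_divide)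
    qed
    have g: "gauge q y1 t1 / gauge q y2 t2 = - ((- 1) ^ s * q ^ d / (q ^ (Suc s choose 2) * q ^ (t1 * Suc s)))"
      unfolding gauge_def ch using q(1)
      by (simp add: s y2 power_add divide_inverse inverse_minus_one_power mult_ac)
    have ex: "q ^ (Suc s * (y1 + t1)) * q ^ (d * s) * q ^ d = q ^ (t1 * Suc s) * q ^ (Suc s * y2)"
      by (simp flip: power_add add: y2 algebra_simps)
    have B: "1 / q ^ (Suc s * (y1 + t1)) / q ^ (d * s) = q ^ d / (q ^ (t1 * Suc s) * q ^ (Suc s * y2))"
      unfolding ex[symmetric] using q(1) by simp
    have H: "1 / q ^ (Suc s * (y1 + t1)) * ((- 1) ^ s * N / (q ^ (d * s) * q ^ (Suc s choose 2))) / qpoch q q s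
      = (- 1) ^ s * N / q ^ (Suc s choose 2) / qpoch q q s * (q ^ d / (q ^ (t1 * Suc s) * q ^ (Suc s * y2)))"
      unfolding B[symmetric] by (simp only: divide_inverse inverse_mult_distrib mult_1_left mult_ac)
    have ob: "of_bool (int y2 + int t2 > int y1 + int t1) = (1 :: 'a)" using y2 s by simp
    show ?thesis unfolding e(1) l p r g ob mult_1_left H by (simp add: divide_inverse mult_ac)
  qed
qed

text \<open>Expanding the inverse power in point masses, the part without \<open>lagr\<close>
  recombines to the power t2 - t1 of the inverse. For t2 < t1 this is a positive power of the step
  operator and cancels the subtracted term of \<open>walk_kernel\<close>.\<close>

lemma walk_kernel_eq_sum:
  fixes q :: "'a :: field"
  assumes q: "q \<noteq> 0"
  shows "walk_kernel q x y2 t2 y1 t1 = (if t1 \<le> t2 then (cumop q ^^ (t2 - t1)) (kdelta y1) y2 else 0)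
    - (\<Sum>k\<le>y2. (cumop q ^^ t2) (kdelta k) y2 * ((stepop q ^^ t1) (kdelta y1) k -
         (\<Sum>r<length x. lagr q x r k * (stepop q ^^ t1) (kdelta y1) (x ! r))))"
proof -
  let ?S = "\<lambda>k. (cumop q ^^ t2) (kdelta k) y2"
  have "(\<Sum>r<length x. (cumop q ^^ t2) (lagr q x r) y2 * (stepop q ^^ t1) (kdelta y1) (x ! r))
    = (\<Sum>r<length x. \<Sum>k\<le>y2. ?S k * (lagr q x r k * (stepop q ^^ t1) (kdelta y1) (x ! r)))"
    by (subst cumop_pow_expand) (simp add: sum_distrib_right mult.assoc)
  also have "\<dots> = (\<Sum>k\<le>y2. ?S k * (\<Sum>r<length x. lagr q x r k * (stepop q ^^ t1) (kdelta y1) (x ! r)))"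
    by (subst sum.swap) (simp add: sum_distrib_left)
  finally have 1: "(\<Sum>r<length x. (cumop q ^^ t2) (lagr q x r) y2 * (stepop q ^^ t1) (kdelta y1) (x ! r)) = \<dots>" .
  have 2: "(\<Sum>k\<le>y2. ?S k * (stepop q ^^ t1) (kdelta y1) k) = (cumop q ^^ t2) ((stepop q ^^ t1) (kdelta y1)) y2"
    by (rule cumop_pow_expand[symmetric])
  have "(cumop q ^^ t2) ((stepop q ^^ t1) (kdelta y1)) y2 =
     (if t1 \<le> t2 then (cumop q ^^ (t2 - t1)) (kdelta y1) y2 else (stepop q ^^ (t1 - t2)) (kdelta y1) y2)"
    using cumop_pow_stepop_pow[OF q, of t2 t1] cumop_pow_stepop_pow'[OF q, of t1 t2] by simp
  thus ?thesis unfolding walk_kernel_def 1 right_diff_distrib sum_subtractf 2 by auto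
qed

text \<open>If \<open>y2\<close> exceeds all \<open>x\<^sub>r\<close>, admissibility allows a \<open>w\<close> circle through the pole \<open>q\<^sup>y\<^sup>2\<close>, and then the
  \<open>z\<close> contour encloses this pole. This changes the kernel only when some \<open>x\<^sub>r \<ge> y1\<close>, which
  the last hypothesis excludes; the entries left out do not affect the determinant.\<close>

lemma K_walks_eq_walk_kernel:
  fixes q :: real and x :: "nat list"
  defines "Q \<equiv> complex_of_real q"
  assumes q: "0 < q" "q < 1" and x: "distinct x" and t2: "t2 > 0"
    and adm: "admissible_contours Q x (int y1) t1 (int y2) t2 (\<epsilon> (int y1) t1 (int y2) t2) (\<gamma> (int y1) t1 (int y2) t2)"
    and dich: "(\<exists>a\<in>set x. y2 \<le> a) \<or> (\<forall>a\<in>set x. a < y1)"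
  shows "K_walks Q x \<epsilon> \<gamma> (int y1) t1 (int y2) t2 = gauge Q y1 t1 / gauge Q y2 t2 * walk_kernel Q x y2 t2 y1 t1"
proof -
  have Q0: "Q \<noteq> 0" and Qn: "\<And>n. n > 0 \<Longrightarrow> Q ^ n \<noteq> 1" using q complex_power_neq_one[OF q] by (auto simp: Q_def)
  let ?g = "gauge Q y1 t1 / gauge Q y2 t2"
  let ?S = "\<lambda>k. (cumop Q ^^ t2) (kdelta k) y2"
  define I where "I = contour_integral (circlepath 0 (\<epsilon> (int y1) t1 (int y2) t2)) (\<lambda>w.
     contour_integral (\<gamma> (int y1) t1 (int y2) t2) (\<lambda>z. walks_integrand Q x (int y1) t1 (int y2) t2 w z))"
  define br where "br k = divdiff_weight Q t1 y1 k - (\<Sum>r<length x. lagr Q x r k * divdiff_weight Q t1 y1 (x ! r))" for k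
  define br' where "br' k = (stepop Q ^^ t1) (kdelta y1) k - (\<Sum>r<length x. lagr Q x r k * (stepop Q ^^ t1) (kdelta y1) (x ! r))" for k
  define c where "c = (\<Prod>i<t1. 1 - 1 / Q ^ Suc i)"
  have br': "br' k = c * br k" for k
  proof -
    have "(stepop Q ^^ t1) (kdelta y1) a = c * divdiff_weight Q t1 y1 a" for a
      unfolding c_def by (rule stepop_pow_kdelta[OF Q0 Qn])
    thus ?thesis
      by (simp add: br'_def br_def right_diff_distrib sum_distrib_left mult_ac)
  qed
  have qq: "qpoch Q Q n \<noteq> 0" for n
    using Qn[of "Suc _"] by (simp add: qpoch_def)
  have gq: "Q powi (- int t1 - int y1) * qpoch Q Q t1 = gauge Q y1 t1 * c"
  proof -
    have "Q powi (- int t1 - int y1) = 1 / (Q ^ t1 * Q ^ y1)"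
      using Q0 by (simp add: power_int_diff power_int_minus inverse_eq_divide)
    thus ?thesis unfolding qpoch_self[OF Q0] gauge_def c_def Suc_choose_two power_add using Q0 by simp
  qed
  have "I = - ((2 * pi * \<i>)\<^sup>2 * (qpoch Q Q t1 / qpoch Q Q (t2 - 1)) *
      (\<Sum>k\<le>y2. - (qpoch Q Q (t2 - 1) / gauge Q y2 t2 * ?S k) * br k))"
  proof -
    have "I = - ((2 * pi * \<i>)\<^sup>2 * (qpoch Q Q t1 / qpoch Q Q (t2 - 1)) *
      (\<Sum>k\<le>y2. (\<Prod>i\<in>{y2<..<y2+t2}. 1 / Q ^ k - 1 / Q ^ i) * br k))"
      unfolding I_def br_def Q_def by (rule contour_double_integral[OF q x t2 adm[unfolded Q_def] dich])
    also have "(\<Sum>k\<le>y2. (\<Prod>i\<in>{y2<..<y2+t2}. 1 / Q ^ k - 1 / Q ^ i) * br k)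
        = (\<Sum>k\<le>y2. - (qpoch Q Q (t2 - 1) / gauge Q y2 t2 * ?S k) * br k)"
      by (intro sum.cong refl) (simp only: prod_geometric_nodes[OF Q0 Qn _ t2] atMost_iff)
    finally show ?thesis .
  qed
  also have "(\<Sum>k\<le>y2. - (qpoch Q Q (t2 - 1) / gauge Q y2 t2 * ?S k) * br k)
      = - (qpoch Q Q (t2 - 1) / gauge Q y2 t2) * (\<Sum>k\<le>y2. ?S k * br k)"
    by (simp add: sum_distrib_left sum_negf mult.assoc)
  finally have I: "I = (2 * pi * \<i>)\<^sup>2 * (qpoch Q Q t1 / gauge Q y2 t2) * (\<Sum>k\<le>y2. ?S k * br k)"
    using qq[of "t2 - 1"] by simp
  have "Q powi (- int t1 - int y1) / (2 * pi * \<i>)\<^sup>2 * I = Q powi (- int t1 - int y1) * qpoch Q Q t1 / gauge Q y2 t2 * (\<Sum>k\<le>y2. ?S k * br k)"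
    unfolding I by simp
  also have "\<dots> = ?g * (c * (\<Sum>k\<le>y2. ?S k * br k))" unfolding gq by simp
  also have "c * (\<Sum>k\<le>y2. ?S k * br k) = (\<Sum>k\<le>y2. ?S k * br' k)"
    by (simp add: br' sum_distrib_left mult_ac)
  finally have last: "Q powi (- int t1 - int y1) / (2 * pi * \<i>)\<^sup>2 * I = ?g * (\<Sum>k\<le>y2. ?S k * br' k)" .
  \<comment> \<open>The two explicit terms combine into one inverse power; for t1 = t2 it is the
    identity matrix, and the gauge ratio is then 1 on the diagonal.\<close>
  have first: "of_bool (t1 = t2) * of_bool (int y1 = int y2)
     - of_bool (t2 > t1) * of_bool (int y2 + int t2 > int y1 + int t1)
       * (Q powi ((int t1 - int t2) * (int y1 + int t1))
          * qpoch (Q powi (int y1 - int y2 + int t1 - int t2 + 1)) Q (t2 - t1 - 1)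
          / qpoch Q Q (t2 - t1 - 1))
     = ?g * (if t1 \<le> t2 then (cumop Q ^^ (t2 - t1)) (kdelta y1) y2 else 0)"
  proof -
    consider "t1 < t2" | "t1 = t2" | "t1 > t2" by linarith
    thus ?thesis
    proof cases
      case 1
      thus ?thesis using transition_term_eq[OF Q0 Qn 1, of y1 y2] by (simp add: mult.assoc)
    next
      case 2
      thus ?thesis using gauge_nonzero[OF Q0] by (auto simp: kdelta_def)
    qed simp
  qed
  have "K_walks Q x \<epsilon> \<gamma> (int y1) t1 (int y2) t2 =
     ?g * (if t1 \<le> t2 then (cumop Q ^^ (t2 - t1)) (kdelta y1) y2 else 0) - ?g * (\<Sum>k\<le>y2. ?S k * br' k)"
    unfolding K_walks_def first[symmetric] last[symmetric] I_def by simp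
  thus ?thesis unfolding walk_kernel_eq_sum[OF Q0] br'_def by (simp only: right_diff_distrib)
qed

section \<open>From real to complex scalars, and the comparison of determinants\<close>

lemma of_real_stepop:
  "(of_real (stepop q f a) :: 'a :: {real_algebra_1, field}) = stepop (of_real q) (\<lambda>a. of_real (f a)) a"
  by (simp add: stepop_def)

lemma of_real_stepop_pow:
  "(of_real ((stepop q ^^ n) f a) :: 'a :: {real_algebra_1, field}) = (stepop (of_real q) ^^ n) (\<lambda>a. of_real (f a)) a"
  by (induction n arbitrary: a) (simp_all add: of_real_stepop)

lemma of_real_cumop_pow:
  "(of_real ((cumop q ^^ n) f a) :: 'a :: real_normed_field) = (cumop (of_real q) ^^ n) (\<lambda>a. of_real (f a)) a"
  by (induction n arbitrary: a) (simp_all add: cumop_def)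

lemma of_real_walk_kernel:
  "(of_real (walk_kernel q x u s v t) :: 'a :: real_normed_field) = walk_kernel (of_real q) x u s v t"
proof -
  have k: "of_real (kdelta b a) = (kdelta b a :: 'a)" for a b by (simp add: kdelta_def)
  have "of_real (lagr q x r k) = (lagr (of_real q) x r k :: 'a)" for r k
    by (simp add: lagr_def kap_def)
  thus ?thesis unfolding walk_kernel_def by (simp add: of_real_stepop_pow of_real_cumop_pow k)
qed

text \<open>Walkers never move up, so b cannot be reached from a site below it.\<close>

lemma stepop_pow_kdelta_below:
  "a < b \<Longrightarrow> (stepop q ^^ n) (kdelta b) a = 0"
  by (induction n arbitrary: a) (auto simp: kdelta_def stepop_def)

text \<open>Along a permutation the numerators and denominators of the ratios run through the same
  values.\<close>

lemma det_gauge: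
  fixes K :: "nat \<Rightarrow> nat \<Rightarrow> 'a :: field"
  assumes "\<And>i. i < n \<Longrightarrow> g i \<noteq> 0"
  shows "Determinant.det (Matrix.mat n n (\<lambda>(i, j). g i / g j * K i j)) = Determinant.det (Matrix.mat n n (\<lambda>(i, j). K i j))"
proof -
  have "(\<Prod>i<n. g i / g (p i) * K i (p i)) = (\<Prod>i<n. K i (p i))" if "p permutes {0..<n}" for p
  proof -
    have "(\<Prod>i<n. g (p i)) = (\<Prod>i<n. g i)"
      using prod.permute[OF that, of g] by (simp add: lessThan_atLeast0 o_def)
    moreover have "(\<Prod>i<n. g i) \<noteq> 0" using assms by simp
    ultimately show ?thesis by (simp add: prod.distrib prod_dividef)
  qed
  thus ?thesis unfolding det_mat_perm by (intro sum.cong) auto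
qed

lemma det_zero_row:
  assumes "i < n" "\<And>j. j < n \<Longrightarrow> K i j = 0"
  shows "Determinant.det (Matrix.mat n n (\<lambda>(i, j). K i j) :: 'a :: comm_ring_1 mat) = 0"
proof -
  have "(\<Prod>k<n. K k (p k)) = 0" if "p permutes {0..<n}" for p
    using assms permutes_in_image[OF that, of i] by (intro prod_zero) (auto intro!: bexI[of _ i])
  thus ?thesis unfolding det_mat_perm by (intro sum.neutral) auto
qed

theorem theorem2p10:
  fixes q :: real and m :: nat and x :: "nat list"
    and M :: "'w measure" and Y :: "nat \<Rightarrow> 'w \<Rightarrow> nat list"
    and \<epsilon> :: "int \<Rightarrow> nat \<Rightarrow> int \<Rightarrow> nat \<Rightarrow> real"
    and \<gamma> :: "int \<Rightarrow> nat \<Rightarrow> int \<Rightarrow> nat \<Rightarrow> real \<Rightarrow> complex"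
  assumes "0 < q" and "q < 1" and "m \<ge> 1" and "x \<in> W m"
    and "markov_chain M (W m) (Upsilon q m) x Y"
    and "\<And>y1 t1 y2 t2. t2 > 0 \<Longrightarrow>
           admissible_contours (of_real q) x y1 t1 y2 t2 (\<epsilon> y1 t1 y2 t2) (\<gamma> y1 t1 y2 t2)"
  shows "\<forall>l\<ge>1. \<forall>(u :: nat \<Rightarrow> nat) (t :: nat \<Rightarrow> nat).
           (\<forall>i<l. t i \<ge> 1) \<and> inj_on (\<lambda>i. (u i, t i)) {..<l} \<longrightarrow>
           complex_of_real (measure M {\<omega> \<in> space M. \<forall>i<l. (u i, t i) \<in> configuration m Y \<omega>})
           = Determinant.det (Matrix.mat l l (\<lambda>(i, j).
               K_walks (of_real q) x \<epsilon> \<gamma> (int (u i)) (t i) (int (u j)) (t j)))"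
proof (intro allI impI, elim conjE)
  fix l :: nat and u t :: "nat \<Rightarrow> nat"
  assume t: "\<forall>i<l. t i \<ge> 1" and inj: "inj_on (\<lambda>i. (u i, t i)) {..<l}"
  let ?Q = "complex_of_real q"
  let ?K = "\<lambda>i j. K_walks ?Q x \<epsilon> \<gamma> (int (u i)) (t i) (int (u j)) (t j)"
  let ?k = "\<lambda>i j. walk_kernel ?Q x (u i) (t i) (u j) (t j)"
  have Q0: "?Q \<noteq> 0" using assms(1) by simp
  have dist: "distinct x"
    using assms(4) by (auto simp: W_def sorted_wrt_iff_nth_less distinct_conv_nth) (metis less_irrefl linorder_neqE_nat)
  interpret prob_space M
    using assms(5) unfolding markov_chain_def by (rule conjunct1)
  interpret q_walks M q m x Y
    by unfold_locales (fact assms)+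
  have "measure M {\<omega> \<in> space M. \<forall>i<l. (u i, t i) \<in> configuration m Y \<omega>}
     = Determinant.det (Matrix.mat l l (\<lambda>(i, j). walk_kernel q x (u i) (t i) (u j) (t j)))"
    by (rule walks_correlation[OF _ inj]) (use t in \<open>auto simp: Suc_le_eq\<close>)
  hence "complex_of_real (measure M {\<omega> \<in> space M. \<forall>i<l. (u i, t i) \<in> configuration m Y \<omega>})
     = (\<Sum>p\<in>{p. p permutes {0..<l}}. signof p * (\<Prod>i<l. ?k i (p i)))"
    unfolding det_mat_perm by (simp add: of_real_walk_kernel sign_def)
  also have "\<dots> = Determinant.det (Matrix.mat l l (\<lambda>(i, j). ?k j i))"
    by (rule trans[OF det_mat_perm[symmetric] det_mat_transpose[symmetric]])
  also have "\<dots> = Determinant.det (Matrix.mat l l (\<lambda>(i, j). ?K i j))"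
  \<comment> \<open>If every marked site is bounded by some starting site, all entries can be
    compared. Otherwise some may not be, and both determinants are shown to vanish.\<close>
  proof (cases "\<forall>j<l. \<exists>a\<in>set x. u j \<le> a")
    case True
    have "?K i j = gauge ?Q (u i) (t i) / gauge ?Q (u j) (t j) * ?k j i" if "j < l" for i j
      by (rule K_walks_eq_walk_kernel[OF assms(1,2) dist]) (use t True that assms(6) in \<open>auto simp: Suc_le_eq\<close>)
    hence "Matrix.mat l l (\<lambda>(i, j). ?K i j)
        = Matrix.mat l l (\<lambda>(i, j). gauge ?Q (u i) (t i) / gauge ?Q (u j) (t j) * ?k j i)"
      by (intro eq_matI) auto
    thus ?thesis using det_gauge[of l "\<lambda>i. gauge ?Q (u i) (t i)" "\<lambda>i j. ?k j i"] gauge_nonzero[OF Q0] by simp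
  next
    case False
    \<comment> \<open>The marks above all starting sites, which no walker can occupy. Among them one
      of earliest time is chosen, because the subtracted term of the kernel involves the marks at
      earlier times.\<close>
    define H where "H = {j. j < l \<and> (\<forall>a\<in>set x. a < u j)}"
    have "finite H" "H \<noteq> {}" using False by (auto simp: H_def not_le)
    then obtain i where i: "i \<in> H" and min: "\<And>j. j \<in> H \<Longrightarrow> t i \<le> t j"
      using arg_min_if_finite[of H t] by (metis not_le)
    have il: "i < l" and ix: "\<And>a. a \<in> set x \<Longrightarrow> a < u i" using i by (auto simp: H_def)
    have zero: "?k j i = 0" if j: "j < l" for j
    proof -
      have "u j < u i" if "t j < t i"
      proof -
        have "j \<notin> H" using min[of j] that by auto
        then obtain a where "a \<in> set x" "u j \<le> a" using j by (auto simp: H_def not_less)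
        thus ?thesis using ix[of a] by simp
      qed
      thus ?thesis by (auto simp: walk_kernel_def stepop_pow_kdelta_below ix)
    qed
    \<comment> \<open>In row i all starting sites lie below u i, so the second alternative of
      \<open>K_walks_eq_walk_kernel\<close> applies to the whole row.\<close>
    have "?K i j = 0" if j: "j < l" for j
    proof -
      have "?K i j = gauge ?Q (u i) (t i) / gauge ?Q (u j) (t j) * ?k j i"
        by (rule K_walks_eq_walk_kernel[OF assms(1,2) dist]) (use t j ix assms(6) in \<open>auto simp: Suc_le_eq\<close>)
      thus ?thesis using zero[OF j] by simp
    qed
    thus ?thesis using det_zero_row[OF il, of ?K] det_zero_row[OF il, of "\<lambda>i j. ?k j i"] zero by simp
  qed
  finally show "complex_of_real (measure M {\<omega> \<in> space M. \<forall>i<l. (u i, t i) \<in> configuration m Y \<omega>})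
           = Determinant.det (Matrix.mat l l (\<lambda>(i, j). ?K i j))" .
qed

end
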